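(* Let $\mathsf{k}$ be an infinite field and let $P$ be a partition of $n$. If $r(P)=3$, then $$Q(P)=(i(Q(P)),\ n-i(Q(P))-\mu(P),\ \mu(P)),$$ where $i(Q(P))$ denotes the largest part (the index) of $Q(P)$.
   Context: The partition $Q(P)$. Let $\mathsf{k}$ be an infinite field, $P$ a partition of $n$, and $B=J_P$ the $n\times n$ nilpotent Jordan matrix with Jordan block partition $P$. Let $\mathcal{C}_B=\{A\in \mathrm{Mat}_n(\mathsf{k}): AB=BA\}$ and $\mathcal{N}_B=\{A\in\mathcal{C}_B: A^n=0\}$. $\mathcal{N}_B$ is an irreducible algebraic variety, and $Q(P)$ is the Jordan type of a generic element of $\mathcal{N}_B$, i.e. the unique partition of $n$ that is the Jordan type of all elements of some nonempty Zariski-open subset of $\mathcal{N}_B$. The number $r(P)$. A partition is almost rectangular if its largest and smallest parts differ by at most $1$. $r(P)$ is the minimum number of almost rectangular subpartitions in a decomposition of $P$ as a union (multiset union of parts) of almost rectangular subpartitions. The invariant $\mu(P)$. In the notation $P=(p_s^{n_s},\dots,p_1^{n_1})$, $n_i$ is the multiplicity of the part $p_i$. An $s$-spread (or spread) is a partition $P=(p_s^{n_s},\dots,p_1^{n_1})$ with $p_1>0$, $p_{i+1}=p_i+1$ for $1\le i<s$, and $n_i>0$ for all $i$; then $r(P)=\lceil s/2\rceil$. For an $s$-spread with smallest part $p=p_1$, put $n_{s+1}=0$ and $\mu(P)=\min\{p\,n_{2i-1}+(p+1)\,n_{2j} : 1\le i\le j\le r(P)\}$. For an arbitrary partition write $P=P_\ell\cup\cdots\cup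 P_1$ where each $P_k$ is a spread and the largest part of $P_k$ is at most the smallest part of $P_{k+1}$ minus $2$. With $\bar r_k=\sum_{i=1}^{k-1} r(P_i)$, define $\mu(P)=\min\{\mu(P_k-2\bar r_k): 1\le k\le \ell\}$, where $P-c$ denotes the partition obtained from $P$ by subtracting $c$ from each part. *)

theory Defs
  imports
    "HOL-Library.Multiset"
    "Jordan_Normal_Form.Jordan_Normal_Form"
begin

section \<open>Partitions\<close>

definition partition_of :: "nat \<Rightarrow> nat multiset \<Rightarrow> bool" where
  "partition_of n P \<longleftrightarrow> 0 \<notin># P \<and> sum_mset P = n"

text \<open>The parts in weakly decreasing order, with repetitions.\<close>

definition parts :: "nat multiset \<Rightarrow> nat list" where
  "parts P = rev (sorted_list_of_multiset P)"

definition index :: "nat multiset \<Rightarrow> nat" where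
  "index P = Max_mset P"

definition almost_rectangular :: "nat multiset \<Rightarrow> bool" where
  "almost_rectangular R \<longleftrightarrow> R \<noteq> {#} \<and> Max_mset R - Min_mset R \<le> 1"

definition ar_number :: "nat multiset \<Rightarrow> nat" where
  "ar_number P = (LEAST r. \<exists>D. size D = r \<and> (\<forall>R\<in>#D. almost_rectangular R) \<and> sum_mset D = P)"


section \<open>The nilpotent commutator and its generic Jordan type\<close>

definition nilp_jordan_list :: "nat multiset \<Rightarrow> (nat \<times> 'a::zero) list" where
  "nilp_jordan_list P = map (\<lambda>p. (p, 0)) (parts P)"

definition nilp_jordan_matrix :: "nat multiset \<Rightarrow> 'a::{zero,one} mat" where
  "nilp_jordan_matrix P = jordan_matrix (nilp_jordan_list P)"

definition has_jordan_type :: "'a::semiring_1 mat \<Rightarrow> nat multiset \<Rightarrow> bool" where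
  "has_jordan_type A P \<longleftrightarrow> jordan_nf A (nilp_jordan_list P)"

definition commutator :: "nat \<Rightarrow> 'a::semiring_1 mat \<Rightarrow> 'a mat set" where
  "commutator n B = {A \<in> carrier_mat n n. A * B = B * A}"

definition nilp_commutator :: "nat \<Rightarrow> 'a::semiring_1 mat \<Rightarrow> 'a mat set" where
  "nilp_commutator n B = {A \<in> commutator n B. A ^\<^sub>m n = 0\<^sub>m n n}"

text \<open>
  Polynomial functions in the \<open>n\<^sup>2\<close> matrix entries. Zero loci depend only on the functions
  induced by polynomials, so these suffice to describe the Zariski topology.
\<close>

inductive_set poly_functions :: "nat \<Rightarrow> ('a::comm_ring_1 mat \<Rightarrow> 'a) set" for n :: nat where
  const: "(\<lambda>A. c) \<in> poly_functions n"
| entry: "i < n \<Longrightarrow> j < n \<Longrightarrow> (\<lambda>A. A $$ (i, j)) \<in> poly_functions n"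
| add: "f \<in> poly_functions n \<Longrightarrow> g \<in> poly_functions n \<Longrightarrow> (\<lambda>A. f A + g A) \<in> poly_functions n"
| mult: "f \<in> poly_functions n \<Longrightarrow> g \<in> poly_functions n \<Longrightarrow> (\<lambda>A. f A * g A) \<in> poly_functions n"

definition zariski_closed :: "nat \<Rightarrow> 'a::comm_ring_1 mat set \<Rightarrow> bool" where
  "zariski_closed n Z \<longleftrightarrow>
     (\<exists>F \<subseteq> poly_functions n. Z = {A \<in> carrier_mat n n. \<forall>f\<in>F. f A = 0})"

text \<open>\<open>U\<close> is open in the subspace topology that \<open>V\<close> inherits from the matrix space.\<close>

definition zariski_open_in :: "nat \<Rightarrow> 'a::comm_ring_1 mat set \<Rightarrow> 'a mat set \<Rightarrow> bool" where
  "zariski_open_in n V U \<longleftrightarrow> (\<exists>Z. zariski_closed n Z \<and> U = V - Z)"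

definition is_generic_jordan_type :: "nat \<Rightarrow> 'a::comm_ring_1 mat set \<Rightarrow> nat multiset \<Rightarrow> bool" where
  "is_generic_jordan_type n V Q \<longleftrightarrow>
     partition_of n Q \<and>
     (\<exists>U. zariski_open_in n V U \<and> U \<noteq> {} \<and> (\<forall>A\<in>U. has_jordan_type A Q))"

text \<open>
  The partition \<open>Q(P)\<close> over the field given by the type argument. Its existence and uniqueness
  for infinite fields come from the irreducibility of the nilpotent commutator.
\<close>

definition generic_partition :: "'a::field itself \<Rightarrow> nat multiset \<Rightarrow> nat multiset" where
  "generic_partition _ P =
     (THE Q. is_generic_jordan_type (sum_mset P)
        (nilp_commutator (sum_mset P) (nilp_jordan_matrix P :: 'a mat)) Q)"


section \<open>The invariant \<open>\<mu>\<close>\<close>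

definition spread :: "nat multiset \<Rightarrow> bool" where
  "spread S \<longleftrightarrow> (\<exists>p s. p > 0 \<and> s > 0 \<and> set_mset S = {p..<p + s})"

text \<open>
  For a spread \<open>S\<close> with smallest part \<open>p\<close>, the multiplicity \<open>n\<^sub>k\<close> of its \<open>k\<close>-th smallest part
  is \<open>count S (p + k - 1)\<close>; the convention \<open>n\<^sub>s\<^sub>+\<^sub>1 = 0\<close> is then automatic.
\<close>

definition spread_mult :: "nat multiset \<Rightarrow> nat \<Rightarrow> nat" where
  "spread_mult S k = count S (Min_mset S + k - 1)"

definition spread_mu :: "nat multiset \<Rightarrow> nat" where
  "spread_mu S =
     Min {Min_mset S * spread_mult S (2 * i - 1) + (Min_mset S + 1) * spread_mult S (2 * j) | i j.
            1 \<le> i \<and> i \<le> j \<and> j \<le> ar_number S}"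

text \<open>
  The list \<open>[P\<^sub>1, \<dots>, P\<^sub>l]\<close>, starting with the spread that contains the smallest parts.
  It exists and is unique as soon as 0 is not a part: the spreads collect the parts lying in
  the maximal intervals of \<open>set_mset P\<close>.
\<close>

definition spread_decomposition :: "nat multiset \<Rightarrow> nat multiset list \<Rightarrow> bool" where
  "spread_decomposition P Ss \<longleftrightarrow>
     sum_list Ss = P \<and> (\<forall>S\<in>set Ss. spread S) \<and>
     successively (\<lambda>S T. Max_mset S + 2 \<le> Min_mset T) Ss"

definition spreads :: "nat multiset \<Rightarrow> nat multiset list" where
  "spreads P = (THE Ss. spread_decomposition P Ss)"

definition shift_down :: "nat \<Rightarrow> nat multiset \<Rightarrow> nat multiset" where
  "shift_down c P = image_mset (\<lambda>p. p - c) P"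

text \<open>
  List positions start at 0, so \<open>\<Sum>i<k\<close> runs over the spreads strictly below \<open>spreads P ! k\<close>.
  The subtraction never truncates: the parts of \<open>spreads P ! k\<close> exceed twice that sum.
\<close>

definition mu :: "nat multiset \<Rightarrow> nat" where
  "mu P =
     Min {spread_mu (shift_down (2 * (\<Sum>i<k. ar_number (spreads P ! i))) (spreads P ! k)) | k.
            k < length (spreads P)}"

end

theory Submission
  imports Defs "Jordan_Normal_Form.Jordan_Normal_Form_Existence"
begin

text \<open>
  Up to conjugation in the centralizer of \<open>J\<close>, every element of the nilpotent commutator lies in the
  linear space \<open>tri\<close> of elements that are triangular for the order \<open>prec\<close>. Joining two elements of
  \<open>tri\<close> by a line shows that the generic Jordan type \<open>Q\<close> is attained in \<open>tri\<close> and that there it minimizes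
  the dimensions of the kernels of all powers; the kernel of the \<open>k\<close>-th power has dimension
  \<open>\<Sum>q\<in>#Q. min k q\<close>.

  If \<open>r(P) = 3\<close>, then the parts of \<open>P\<close> lie in three pairs of consecutive numbers, and the order \<open>prec\<close>
  contains three chains of length \<open>\<mu> = \<mu>(P)\<close> such that elements at the same position of different chains
  are incomparable; therefore the \<open>\<mu>\<close>-th power of any element of \<open>tri\<close> has a kernel of dimension at
  least \<open>3 \<mu>\<close>. Conversely, some elements of \<open>tri\<close> degenerate to a nilpotent matrix
  that moves all but \<open>\<mu>\<close> of the basis vectors along two strings, so that the kernel of the \<open>k\<close>-th power has
  dimension at most \<open>\<mu> + 2 k\<close>; and likewise three strings suffice to move all the basis vectors.
  Hence \<open>Q\<close> has exactly three parts, and the smallest one is \<open>\<mu>\<close>.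
\<close>

section \<open>Corank certificates\<close>

text \<open>An element of the commutator is \<open>t\<close>-linear: a map between two Jordan blocks
  acts at all heights at once. The strings behind the upper bound, however, must leave a row
  upwards, downwards or along depending on its height, which no such matrix does literally. So each
  entry carries a power of a parameter, and conjugation by a diagonal matrix turns its exponent into
  one that depends on the height; at parameter 0 only the desired edges remain. The limit may leave
  the commutator, but an upper bound on a kernel dimension is an open condition and survives at some
  nonzero parameter. Three exponents \<open>k\<close> suffice: \<open>k = 1\<close> and
  \<open>k = \<mu>\<close> force exactly three parts, each at least \<open>\<mu>\<close>, and
  \<open>k = \<mu> + 1\<close> bounds the smallest one by \<open>\<mu>\<close>. Since the generic
  type minimizes every kernel dimension separately, different \<open>k\<close> may be settled by
  different matrices. The field is only known to be infinite; hence genericity is tested along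
  polynomial curves, where two nonzero polynomials have a common nonroot.\<close>

text \<open>
  Over a field, \<open>corank_le n F d\<close> and \<open>corank_ge n F e\<close> say that the kernel of \<open>F\<close> has dimension at
  most \<open>d\<close> and at least \<open>e\<close>: a perturbation of rank at most \<open>d\<close> makes \<open>F\<close> invertible, respectively
  \<open>F\<close> factors through a space of dimension \<open>n - e\<close>. In the first form the bound is visibly open.
\<close>

definition rows_in :: "nat set \<Rightarrow> 'a::zero mat \<Rightarrow> bool" where
  "rows_in D M \<longleftrightarrow> (\<forall>i<dim_row M. \<forall>j<dim_col M. i \<notin> D \<longrightarrow> M $$ (i, j) = 0)"

definition corank_le :: "nat \<Rightarrow> 'a::comm_ring_1 mat \<Rightarrow> nat \<Rightarrow> bool" where
  "corank_le n F d \<longleftrightarrow> (\<exists>K R D. K \<in> carrier_mat n n \<and> R \<in> carrier_mat n n \<and> D \<subseteq> {..<n} \<and>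
     card D \<le> d \<and> rows_in D R \<and> det (F + K * R) \<noteq> 0)"

definition corank_ge :: "nat \<Rightarrow> 'a::comm_ring_1 mat \<Rightarrow> nat \<Rightarrow> bool" where
  "corank_ge n F e \<longleftrightarrow> (\<exists>Y Z D. Y \<in> carrier_mat n n \<and> Z \<in> carrier_mat n n \<and> D \<subseteq> {..<n} \<and>
     card D + e \<le> n \<and> rows_in D Z \<and> F = Y * Z)"

lemma rows_in_mult:
  assumes "rows_in D R" "R \<in> carrier_mat n n" "P \<in> carrier_mat n n"
  shows "rows_in D (R * P :: 'a::comm_ring_1 mat)"
  using assms unfolding rows_in_def
  by (auto simp: scalar_prod_def intro!: sum.neutral)

text \<open>The possibly nonzero rows of \<open>Z\<close> and \<open>R\<close>, fewer than
  \<open>n\<close> in all, fit into one square matrix with a row to spare. Leaving that row zero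
  makes the determinant vanish, which replaces a dimension count.\<close>

lemma common_kernel_vector:
  fixes Z R :: "'a::field mat"
  assumes Z: "Z \<in> carrier_mat n n" and R: "R \<in> carrier_mat n n"
    and D1: "D1 \<subseteq> {..<n}" "rows_in D1 Z" and D2: "D2 \<subseteq> {..<n}" "rows_in D2 R"
    and card: "card D1 + card D2 < n"
  obtains x where "x \<in> carrier_vec n" "x \<noteq> 0\<^sub>v n" "Z *\<^sub>v x = 0\<^sub>v n" "R *\<^sub>v x = 0\<^sub>v n"
proof -
  have fin: "finite D1" "finite D2" using D1 D2 finite_subset by blast+
  let ?D = "D1 <+> D2"
  have cD: "card ?D = card D1 + card D2" using fin by (simp add: card_Plus)
  obtain f where f: "f ` ?D \<subseteq> {..<n}" "inj_on f ?D"
    using card_le_inj[of ?D "{..<n}"] fin card cD by auto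
  have "card (f ` ?D) < n" using card_image[OF f(2)] card cD by simp
  then obtain k where k: "k < n" "k \<notin> f ` ?D"
    using f(1) by (metis card_lessThan lessThan_iff psubsetI psubset_imp_ex_mem subset_antisym less_irrefl subsetI)
  define M where "M = mat n n (\<lambda>(i, j). if i \<in> f ` ?D then
     (case inv_into ?D f i of Inl a \<Rightarrow> Z $$ (a, j) | Inr b \<Rightarrow> R $$ (b, j)) else 0)"
  have M: "M \<in> carrier_mat n n" by (simp add: M_def)
  have "row M k = 0\<^sub>v n" using k by (intro eq_vecI) (auto simp: M_def)
  then have "M = mat\<^sub>r n n (\<lambda>i. if i = k then 0\<^sub>v n else row M i)"
    using M by (intro eq_matI) (auto simp flip: index_row(1))
  then have "det M = 0"
    using det_row_0[OF k(1), of "\<lambda>i. row M i"] M by fastforce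
  then obtain x where x: "x \<in> carrier_vec n" "x \<noteq> 0\<^sub>v n" "M *\<^sub>v x = 0\<^sub>v n"
    using det_0_iff_vec_prod_zero_field[OF M] by blast
  have rowM: "row M (f (Inl a)) = row Z a" if "a \<in> D1" for a
  proof -
    have "Inl a \<in> ?D" using that by auto
    moreover have "a < n" using D1 that by auto
    ultimately show ?thesis using f Z by (intro eq_vecI) (auto simp: M_def inv_into_f_f image_subset_iff)
  qed
  have rowM': "row M (f (Inr a)) = row R a" if "a \<in> D2" for a
  proof -
    have "Inr a \<in> ?D" using that by auto
    moreover have "a < n" using D2 that by auto
    ultimately show ?thesis using f R by (intro eq_vecI) (auto simp: M_def inv_into_f_f image_subset_iff)
  qed
  have Mx: "row M i \<bullet> x = 0" if "i < n" for i
    using arg_cong[OF x(3), of "\<lambda>v. v $ i"] that M by auto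
  have "Z *\<^sub>v x = 0\<^sub>v n"
  proof (intro eq_vecI)
    fix i assume i: "i < dim_vec (0\<^sub>v n :: 'a vec)"
    show "(Z *\<^sub>v x) $ i = 0\<^sub>v n $ i"
    proof (cases "i \<in> D1")
      case True
      then have "f (Inl i) < n" using f(1) by (auto simp: image_subset_iff)
      then show ?thesis using rowM[OF True] Mx[of "f (Inl i)"] i Z by auto
    next
      case False
      then have "row Z i = 0\<^sub>v n" using D1(2) i Z unfolding rows_in_def by (intro eq_vecI) auto
      then show ?thesis using i Z x by auto
    qed
  qed (use Z in auto)
  moreover have "R *\<^sub>v x = 0\<^sub>v n"
  proof (intro eq_vecI)
    fix i assume i: "i < dim_vec (0\<^sub>v n :: 'a vec)"
    show "(R *\<^sub>v x) $ i = 0\<^sub>v n $ i"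
    proof (cases "i \<in> D2")
      case True
      then have "f (Inr i) < n" using f(1) by (auto simp: image_subset_iff)
      then show ?thesis using rowM'[OF True] Mx[of "f (Inr i)"] i R by auto
    next
      case False
      then have "row R i = 0\<^sub>v n" using D2(2) i R unfolding rows_in_def by (intro eq_vecI) auto
      then show ?thesis using i R x by auto
    qed
  qed (use R in auto)
  ultimately show ?thesis using that x by blast
qed

text \<open>A vector killed by both \<open>Z\<close> and \<open>R\<close> is killed by
  \<open>F + K * R\<close>, and there is a nonzero one as soon as \<open>e > d\<close>. This
  comparison of the two certificates stands in for rank arithmetic.\<close>

lemma corank_ge_le:
  fixes F :: "'a::field mat"
  assumes "corank_ge n F e" "corank_le n F d"
  shows "e \<le> d"
proof (rule ccontr)
  assume "\<not> e \<le> d"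
  obtain Y Z D1 where 1: "Y \<in> carrier_mat n n" "Z \<in> carrier_mat n n" "D1 \<subseteq> {..<n}"
     "card D1 + e \<le> n" "rows_in D1 Z" "F = Y * Z" using assms(1) unfolding corank_ge_def by blast
  obtain K R D2 where 2: "K \<in> carrier_mat n n" "R \<in> carrier_mat n n" "D2 \<subseteq> {..<n}"
     "card D2 \<le> d" "rows_in D2 R" "det (F + K * R) \<noteq> 0" using assms(2) unfolding corank_le_def by blast
  have "card D1 + card D2 < n" using 1 2 \<open>\<not> e \<le> d\<close> by linarith
  then obtain x where x: "x \<in> carrier_vec n" "x \<noteq> 0\<^sub>v n" "Z *\<^sub>v x = 0\<^sub>v n" "R *\<^sub>v x = 0\<^sub>v n"
    using common_kernel_vector 1 2 by metis
  have "(F + K * R) *\<^sub>v x = Y *\<^sub>v (Z *\<^sub>v x) + K *\<^sub>v (R *\<^sub>v x)"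
    using 1 2 x by (simp add: add_mult_distrib_mat_vec[of _ n n] assoc_mult_mat_vec[of _ n n _ n])
  also have "\<dots> = 0\<^sub>v n"
  proof -
    have "M *\<^sub>v 0\<^sub>v n = 0\<^sub>v n" if "M \<in> carrier_mat n n" for M :: "'a mat"
      using that by (intro eq_vecI) auto
    then show ?thesis using 1 2 x by simp
  qed
  finally have "det (F + K * R) = 0"
    using det_0_iff_vec_prod_zero_field[of "F + K * R" n] x 1 2 by auto
  with 2 show False by simp
qed

lemma mat_mult5:
  assumes "(Q :: 'a::comm_ring_1 mat) \<in> carrier_mat n n" "F \<in> carrier_mat n n" "K \<in> carrier_mat n n"
    "R \<in> carrier_mat n n" "P \<in> carrier_mat n n"
  shows "Q * F * P + (Q * K) * (R * P) = Q * (F + K * R) * P"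
proof -
  have "Q * (F + K * R) * P = (Q * F + Q * (K * R)) * P"
    using assms by (simp add: mult_add_distrib_mat[of _ n n])
  also have "\<dots> = Q * F * P + Q * (K * R) * P"
    using assms by (intro add_mult_distrib_mat[of _ n n]) auto
  also have "Q * (K * R) * P = (Q * K) * (R * P)"
    using assms by (simp add: assoc_mult_mat[of _ n n _ n _ n])
  finally show ?thesis by simp
qed

lemma corank_le_similar:
  fixes F G :: "'a::field mat"
  assumes F: "F \<in> carrier_mat n n" and sim: "similar_mat F G" and le: "corank_le n F d"
  shows "corank_le n G d"
proof -
  obtain P Q where w: "similar_mat_wit F G P Q" using sim unfolding similar_mat_def by blast
  note w = similar_mat_witD2[OF F w]
  have c: "G \<in> carrier_mat n n" "P \<in> carrier_mat n n" "Q \<in> carrier_mat n n" using w by auto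
  have G: "G = Q * F * P"
  proof -
    have "Q * F * P = (Q * P) * (G * (Q * P))" using c w(3) by (simp add: assoc_mult_mat[of _ n n _ n _ n])
    then show ?thesis using w(2) c by simp
  qed
  obtain K R D where 2: "K \<in> carrier_mat n n" "R \<in> carrier_mat n n" "D \<subseteq> {..<n}"
     "card D \<le> d" "rows_in D R" "det (F + K * R) \<noteq> 0" using le unfolding corank_le_def by blast
  have "det Q * det P = 1" using det_mult[of Q n P] c w by (simp add: w(2))
  then have nz: "det Q \<noteq> 0" "det P \<noteq> 0" by auto
  have "G + (Q * K) * (R * P) = Q * (F + K * R) * P"
    unfolding G by (rule mat_mult5) (use c F 2 in auto)
  then have "det (G + (Q * K) * (R * P)) = det Q * det (F + K * R) * det P"
    using c F 2 by (simp add: det_mult[of _ n])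
  then have "det (G + (Q * K) * (R * P)) \<noteq> 0" using nz 2 by simp
  moreover have "rows_in D (R * P)" using rows_in_mult 2 c by blast
  ultimately show ?thesis unfolding corank_le_def
    using 2(1-4) c by (intro exI[of _ "Q * K"] exI[of _ "R * P"] exI[of _ D] conjI) (simp_all del: assoc_mult_mat)
qed

lemma corank_ge_similar:
  fixes F G :: "'a::field mat"
  assumes F: "F \<in> carrier_mat n n" and sim: "similar_mat F G" and ge: "corank_ge n F e"
  shows "corank_ge n G e"
proof -
  obtain P Q where w: "similar_mat_wit F G P Q" using sim unfolding similar_mat_def by blast
  note w = similar_mat_witD2[OF F w]
  have c: "G \<in> carrier_mat n n" "P \<in> carrier_mat n n" "Q \<in> carrier_mat n n" using w by auto
  obtain Y Z D where 1: "Y \<in> carrier_mat n n" "Z \<in> carrier_mat n n" "D \<subseteq> {..<n}"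
     "card D + e \<le> n" "rows_in D Z" "F = Y * Z" using ge unfolding corank_ge_def by blast
  have "G = (Q * Y) * (Z * P)"
  proof -
    have "(Q * Y) * (Z * P) = Q * F * P" unfolding 1(6)
      using c 1 by (simp add: assoc_mult_mat[of _ n n _ n _ n])
    also have "\<dots> = (Q * P) * (G * (Q * P))" using c w(3) by (simp add: assoc_mult_mat[of _ n n _ n _ n])
    finally show ?thesis using w(2) c by simp
  qed
  moreover have "rows_in D (Z * P)" using rows_in_mult 1 c by blast
  ultimately show ?thesis unfolding corank_ge_def
    using 1(1-4) c by (intro exI[of _ "Q * Y"] exI[of _ "Z * P"] exI[of _ D] conjI) (simp_all del: assoc_mult_mat)
qed

lemma det_permutation_matrix_nonzero:
  assumes "bij_betw \<tau> {..<n} {..<n}"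
  shows "det (mat n n (\<lambda>(i, j). if i = \<tau> j then 1 else 0 :: 'a::field)) \<noteq> 0"
proof -
  let ?M = "mat n n (\<lambda>(i, j). if i = \<tau> j then 1 else 0 :: 'a)"
  have "transpose_mat ?M * ?M = 1\<^sub>m n"
  proof (intro eq_matI)
    fix i j assume ij: "i < dim_row (1\<^sub>m n :: 'a mat)" "j < dim_col (1\<^sub>m n :: 'a mat)"
    have ti: "\<tau> i < n" using assms ij by (auto simp: bij_betw_def)
    have inj: "\<tau> i = \<tau> j \<longleftrightarrow> i = j" using assms ij by (auto simp: bij_betw_def inj_on_def)
    have "(transpose_mat ?M * ?M) $$ (i, j) = (\<Sum>k<n. (if k = \<tau> i then 1 else 0) * (if k = \<tau> j then 1 else 0))"
      using ij by (auto simp: scalar_prod_def lessThan_atLeast0)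
    also have "\<dots> = (\<Sum>k<n. if k = \<tau> i then (if \<tau> i = \<tau> j then 1 else 0) else 0)"
      by (rule sum.cong) auto
    also have "\<dots> = (if \<tau> i = \<tau> j then 1 else 0)" using ti by simp
    finally show "(transpose_mat ?M * ?M) $$ (i, j) = 1\<^sub>m n $$ (i, j)" using ij inj by simp
  qed auto
  then have "det (transpose_mat ?M) * det ?M = 1"
    using det_mult[of "transpose_mat ?M" n ?M] by simp
  then show ?thesis by auto
qed

text \<open>The injection \<open>p\<close> extends to a permutation. Replacing the columns outside
  \<open>X\<close> by those of the permutation matrix is a perturbation of rank at most
  \<open>n - card X\<close>.\<close>

lemma corank_le_unit_columns:
  fixes F :: "'a::field mat"
  assumes F: "F \<in> carrier_mat n n" and X: "X \<subseteq> {..<n}" and p: "p ` X \<subseteq> {..<n}" "inj_on p X"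
    and col: "\<And>x i. x \<in> X \<Longrightarrow> i < n \<Longrightarrow> F $$ (i, x) = (if i = p x then 1 else 0)"
    and d: "n \<le> d + card X"
  shows "corank_le n F d"
proof -
  have fin: "finite X" using X finite_subset by blast
  have "card ({..<n} - X) = card ({..<n} - p ` X)"
    using X p fin by (simp add: card_Diff_subset card_image)
  then obtain b where b: "bij_betw b ({..<n} - X) ({..<n} - p ` X)"
    using finite_same_card_bij by (metis finite_Diff finite_lessThan)
  define \<tau> where "\<tau> j = (if j \<in> X then p j else b j)" for j
  have "bij_betw \<tau> (X \<union> ({..<n} - X)) (p ` X \<union> ({..<n} - p ` X))"
  proof (rule bij_betw_combine)
    show "bij_betw \<tau> X (p ` X)" using p by (auto simp: bij_betw_def \<tau>_def inj_on_def)
    show "bij_betw \<tau> ({..<n} - X) ({..<n} - p ` X)"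
      using b by (rule bij_betw_cong[THEN iffD1, rotated]) (auto simp: \<tau>_def)
  qed auto
  then have bij: "bij_betw \<tau> {..<n} {..<n}" using X p by (simp add: Un_absorb1 Un_Diff_cancel)
  define K where "K = mat n n (\<lambda>(i, j). (if i = \<tau> j then 1 else 0) - F $$ (i, j))"
  define R where "R = mat n n (\<lambda>(i, j). if i = j \<and> i \<notin> X then 1 else 0 :: 'a)"
  have c: "K \<in> carrier_mat n n" "R \<in> carrier_mat n n" by (auto simp: K_def R_def)
  have "F + K * R = mat n n (\<lambda>(i, j). if i = \<tau> j then 1 else 0)"
  proof (intro eq_matI)
    fix i j
    assume "i < dim_row (mat n n (\<lambda>(i, j). if i = \<tau> j then 1 else 0 :: 'a))"
      "j < dim_col (mat n n (\<lambda>(i, j). if i = \<tau> j then 1 else 0 :: 'a))"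
    then have ij: "i < n" "j < n" by auto
    have "(K * R) $$ (i, j) = (\<Sum>k<n. K $$ (i, k) * (if k = j \<and> k \<notin> X then 1 else 0))"
      using ij by (auto simp: scalar_prod_def lessThan_atLeast0 K_def R_def)
    also have "\<dots> = (\<Sum>k<n. if k = j then (if j \<notin> X then K $$ (i, j) else 0) else 0)"
      by (rule sum.cong) auto
    also have "\<dots> = (if j \<notin> X then K $$ (i, j) else 0)" using ij by simp
    finally show "(F + K * R) $$ (i, j) = mat n n (\<lambda>(i, j). if i = \<tau> j then 1 else 0) $$ (i, j)"
      using ij F c col[of j i] by (auto simp: K_def \<tau>_def)
  qed (use F c in auto)
  then have "det (F + K * R) \<noteq> 0" using det_permutation_matrix_nonzero[OF bij] by simp
  moreover have "rows_in ({..<n} - X) R" by (auto simp: rows_in_def R_def)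
  moreover have "card ({..<n} - X) \<le> d" using d X fin by (simp add: card_Diff_subset)
  ultimately show ?thesis unfolding corank_le_def using c
    by (intro exI[of _ K] exI[of _ R] exI[of _ "{..<n} - X"]) simp
qed

lemma corank_ge_zero_columns:
  fixes F :: "'a::field mat"
  assumes F: "F \<in> carrier_mat n n" and X: "X \<subseteq> {..<n}"
    and col: "\<And>x i. x < n \<Longrightarrow> x \<notin> X \<Longrightarrow> i < n \<Longrightarrow> F $$ (i, x) = 0"
    and e: "card X + e \<le> n"
  shows "corank_ge n F e"
proof -
  define R where "R = mat n n (\<lambda>(i, j). if i = j \<and> i \<in> X then 1 else 0 :: 'a)"
  have "F = F * R"
  proof (intro eq_matI)
    fix i j assume "i < dim_row (F * R)" "j < dim_col (F * R)"
    then have ij: "i < n" "j < n" using F by (auto simp: R_def)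
    have "(F * R) $$ (i, j) = (\<Sum>k<n. F $$ (i, k) * (if k = j \<and> k \<in> X then 1 else 0))"
      using ij F by (auto simp: scalar_prod_def lessThan_atLeast0 R_def)
    also have "\<dots> = (\<Sum>k<n. if k = j then (if j \<in> X then F $$ (i, j) else 0) else 0)"
      by (rule sum.cong) auto
    also have "\<dots> = F $$ (i, j)" using ij col[of j i] by simp
    finally show "F $$ (i, j) = (F * R) $$ (i, j)" by simp
  qed (use F in \<open>auto simp: R_def\<close>)
  moreover have "rows_in X R" by (auto simp: rows_in_def R_def)
  ultimately show ?thesis unfolding corank_ge_def
    using F X e by (intro exI[of _ F] exI[of _ R] exI[of _ X]) (auto simp: R_def)
qed

lemma similar_mat_reindex:
  fixes A B :: "'a::field mat"
  assumes A: "A \<in> carrier_mat n n" and B: "B \<in> carrier_mat n n" and t: "bij_betw t {..<n} {..<n}"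
    and AB: "\<And>i j. i < n \<Longrightarrow> j < n \<Longrightarrow> A $$ (i, j) = B $$ (t i, t j)"
  shows "similar_mat A B"
proof -
  let ?P = "mat n n (\<lambda>(i, j). if j = t i then 1 else 0 :: 'a)"
  let ?Q = "mat n n (\<lambda>(i, j). if i = t j then 1 else 0 :: 'a)"
  have tn: "t i < n" if "i < n" for i using t that by (auto simp: bij_betw_def)
  have inj: "t i = t j \<longleftrightarrow> i = j" if "i < n" "j < n" for i j
    using t that by (auto simp: bij_betw_def inj_on_def)
  have PQ: "?P * ?Q = 1\<^sub>m n"
  proof (intro eq_matI)
    fix i j assume "i < dim_row (1\<^sub>m n :: 'a mat)" "j < dim_col (1\<^sub>m n :: 'a mat)"
    then have ij: "i < n" "j < n" by auto
    have "(?P * ?Q) $$ (i, j) = (\<Sum>k<n. (if k = t i then 1 else 0) * (if k = t j then 1 else 0))"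
      using ij by (auto simp: scalar_prod_def lessThan_atLeast0)
    also have "\<dots> = (\<Sum>k<n. if k = t i then (if t i = t j then 1 else 0) else 0)"
      by (rule sum.cong) auto
    also have "\<dots> = (if t i = t j then 1 else 0)" using tn ij by simp
    finally show "(?P * ?Q) $$ (i, j) = 1\<^sub>m n $$ (i, j)" using ij inj by simp
  qed auto
  have QP: "?Q * ?P = 1\<^sub>m n"
    using mat_mult_left_right_inverse[OF _ _ PQ] by simp
  have PB: "?P * B = mat n n (\<lambda>(i, j). B $$ (t i, j))"
  proof (intro eq_matI)
    fix i j assume "i < dim_row (mat n n (\<lambda>(i, j). B $$ (t i, j)))" "j < dim_col (mat n n (\<lambda>(i, j). B $$ (t i, j)))"
    then have ij: "i < n" "j < n" by auto
    have "(?P * B) $$ (i, j) = (\<Sum>k<n. (if k = t i then 1 else 0) * B $$ (k, j))"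
      using ij B by (auto simp: scalar_prod_def lessThan_atLeast0)
    also have "\<dots> = (\<Sum>k<n. if k = t i then B $$ (t i, j) else 0)" by (rule sum.cong) auto
    finally show "(?P * B) $$ (i, j) = mat n n (\<lambda>(i, j). B $$ (t i, j)) $$ (i, j)" using ij tn by simp
  qed (use B in auto)
  have "A = ?P * B * ?Q"
  proof (intro eq_matI)
    fix i j assume "i < dim_row (?P * B * ?Q)" "j < dim_col (?P * B * ?Q)"
    then have ij: "i < n" "j < n" by auto
    have "(?P * B * ?Q) $$ (i, j) = (\<Sum>k<n. B $$ (t i, k) * (if k = t j then 1 else 0))"
      unfolding PB using ij B by (auto simp: scalar_prod_def lessThan_atLeast0)
    also have "\<dots> = (\<Sum>k<n. if k = t j then B $$ (t i, t j) else 0)" by (rule sum.cong) auto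
    finally show "A $$ (i, j) = (?P * B * ?Q) $$ (i, j)" using ij tn AB by simp
  qed (use A in auto)
  then have "similar_mat_wit A B ?P ?Q"
    using PQ QP A B unfolding similar_mat_wit_def by (auto simp: Let_def)
  then show ?thesis unfolding similar_mat_def by blast
qed

lemma index_mult_mat_sum:
  assumes "A \<in> carrier_mat n n" "B \<in> carrier_mat n n" "i < n" "j < n"
  shows "(A * B) $$ (i, j) = (\<Sum>l<n. A $$ (i, l) * B $$ (l, j))"
  using assms by (auto simp: scalar_prod_def lessThan_atLeast0)

section \<open>Jordan types of nilpotent matrices\<close>

definition shift_mat :: "nat \<Rightarrow> (nat \<Rightarrow> nat) \<Rightarrow> (nat \<Rightarrow> nat) \<Rightarrow> 'a::{zero,one} mat" where
  "shift_mat n blk ht = mat n n (\<lambda>(i, j). if blk i = blk j \<and> ht i = Suc (ht j) then 1 else 0)"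

lemma shift_mat_carrier [simp]: "shift_mat n blk ht \<in> carrier_mat n n"
  by (simp add: shift_mat_def)

text \<open>
  The index \<open>i\<close> stands for the element \<open>t ^ ht i\<close> of the summand number \<open>blk i\<close> of the module
  \<open>\<Oplus>b<m. k[t]/(t ^ sz b)\<close>, on which \<open>shift_mat\<close> is the multiplication by \<open>t\<close>.
\<close>

locale block_coords =
  fixes n m :: nat and sz blk ht :: "nat \<Rightarrow> nat"
  assumes bij: "bij_betw (\<lambda>i. (blk i, ht i)) {..<n} (SIGMA b:{..<m}. {..<sz b})"
begin

lemma blk_less: "i < n \<Longrightarrow> blk i < m" and ht_less: "i < n \<Longrightarrow> ht i < sz (blk i)"
  using bij by (auto simp: bij_betw_def image_subset_iff set_eq_iff image_iff)

lemma coord_inj: "i < n \<Longrightarrow> j < n \<Longrightarrow> blk i = blk j \<Longrightarrow> ht i = ht j \<Longrightarrow> i = j"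
  using bij by (auto simp: bij_betw_def inj_on_def)

definition ix :: "nat \<Rightarrow> nat \<Rightarrow> nat" where
  "ix b u = inv_into {..<n} (\<lambda>i. (blk i, ht i)) (b, u)"

lemma ix:
  assumes "b < m" "u < sz b"
  shows "ix b u < n" "blk (ix b u) = b" "ht (ix b u) = u"
proof -
  have "(b, u) \<in> (\<lambda>i. (blk i, ht i)) ` {..<n}" using bij assms by (auto simp: bij_betw_def)
  from inv_into_into[OF this] f_inv_into_f[OF this]
  show "ix b u < n" "blk (ix b u) = b" "ht (ix b u) = u" unfolding ix_def by auto
qed

lemma ix_coord [simp]: "i < n \<Longrightarrow> ix (blk i) (ht i) = i"
  using coord_inj ix blk_less ht_less by metis

lemma ix_eq_iff: "b < m \<Longrightarrow> u < sz b \<Longrightarrow> i < n \<Longrightarrow> i = ix b u \<longleftrightarrow> blk i = b \<and> ht i = u"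
  using ix by auto

lemma sum_coord:
  assumes "b < m"
  shows "(\<Sum>l<n. if blk l = b \<and> ht l = u then f l else 0) = (if u < sz b then f (ix b u) else 0)"
proof (cases "u < sz b")
  case True
  have "(\<Sum>l<n. if blk l = b \<and> ht l = u then f l else 0) = (\<Sum>l<n. if l = ix b u then f (ix b u) else 0)"
    by (rule sum.cong) (use True assms ix_eq_iff in auto)
  then show ?thesis using ix[OF assms True] True by simp
next
  case False
  then have "(\<Sum>l<n. if blk l = b \<and> ht l = u then f l else 0) = 0"
    using ht_less by (intro sum.neutral) auto
  then show ?thesis using False by simp
qed

lemma shift_mat_pow:
  assumes "i < n" "j < n"
  shows "((shift_mat n blk ht :: 'a::comm_ring_1 mat) ^\<^sub>m k) $$ (i, j) =
    (if blk i = blk j \<and> ht i = ht j + k then 1 else 0)"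
  using assms
proof (induction k arbitrary: i j)
  case 0
  then show ?case using coord_inj[of i j] by (auto simp: shift_mat_def)
next
  case (Suc k)
  let ?J = "shift_mat n blk ht :: 'a mat"
  have c: "?J ^\<^sub>m k \<in> carrier_mat n n" by (simp add: pow_carrier_mat)
  have "(?J ^\<^sub>m Suc k) $$ (i, j) = (\<Sum>l<n. (?J ^\<^sub>m k) $$ (i, l) * ?J $$ (l, j))"
    using Suc.prems c by (simp add: index_mult_mat_sum)
  also have "\<dots> = (\<Sum>l<n. if blk l = blk j \<and> ht l = Suc (ht j)
      then (if blk i = blk l \<and> ht i = ht l + k then 1 else 0) else 0)"
    using Suc by (intro sum.cong) (auto simp: shift_mat_def)
  also have "\<dots> = (if Suc (ht j) < sz (blk j) then
     (if blk i = blk j \<and> ht i = Suc (ht j) + k then 1 else 0) else 0)"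
    by (subst sum_coord[OF blk_less[OF Suc.prems(2)]])
      (use ix[OF blk_less[OF Suc.prems(2)], of "Suc (ht j)"] in auto)
  also have "\<dots> = (if blk i = blk j \<and> ht i = ht j + Suc k then 1 else 0)"
    using ht_less[OF Suc.prems(1)] by auto
  finally show ?case .
qed

lemma card_coord_top: "card {j. j < n \<and> sz (blk j) \<le> ht j + k} = (\<Sum>b<m. min k (sz b))"
proof -
  let ?g = "\<lambda>i. (blk i, ht i)" and ?X = "{j. j < n \<and> sz (blk j) \<le> ht j + k}"
  have inj: "inj_on ?g ?X" using bij unfolding bij_betw_def by (rule inj_on_subset[OF conjunct1]) auto
  have img: "?g ` ?X = (SIGMA b:{..<m}. {sz b - k..<sz b})"
  proof (intro Set.set_eqI iffI)
    fix x assume "x \<in> (SIGMA b:{..<m}. {sz b - k..<sz b})"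
    then obtain b u where x: "x = (b, u)" "b < m" "u < sz b" "sz b - k \<le> u" by auto
    then have "ix b u \<in> ?X" "x = ?g (ix b u)" using ix[of b u] by auto
    then show "x \<in> ?g ` ?X" by blast
  qed (use blk_less ht_less in auto)
  have "card ?X = card (SIGMA b:{..<m}. {sz b - k..<sz b})"
    using card_image[OF inj] unfolding img by (rule sym)
  also have "\<dots> = (\<Sum>b<m. sz b - (sz b - k))" by (subst card_SigmaI) auto
  also have "\<dots> = (\<Sum>b<m. min k (sz b))" by (rule sum.cong) (auto simp: min_def)
  finally show ?thesis .
qed

text \<open>The \<open>k\<close>-th power sends each basis element of height below
  \<open>sz b - k\<close> to a basis element, injectively, and kills the others; so one set of
  columns serves both certificates.\<close>

lemma corank_shift_mat:
  fixes k :: nat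
  defines "J \<equiv> shift_mat n blk ht :: 'a::field mat"
  shows "corank_le n (J ^\<^sub>m k) (\<Sum>b<m. min k (sz b))" "corank_ge n (J ^\<^sub>m k) (\<Sum>b<m. min k (sz b))"
proof -
  let ?X = "{j. j < n \<and> ht j + k < sz (blk j)}"
  have J: "J ^\<^sub>m k \<in> carrier_mat n n" by (simp add: J_def pow_carrier_mat)
  have "card (?X \<union> {j. j < n \<and> sz (blk j) \<le> ht j + k}) = card ?X + card {j. j < n \<and> sz (blk j) \<le> ht j + k}"
    by (rule card_Un_disjoint) auto
  moreover have "?X \<union> {j. j < n \<and> sz (blk j) \<le> ht j + k} = {..<n}" by auto
  ultimately have card: "n = card ?X + (\<Sum>b<m. min k (sz b))" using card_coord_top by simp
  show "corank_le n (J ^\<^sub>m k) (\<Sum>b<m. min k (sz b))"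
  proof (rule corank_le_unit_columns[OF J, where X = ?X and p = "\<lambda>j. ix (blk j) (ht j + k)"])
    show "inj_on (\<lambda>j. ix (blk j) (ht j + k)) ?X"
    proof (rule inj_onI)
      fix x y assume x: "x \<in> ?X" and y: "y \<in> ?X" and e: "ix (blk x) (ht x + k) = ix (blk y) (ht y + k)"
      have "blk x = blk (ix (blk y) (ht y + k))" "ht x + k = ht (ix (blk y) (ht y + k))"
        using ix[of "blk x" "ht x + k"] x blk_less unfolding e[symmetric] by auto
      then have "blk x = blk y" "ht x = ht y"
        using ix[of "blk y" "ht y + k"] y blk_less by auto
      then show "x = y" using x y coord_inj by auto
    qed
    fix x i assume "x \<in> ?X" "i < n"
    then show "(J ^\<^sub>m k) $$ (i, x) = (if i = ix (blk x) (ht x + k) then 1 else 0)"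
      using shift_mat_pow[of i x k] ix_eq_iff[of "blk x" "ht x + k" i] blk_less unfolding J_def by auto
  qed (use card ix blk_less in auto)
  show "corank_ge n (J ^\<^sub>m k) (\<Sum>b<m. min k (sz b))"
  proof (rule corank_ge_zero_columns[OF J, where X = ?X])
    fix x i assume x: "x < n" "x \<notin> ?X" "i < n"
    then have "\<not> (blk i = blk x \<and> ht i = ht x + k)" using ht_less[of i] by auto
    then show "(J ^\<^sub>m k) $$ (i, x) = 0"
      unfolding J_def shift_mat_pow[OF x(3,1)] by simp
  qed (use card in auto)
qed

end

text \<open>Matching blocks of equal size and keeping the heights is a permutation of the basis. So
  only the multiset of block sizes matters, not the numbering chosen for blocks and heights.\<close>

lemma similar_shift_mats:
  assumes "block_coords n m sz blk ht" "block_coords n m sz' blk' ht'"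
    and s: "bij_betw s {..<m} {..<m}" and sz: "\<And>b. b < m \<Longrightarrow> sz' (s b) = sz b"
  shows "similar_mat (shift_mat n blk ht :: 'a::field mat) (shift_mat n blk' ht')"
proof -
  interpret a: block_coords n m sz blk ht by fact
  interpret b: block_coords n m sz' blk' ht' by fact
  define t where "t i = b.ix (s (blk i)) (ht i)" for i
  have sm: "s b < m" if "b < m" for b using s that by (auto simp: bij_betw_def)
  have sinj: "s b = s c \<longleftrightarrow> b = c" if "b < m" "c < m" for b c
    using s that by (auto simp: bij_betw_def inj_on_def)
  have t: "t i < n" "blk' (t i) = s (blk i)" "ht' (t i) = ht i" if "i < n" for i
    using b.ix[of "s (blk i)" "ht i"] a.blk_less[OF that] a.ht_less[OF that] sm sz by (auto simp: t_def)
  have "inj_on t {..<n}"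
  proof (rule inj_onI)
    fix x y assume "x \<in> {..<n}" "y \<in> {..<n}" "t x = t y"
    then show "x = y" using t[of x] t[of y] a.coord_inj[of x y] a.blk_less sinj by auto
  qed
  then have "bij_betw t {..<n} {..<n}"
    using t(1) endo_inj_surj[of "{..<n}" t] by (auto simp: bij_betw_def image_subset_iff)
  then show ?thesis
    by (rule similar_mat_reindex[rotated 2]) (use t sinj a.blk_less in \<open>auto simp: shift_mat_def\<close>)
qed

section \<open>Nilpotent Jordan matrices in block coordinates\<close>

fun jordan_blk :: "nat list \<Rightarrow> nat \<Rightarrow> nat" where
  "jordan_blk [] i = 0"
| "jordan_blk (p # ps) i = (if i < p then 0 else Suc (jordan_blk ps (i - p)))"

text \<open>A Jordan block has its ones above the diagonal and thus lowers the index by 1, whereas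
  \<open>shift_mat\<close> raises heights; so height 0 belongs to the last index of a block.\<close>

fun jordan_ht :: "nat list \<Rightarrow> nat \<Rightarrow> nat" where
  "jordan_ht [] i = 0"
| "jordan_ht (p # ps) i = (if i < p then p - 1 - i else jordan_ht ps (i - p))"

lemma jordan_coords:
  "block_coords (sum_list ps) (length ps) ((!) ps) (jordan_blk ps) (jordan_ht ps)"
proof (induction ps)
  case Nil
  then show ?case by (simp add: block_coords_def bij_betw_def)
next
  case (Cons p ps)
  interpret block_coords "sum_list ps" "length ps" "(!) ps" "jordan_blk ps" "jordan_ht ps" by fact
  let ?g = "\<lambda>i. (jordan_blk (p # ps) i, jordan_ht (p # ps) i)"
  show ?case unfolding block_coords_def bij_betw_def
  proof
    show "inj_on ?g {..<sum_list (p # ps)}"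
    proof (rule inj_onI)
      fix x y assume a: "x \<in> {..<sum_list (p # ps)}" "y \<in> {..<sum_list (p # ps)}" "?g x = ?g y"
      show "x = y"
      proof (cases "x < p")
        case True
        then show ?thesis using a by (simp split: if_splits)
      next
        case False
        moreover have "\<not> y < p" using a(3) False by auto
        ultimately obtain i j where "x = p + i" "y = p + j" by (metis le_Suc_ex not_less)
        then show ?thesis using a coord_inj[of i j] by simp
      qed
    qed
    show "?g ` {..<sum_list (p # ps)} = (SIGMA b:{..<length (p # ps)}. {..<(p # ps) ! b})"
    proof (intro Set.set_eqI iffI)
      fix x assume "x \<in> ?g ` {..<sum_list (p # ps)}"
      then obtain i where i: "i < p + sum_list ps" "x = ?g i" by auto
      then show "x \<in> (SIGMA b:{..<length (p # ps)}. {..<(p # ps) ! b})"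
        using blk_less[of "i - p"] ht_less[of "i - p"] by (cases "i < p") auto
    next
      fix x assume "x \<in> (SIGMA b:{..<length (p # ps)}. {..<(p # ps) ! b})"
      then obtain b u where x: "x = (b, u)" "b < Suc (length ps)" "u < (p # ps) ! b" by auto
      show "x \<in> ?g ` {..<sum_list (p # ps)}"
      proof (cases b)
        case 0
        then show ?thesis using x by (intro image_eqI[of _ _ "p - 1 - u"]) auto
      next
        case (Suc c)
        then show ?thesis using x ix[of c u] by (intro image_eqI[of _ _ "p + ix c u"]) auto
      qed
    qed
  qed
qed

lemma jordan_matrix_shift_mat:
  "(jordan_matrix (map (\<lambda>p. (p, 0)) ps) :: 'a::comm_ring_1 mat) =
     shift_mat (sum_list ps) (jordan_blk ps) (jordan_ht ps)"
proof (induction ps)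
  case Nil
  then show ?case by (intro eq_matI) (auto simp: jordan_matrix_def shift_mat_def)
next
  case (Cons p ps)
  let ?J = "jordan_matrix (map (\<lambda>p. (p, 0)) ps) :: 'a mat"
  have J: "?J \<in> carrier_mat (sum_list ps) (sum_list ps)" by (simp add: Cons.IH)
  have "jordan_matrix (map (\<lambda>p. (p, 0)) (p # ps)) =
     four_block_mat (jordan_block p 0) (0\<^sub>m p (sum_list ps)) (0\<^sub>m (sum_list ps) p) ?J"
    using J by (simp add: jordan_matrix_def Let_def)
  also have "\<dots> = shift_mat (sum_list (p # ps)) (jordan_blk (p # ps)) (jordan_ht (p # ps))"
    unfolding Cons.IH by (intro eq_matI) (auto simp: shift_mat_def)
  finally show ?case .
qed

lemma mset_parts [simp]: "mset (parts P) = P" by (simp add: parts_def)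

lemma sum_list_parts [simp]: "sum_list (parts P) = sum_mset P"
  by (metis mset_parts sum_mset_sum_list)

lemma nilp_jordan_matrix_shift_mat:
  "(nilp_jordan_matrix P :: 'a::comm_ring_1 mat) =
     shift_mat (sum_mset P) (jordan_blk (parts P)) (jordan_ht (parts P))"
  unfolding nilp_jordan_matrix_def nilp_jordan_list_def jordan_matrix_shift_mat by simp

lemma sum_nth_mset: "(\<Sum>b<length ps. f (ps ! b)) = (\<Sum>q\<in>#mset ps. f q)"
  by (simp add: sum_mset_sum_list sum_list_sum_nth lessThan_atLeast0 flip: mset_map)

lemma has_jordan_type_dim:
  assumes "A \<in> carrier_mat n n" "has_jordan_type A Q"
  shows "partition_of n Q"
proof -
  have s: "similar_mat A (nilp_jordan_matrix Q)" and z: "0 \<notin> fst ` set (nilp_jordan_list Q :: (nat \<times> 'a) list)"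
    using assms unfolding has_jordan_type_def jordan_nf_def nilp_jordan_matrix_def by auto
  have "set (parts Q) = set_mset Q" by (metis mset_parts set_mset_mset)
  then have "0 \<notin># Q" using z by (force simp: nilp_jordan_list_def)
  moreover have "dim_row (nilp_jordan_matrix Q :: 'a mat) = n"
    using similar_matD[OF s] assms by auto
  then have "sum_mset Q = n"
    by (simp add: nilp_jordan_matrix_def nilp_jordan_list_def comp_def)
  ultimately show ?thesis by (simp add: partition_of_def)
qed

lemma has_jordan_type_corank:
  fixes A :: "'a::field mat"
  assumes A: "A \<in> carrier_mat n n" and t: "has_jordan_type A Q"
  shows "corank_le n (A ^\<^sub>m k) (\<Sum>q\<in>#Q. min k q)" "corank_ge n (A ^\<^sub>m k) (\<Sum>q\<in>#Q. min k q)"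
proof -
  have n: "sum_mset Q = n" using has_jordan_type_dim[OF A t] by (simp add: partition_of_def)
  interpret block_coords n "length (parts Q)" "(!) (parts Q)" "jordan_blk (parts Q)" "jordan_ht (parts Q)"
    using jordan_coords[of "parts Q"] n by simp
  let ?J = "nilp_jordan_matrix Q :: 'a mat"
  have J: "?J = shift_mat n (jordan_blk (parts Q)) (jordan_ht (parts Q))"
    by (simp add: nilp_jordan_matrix_shift_mat n)
  obtain P R where w: "similar_mat_wit A ?J P R"
    using t unfolding has_jordan_type_def jordan_nf_def nilp_jordan_matrix_def similar_mat_def by auto
  have "similar_mat (A ^\<^sub>m k) (?J ^\<^sub>m k)"
    using similar_mat_wit_pow[OF w, of k] unfolding similar_mat_def by blast
  then have s: "similar_mat (?J ^\<^sub>m k) (A ^\<^sub>m k)" by (rule similar_mat_sym)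
  have c: "?J ^\<^sub>m k \<in> carrier_mat n n" by (simp add: J pow_carrier_mat)
  have e: "(\<Sum>b<length (parts Q). min k (parts Q ! b)) = (\<Sum>q\<in>#Q. min k q)"
    by (simp add: sum_nth_mset)
  show "corank_le n (A ^\<^sub>m k) (\<Sum>q\<in>#Q. min k q)"
    using corank_le_similar[OF c s] corank_shift_mat(1)[of k] unfolding J e by blast
  show "corank_ge n (A ^\<^sub>m k) (\<Sum>q\<in>#Q. min k q)"
    using corank_ge_similar[OF c s] corank_shift_mat(2)[of k] unfolding J e by blast
qed

lemma sum_min_Suc: "(\<Sum>q\<in>#(Q :: nat multiset). min (Suc k) q) = (\<Sum>q\<in>#Q. min k q) + size {#q \<in># Q. k < q#}"
  by (induction Q) auto

text \<open>First differences of these sums in \<open>k\<close> count the parts greater than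
  \<open>k\<close>; differences of those count the parts equal to \<open>Suc k\<close>.\<close>

lemma partition_eqI_sum_min:
  assumes "0 \<notin># Q" "0 \<notin># Q'" and eq: "\<And>k. (\<Sum>q\<in>#Q. min k q) = (\<Sum>q\<in>#Q'. min (k :: nat) q)"
  shows "Q = (Q' :: nat multiset)"
proof (rule multiset_eqI)
  fix x
  have s: "size {#q \<in># Q. k < q#} = size {#q \<in># Q'. k < q#}" for k
    using sum_min_Suc[of k Q] sum_min_Suc[of k Q'] eq[of k] eq[of "Suc k"] by simp
  have c: "size {#q \<in># R. k < q#} = count R (Suc k) + size {#q \<in># R. Suc k < q#}" for R k
    by (induction R) auto
  show "count Q x = count Q' x"
  proof (cases x)
    case 0
    then show ?thesis using assms by (simp add: not_in_iff)
  next
    case (Suc k)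
    then show ?thesis using c[of k Q] c[of k Q'] s[of k] s[of "Suc k"] by simp
  qed
qed

section \<open>Existence of the Jordan type of a nilpotent matrix\<close>

lemma invertible_with_first_column:
  fixes v :: "'a::field vec"
  assumes v: "v \<in> carrier_vec (Suc n)" "v \<noteq> 0\<^sub>v (Suc n)"
  obtains P Q where "P \<in> carrier_mat (Suc n) (Suc n)" "Q \<in> carrier_mat (Suc n) (Suc n)"
    "P * Q = 1\<^sub>m (Suc n)" "Q * P = 1\<^sub>m (Suc n)" "col P 0 = v"
proof -
  let ?n = "Suc n"
  obtain k where k: "k < ?n" "v $ k \<noteq> 0" using v by (metis carrier_vecD eq_vecI index_zero_vec)
  \<comment> \<open>Column 0 is \<open>v\<close>, which replaces the unit vector number
    \<open>k\<close> because \<open>v $ k \<noteq> 0\<close>. The unit vector number 0, displaced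
    from column 0, moves to column \<open>k\<close>.\<close>
  define h where "h j = (if j = k then 0 else j)" for j
  define P where "P = mat ?n ?n (\<lambda>(i, j). if j = 0 then v $ i else if i = h j then 1 else 0)"
  have P: "P \<in> carrier_mat ?n ?n" by (simp add: P_def)
  have "det P \<noteq> 0"
  proof
    assume "det P = 0"
    then obtain x where x: "x \<in> carrier_vec ?n" "x \<noteq> 0\<^sub>v ?n" "P *\<^sub>v x = 0\<^sub>v ?n"
      using det_0_iff_vec_prod_zero_field[OF P] by blast
    have row: "(\<Sum>j<?n. (if j = 0 then v $ i else if i = h j then 1 else 0) * x $ j) = 0" if "i < ?n" for i
      using arg_cong[OF x(3), of "\<lambda>v. v $ i"] that P x(1)
      by (simp add: P_def scalar_prod_def lessThan_atLeast0)
    have "(\<Sum>j<?n. (if j = 0 then v $ k else if k = h j then 1 else 0) * x $ j) = (\<Sum>j<?n. if j = 0 then v $ k * x $ 0 else 0)"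
      by (rule sum.cong) (auto simp: h_def split: if_splits)
    then have x0: "x $ 0 = 0" using row[OF k(1)] k(2) by (simp del: sum.lessThan_Suc)
    have "x $ j = 0" if j: "0 < j" "j < ?n" for j
    proof -
      have hj: "h j < ?n" using j by (simp add: h_def)
      have "(\<Sum>l<?n. (if l = 0 then v $ h j else if h j = h l then 1 else 0) * x $ l) = (\<Sum>l<?n. if l = j then x $ j else 0)"
        by (rule sum.cong) (use x0 j in \<open>auto simp: h_def split: if_splits\<close>)
      then show ?thesis using row[OF hj] j by (simp del: sum.lessThan_Suc)
    qed
    then have "x = 0\<^sub>v ?n" using x(1) x0 by (intro eq_vecI) (auto, metis gr0I)
    then show False using x by simp
  qed
  from det_non_zero_imp_unit[OF P this, unfolded Units_def, of "()"]
  obtain Q where "Q \<in> carrier_mat ?n ?n" "Q * P = 1\<^sub>m ?n" "P * Q = 1\<^sub>m ?n"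
    by (auto simp: ring_mat_def)
  moreover have "col P 0 = v" using v by (intro eq_vecI) (auto simp: P_def)
  ultimately show ?thesis using that P by blast
qed

text \<open>The determinant of a nilpotent matrix is 0, so a kernel vector exists over any field; as
  first basis vector it leaves a smaller nilpotent block. The result serves twice: for the existence
  of Jordan types and for the residue blocks of the commutator.\<close>

lemma nilpotent_strictly_triangular:
  fixes A :: "'a::field mat"
  assumes "A \<in> carrier_mat n n" "A ^\<^sub>m N = 0\<^sub>m n n"
  shows "\<exists>P Q. P \<in> carrier_mat n n \<and> Q \<in> carrier_mat n n \<and> P * Q = 1\<^sub>m n \<and> Q * P = 1\<^sub>m n \<and>
    (\<forall>i<n. \<forall>j<n. (P * A * Q) $$ (i, j) \<noteq> 0 \<longrightarrow> i < j)"
  using assms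
proof (induction n arbitrary: A)
  case 0
  then show ?case by (intro exI[of _ "1\<^sub>m 0"]) auto
next
  case (Suc n)
  let ?n = "Suc n"
  have dp: "det (A ^\<^sub>m k) = det A ^ k" for k
    by (induction k) (use Suc.prems(1) in \<open>auto simp: det_mult[of _ ?n] pow_carrier_mat\<close>)
  have "det (0\<^sub>m ?n ?n :: 'a mat) = 0" using det_0_iff_vec_prod_zero_field[of "0\<^sub>m ?n ?n :: 'a mat" ?n]
    by (auto intro!: exI[of _ "unit_vec ?n 0"])
  then have "det A = 0" using dp[of N] Suc.prems(2) by simp
  then obtain v where v: "v \<in> carrier_vec ?n" "v \<noteq> 0\<^sub>v ?n" "A *\<^sub>v v = 0\<^sub>v ?n"
    using det_0_iff_vec_prod_zero_field[OF Suc.prems(1)] by blast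
  obtain P Q where PQ: "P \<in> carrier_mat ?n ?n" "Q \<in> carrier_mat ?n ?n"
    "P * Q = 1\<^sub>m ?n" "Q * P = 1\<^sub>m ?n" "col P 0 = v"
    using invertible_with_first_column[OF v(1,2)] by blast
  define A1 where "A1 = Q * A * P"
  have A1: "A1 \<in> carrier_mat ?n ?n" using PQ Suc.prems by (simp add: A1_def)
  have w: "similar_mat_wit A1 A Q P" unfolding similar_mat_wit_def using A1 PQ Suc.prems by (simp add: A1_def Let_def)
  have A1N: "A1 ^\<^sub>m N = 0\<^sub>m ?n ?n"
    using similar_mat_witD2(3)[OF pow_carrier_mat[OF A1] similar_mat_wit_pow[OF w, of N]] PQ Suc.prems(2) by simp
  have "col A1 0 = (Q * A) *\<^sub>v col P 0"
    unfolding A1_def by (rule col_mult2[of _ ?n ?n _ ?n]) (use PQ Suc.prems(1) in auto)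
  also have "\<dots> = Q *\<^sub>v (A *\<^sub>v col P 0)"
    by (rule assoc_mult_mat_vec[of _ ?n ?n _ ?n]) (use PQ(1,2) v(1) PQ(5) Suc.prems(1) in auto)
  also have "\<dots> = 0\<^sub>v ?n" unfolding PQ(5) v(3) using PQ by (intro eq_vecI) auto
  finally have A1_0: "A1 $$ (i, 0) = 0" if "i < ?n" for i
    using A1 that by (metis carrier_matD index_col index_zero_vec(1) zero_less_Suc)
  define A3 where "A3 = mat n n (\<lambda>(i, j). A1 $$ (Suc i, Suc j))"
  define W where "W = mat 1 n (\<lambda>(i, j). A1 $$ (0, Suc j))"
  have A3: "A3 \<in> carrier_mat n n" by (simp add: A3_def)
  \<comment> \<open>As column 0 of \<open>A1\<close> vanishes, the lower right blocks of the powers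
    of \<open>A1\<close> are the powers of \<open>A3\<close>, so \<open>A3\<close> inherits
    nilpotency.\<close>
  have pow: "(A1 ^\<^sub>m k) $$ (Suc i, 0) = 0 \<and> (\<forall>j<n. (A1 ^\<^sub>m k) $$ (Suc i, Suc j) = (A3 ^\<^sub>m k) $$ (i, j))"
    if "i < n" for i k
    using that
  proof (induction k)
    case 0
    then show ?case using A1 A3 by auto
  next
    case (Suc k)
    have c: "A1 ^\<^sub>m k \<in> carrier_mat ?n ?n" "A3 ^\<^sub>m k \<in> carrier_mat n n" using A1 A3 by (auto simp: pow_carrier_mat)
    have "(A1 ^\<^sub>m Suc k) $$ (Suc i, j) = (\<Sum>l<n. (A1 ^\<^sub>m k) $$ (Suc i, Suc l) * A1 $$ (Suc l, j))" if "j < ?n" for j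
    proof -
      have "(A1 ^\<^sub>m Suc k) $$ (Suc i, j) = (\<Sum>l<?n. (A1 ^\<^sub>m k) $$ (Suc i, l) * A1 $$ (l, j))"
        using Suc that c A1 by (auto simp: scalar_prod_def lessThan_atLeast0 simp del: sum.lessThan_Suc)
      then show ?thesis using Suc by (simp add: sum.lessThan_Suc_shift del: sum.lessThan_Suc)
    qed
    then show ?case using Suc c A3 A1_0
      by (auto simp: scalar_prod_def lessThan_atLeast0 A3_def intro!: sum.cong)
  qed
  have "A3 ^\<^sub>m N = 0\<^sub>m n n"
    using pow[of _ N] A1N A3 by (intro eq_matI) (auto simp: pow_carrier_mat)
  then obtain P3 Q3 where IH: "P3 \<in> carrier_mat n n" "Q3 \<in> carrier_mat n n" "P3 * Q3 = 1\<^sub>m n" "Q3 * P3 = 1\<^sub>m n"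
    "\<forall>i<n. \<forall>j<n. (P3 * A3 * Q3) $$ (i, j) \<noteq> 0 \<longrightarrow> i < j"
    using Suc.IH[OF A3] by blast
  let ?fb = "\<lambda>a b c d. four_block_mat a b c d :: 'a mat"
  define P2 where "P2 = ?fb (1\<^sub>m 1) (0\<^sub>m 1 n) (0\<^sub>m n 1) P3"
  define Q2 where "Q2 = ?fb (1\<^sub>m 1) (0\<^sub>m 1 n) (0\<^sub>m n 1) Q3"
  have P2: "P2 \<in> carrier_mat ?n ?n" and Q2: "Q2 \<in> carrier_mat ?n ?n"
    using IH by (auto simp: P2_def Q2_def)
  have A1b: "A1 = ?fb (0\<^sub>m 1 1) W (0\<^sub>m n 1) A3"
    using A1 A1_0 A3 by (intro eq_matI) (auto simp: W_def A3_def)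
  have W: "W \<in> carrier_mat 1 n" by (simp add: W_def)
  have one: "?fb (1\<^sub>m 1) (0\<^sub>m 1 n) (0\<^sub>m n 1) (1\<^sub>m n) = 1\<^sub>m ?n"
    by (intro eq_matI) auto
  have PQ2: "P2 * Q2 = 1\<^sub>m ?n" "Q2 * P2 = 1\<^sub>m ?n"
    using IH mult_four_block_mat[of "1\<^sub>m 1" 1 1 "0\<^sub>m 1 n" n "0\<^sub>m n 1" n P3 "1\<^sub>m 1" 1 "0\<^sub>m 1 n" n "0\<^sub>m n 1" Q3]
      mult_four_block_mat[of "1\<^sub>m 1" 1 1 "0\<^sub>m 1 n" n "0\<^sub>m n 1" n Q3 "1\<^sub>m 1" 1 "0\<^sub>m 1 n" n "0\<^sub>m n 1" P3]
    unfolding P2_def Q2_def by (simp_all add: one)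
  have "P2 * A1 = ?fb (0\<^sub>m 1 1) W (0\<^sub>m n 1) (P3 * A3)"
    using IH A3 W mult_four_block_mat[of "1\<^sub>m 1" 1 1 "0\<^sub>m 1 n" n "0\<^sub>m n 1" n P3 "0\<^sub>m 1 1" 1 W n "0\<^sub>m n 1" A3]
    unfolding P2_def A1b by simp
  then have "P2 * A1 * Q2 = ?fb (0\<^sub>m 1 1) (W * Q3) (0\<^sub>m n 1) (P3 * A3 * Q3)"
    using IH A3 W mult_four_block_mat[of "0\<^sub>m 1 1" 1 1 W n "0\<^sub>m n 1" n "P3 * A3" "1\<^sub>m 1" 1 "0\<^sub>m 1 n" n "0\<^sub>m n 1" Q3]
    unfolding Q2_def by simp
  then have tri: "i < j" if "i < ?n" "j < ?n" "(P2 * A1 * Q2) $$ (i, j) \<noteq> 0" for i j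
  proof -
    have "(P2 * A1 * Q2) $$ (i, j) = (if i < 1 then if j < 1 then 0 else (W * Q3) $$ (i, j - 1)
       else if j < 1 then 0 else (P3 * A3 * Q3) $$ (i - 1, j - 1))"
      using \<open>P2 * A1 * Q2 = _\<close> that(1,2) IH A3 W by auto
    moreover have "i - 1 < n" "j - 1 < n" if "0 < i" "0 < j" using that \<open>i < ?n\<close> \<open>j < ?n\<close> by auto
    ultimately show ?thesis using that IH(5)[rule_format, of "i - 1" "j - 1"] by (auto split: if_splits)
  qed
  have e: "(P2 * Q) * A * (P * Q2) = P2 * A1 * Q2"
    unfolding A1_def using P2 Q2 PQ Suc.prems by (simp add: assoc_mult_mat[of _ ?n ?n _ ?n _ ?n])
  have i1: "(P2 * Q) * (P * Q2) = 1\<^sub>m ?n"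
  proof -
    have "(P2 * Q) * (P * Q2) = P2 * ((Q * P) * Q2)"
      using P2 Q2 PQ(1,2) by (simp add: assoc_mult_mat[of _ ?n ?n _ ?n _ ?n])
    then show ?thesis using PQ(4) PQ2 Q2 by simp
  qed
  have i2: "(P * Q2) * (P2 * Q) = 1\<^sub>m ?n"
  proof -
    have "(P * Q2) * (P2 * Q) = P * ((Q2 * P2) * Q)"
      using P2 Q2 PQ(1,2) by (simp add: assoc_mult_mat[of _ ?n ?n _ ?n _ ?n])
    then show ?thesis using PQ PQ2 by simp
  qed
  show ?case
    by (intro exI[of _ "P2 * Q"] exI[of _ "P * Q2"] conjI)
      (use P2 Q2 PQ tri e i1 i2 in \<open>auto simp del: assoc_mult_mat\<close>)
qed

lemma jordan_nf_reorder:
  assumes "mset ps = mset qs"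
  shows "similar_mat (jordan_matrix (map (\<lambda>p. (p, 0)) ps) :: 'a::field mat) (jordan_matrix (map (\<lambda>p. (p, 0)) qs))"
proof -
  have len: "length ps = length qs" and sum: "sum_list ps = sum_list qs"
    using assms by (metis mset_eq_length, metis sum_mset_sum_list)
  obtain s where s: "s permutes {..<length qs}" "permute_list s qs = ps"
    using mset_eq_permutation[OF assms] by blast
  have c: "block_coords (sum_list qs) (length qs) ((!) ps) (jordan_blk ps) (jordan_ht ps)"
    using jordan_coords[of ps] len sum by simp
  show ?thesis unfolding jordan_matrix_shift_mat sum
  proof (rule similar_shift_mats[OF c jordan_coords])
    show "bij_betw s {..<length qs} {..<length qs}" using s(1) by (rule permutes_imp_bij)
    show "qs ! s b = ps ! b" if "b < length qs" for b
      using s that by (metis length_permute_list permute_list_nth)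
  qed
qed

text \<open>The strictly triangular form has a Jordan normal form over the given field, and its
  characteristic polynomial, a power of the variable, forces every eigenvalue to be 0. Only the
  order of the blocks remains to be adjusted.\<close>

lemma nilpotent_has_jordan_type:
  fixes A :: "'a::field mat"
  assumes A: "A \<in> carrier_mat n n" and nil: "A ^\<^sub>m N = 0\<^sub>m n n"
  shows "\<exists>Q. has_jordan_type A Q"
proof -
  obtain P Q where PQ: "P \<in> carrier_mat n n" "Q \<in> carrier_mat n n" "P * Q = 1\<^sub>m n" "Q * P = 1\<^sub>m n"
    "\<forall>i<n. \<forall>j<n. (P * A * Q) $$ (i, j) \<noteq> 0 \<longrightarrow> i < j"
    using nilpotent_strictly_triangular[OF A nil] by blast
  define B where "B = P * A * Q"
  have B: "B \<in> carrier_mat n n" using PQ A by (simp add: B_def)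
  have simBA: "similar_mat B A" unfolding similar_mat_def similar_mat_wit_def
    using B A PQ by (intro exI[of _ P] exI[of _ Q]) (simp add: B_def Let_def)
  have ut: "upper_triangular B" using PQ(5) B unfolding B_def[symmetric]
    by (auto simp: upper_triangular_def) (meson less_trans not_less_iff_gr_or_eq)
  obtain L where L: "jordan_nf B L" using triangular_to_jnf_vector[OF B ut] by blast
  have "B $$ (i, i) = 0" if "i < n" for i using PQ(5) that unfolding B_def[symmetric] by blast
  then have "diag_mat B = map (\<lambda>_. 0) [0..<n]" using B by (auto simp: diag_mat_def)
  then have "char_poly B = [:0, 1:] ^ n"
    using char_poly_upper_triangular[OF B ut] by (simp add: comp_def map_replicate_const)
  then have cp: "(\<Prod>(na, a)\<leftarrow>L. [:- a, 1:] ^ na) = [:0, 1:] ^ n" using jordan_nf_char_poly[OF L] by simp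
  have "a = 0" if "(p, a) \<in> set L" for p a
  proof -
    have "p \<noteq> 0" using L that unfolding jordan_nf_def by force
    obtain xs ys where "L = xs @ (p, a) # ys" using \<open>(p, a) \<in> set L\<close> split_list by metis
    then have "poly (\<Prod>(na, a)\<leftarrow>L. [:- a, 1:] ^ na) a = 0"
      using \<open>p \<noteq> 0\<close> by (simp add: poly_power)
    then have "poly ([:0, 1:] ^ n) a = 0" by (simp only: cp)
    then show ?thesis by (simp add: poly_power)
  qed
  then have L': "L = map (\<lambda>p. (p, 0)) (map fst L)" by (auto simp: comp_def intro!: map_idI[symmetric])
  let ?Q = "mset (map fst L)"
  have "similar_mat (jordan_matrix L) (jordan_matrix (nilp_jordan_list ?Q))"
    unfolding nilp_jordan_list_def by (subst L', rule jordan_nf_reorder) simp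
  then have "similar_mat A (jordan_matrix (nilp_jordan_list ?Q))"
    using similar_mat_trans similar_mat_sym simBA L unfolding jordan_nf_def by metis
  moreover have "0 \<notin> fst ` set (nilp_jordan_list ?Q :: (nat \<times> 'a) list)"
  proof -
    have "set (parts ?Q) = set_mset ?Q" by (metis mset_parts set_mset_mset)
    then show ?thesis using L unfolding jordan_nf_def nilp_jordan_list_def by force
  qed
  ultimately show ?thesis unfolding has_jordan_type_def jordan_nf_def by blast
qed

section \<open>The commutator of a nilpotent Jordan matrix\<close>

locale pos_block_coords = block_coords +
  assumes sz_pos: "b < m \<Longrightarrow> 0 < sz b"
begin

text \<open>The coheight: \<open>t ^ cht i\<close> is the least power of \<open>t\<close> that
  annihilates the basis element \<open>i\<close>.\<close>

definition cht :: "nat \<Rightarrow> nat" where "cht i = sz (blk i) - ht i"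

abbreviation J :: "'a::comm_ring_1 mat" where "J \<equiv> shift_mat n blk ht"

text \<open>The image of \<open>j\<close> under a \<open>t\<close>-linear map is divisible by
  \<open>t ^ ht j\<close> and annihilated by \<open>t ^ cht j\<close>; this gives the two
  inequalities. Elements that agree in both lie in blocks of the same size, and there a strictly
  triangular form that lowers the block number is imposed.\<close>

definition prec :: "nat \<Rightarrow> nat \<Rightarrow> bool" where
  "prec j i \<longleftrightarrow> ht j \<le> ht i \<and> cht i \<le> cht j \<and> (ht j = ht i \<and> cht j = cht i \<longrightarrow> blk i < blk j)"

definition tri :: "'a::comm_ring_1 mat set" where
  "tri = {A \<in> carrier_mat n n. A * J = J * A \<and> (\<forall>i<n. \<forall>j<n. A $$ (i, j) \<noteq> 0 \<longrightarrow> prec j i)}"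

lemma cht_pos: "i < n \<Longrightarrow> 0 < cht i"
  using ht_less by (auto simp: cht_def)

lemma ht_cht: "i < n \<Longrightarrow> ht i + cht i = sz (blk i)"
  using ht_less[of i] by (auto simp: cht_def)

lemma prec_irrefl [simp]: "\<not> prec i i" by (simp add: prec_def)

lemma prec_trans: "prec i j \<Longrightarrow> prec j k \<Longrightarrow> prec i k"
  unfolding prec_def by (intro conjI impI; linarith)

lemma commute_entries:
  fixes A :: "'a::comm_ring_1 mat"
  assumes A: "A \<in> carrier_mat n n" and i: "i < n" and j: "j < n"
  shows "(A * J) $$ (i, j) = (if Suc (ht j) < sz (blk j) then A $$ (i, ix (blk j) (Suc (ht j))) else 0)"
    and "(J * A) $$ (i, j) = (if 0 < ht i then A $$ (ix (blk i) (ht i - 1), j) else 0)"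
proof -
  have "(A * J) $$ (i, j) = (\<Sum>l<n. if blk l = blk j \<and> ht l = Suc (ht j) then A $$ (i, l) else 0)"
    unfolding index_mult_mat_sum[OF A shift_mat_carrier i j]
    by (rule sum.cong) (use j in \<open>auto simp: shift_mat_def\<close>)
  then show "(A * J) $$ (i, j) = (if Suc (ht j) < sz (blk j) then A $$ (i, ix (blk j) (Suc (ht j))) else 0)"
    by (simp add: sum_coord[OF blk_less[OF j]])
  have JA: "(J * A) $$ (i, j) = (\<Sum>l<n. (if blk i = blk l \<and> ht i = Suc (ht l) then 1 else 0) * A $$ (l, j))"
    unfolding index_mult_mat_sum[OF shift_mat_carrier A i j]
    by (rule sum.cong) (use i in \<open>auto simp: shift_mat_def\<close>)
  show "(J * A) $$ (i, j) = (if 0 < ht i then A $$ (ix (blk i) (ht i - 1), j) else 0)"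
  proof (cases "ht i")
    case 0
    then show ?thesis unfolding JA by simp
  next
    case (Suc u)
    have "(J * A) $$ (i, j) = (\<Sum>l<n. if blk l = blk i \<and> ht l = u then A $$ (l, j) else 0)"
      unfolding JA by (rule sum.cong) (auto simp: Suc)
    then show ?thesis using Suc ht_less[OF i] by (simp add: sum_coord[OF blk_less[OF i]])
  qed
qed

lemma commute_shift:
  fixes A :: "'a::comm_ring_1 mat"
  assumes A: "A \<in> carrier_mat n n" "A * J = J * A"
    and b: "b' < m" "b < m" "Suc u' < sz b'" "Suc u < sz b"
  shows "A $$ (ix b' (Suc u'), ix b (Suc u)) = A $$ (ix b' u', ix b u)"
proof -
  note x = ix[of b' "Suc u'"] ix[of b' u'] ix[of b "Suc u"] ix[of b u]
  have "(A * J) $$ (ix b' (Suc u'), ix b u) = (J * A) $$ (ix b' (Suc u'), ix b u)" using A by simp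
  then show ?thesis using x b by (simp add: commute_entries[OF A(1)])
qed

text \<open>Divisibility and annihilation, one power of \<open>t\<close> at a time: comparing an
  entry of \<open>A * J\<close> with that of \<open>J * A\<close> moves both indices by one step,
  downwards for the heights and upwards for the coheights.\<close>

lemma commute_height:
  fixes A :: "'a::comm_ring_1 mat"
  assumes A: "A \<in> carrier_mat n n" "A * J = J * A"
    and "i < n" "j < n" "A $$ (i, j) \<noteq> 0"
  shows "ht j \<le> ht i" and "cht i \<le> cht j"
proof -
  show "ht j \<le> ht i" using assms(3-)
  proof (induction "ht j" arbitrary: i j)
    case (Suc u)
    let ?j = "ix (blk j) u"
    have j: "?j < n" "blk ?j = blk j" "ht ?j = u"
      using ix[of "blk j" u] blk_less ht_less[of j] Suc by auto
    have "(A * J) $$ (i, ?j) = A $$ (i, j)"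
      using commute_entries(1)[OF A(1) Suc(3) j(1)] j Suc(2) ht_less[OF Suc(4)] Suc(4) by simp
    then have "(J * A) $$ (i, ?j) \<noteq> 0" using A Suc by simp
    then have i: "0 < ht i" "A $$ (ix (blk i) (ht i - 1), ?j) \<noteq> 0"
      using commute_entries(2)[OF A(1) Suc(3) j(1)] by (auto split: if_splits)
    have "ht ?j \<le> ht (ix (blk i) (ht i - 1))"
      using i ht_less[OF Suc(3)] blk_less[OF Suc(3)]
      by (intro Suc(1)) (use j ix[of "blk i" "ht i - 1"] in auto)
    then show ?case using j i Suc(2) ix[of "blk i" "ht i - 1"] ht_less[OF Suc(3)] blk_less[OF Suc(3)] by auto
  qed simp
  show "cht i \<le> cht j" using assms(3-)
  proof (induction "cht i" arbitrary: i j rule: less_induct)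
    case less
    note c = ht_cht[OF less(2)] ht_cht[OF less(3)] cht_pos[OF less(3)]
    show ?case
    proof (cases "cht i = 1")
      case True
      then show ?thesis using c by simp
    next
      case False
      then have si: "Suc (ht i) < sz (blk i)" using c cht_pos[OF less(2)] by linarith
      let ?i = "ix (blk i) (Suc (ht i))"
      have i: "?i < n" "blk ?i = blk i" "ht ?i = Suc (ht i)"
        using ix[of "blk i" "Suc (ht i)"] blk_less less(2) si by auto
      have "(J * A) $$ (?i, j) = A $$ (i, j)"
        using commute_entries(2)[OF A(1) i(1) less(3)] i less(2) by simp
      then have "(A * J) $$ (?i, j) \<noteq> 0" using A less by simp
      then have j: "Suc (ht j) < sz (blk j)" "A $$ (?i, ix (blk j) (Suc (ht j))) \<noteq> 0"
        using commute_entries(1)[OF A(1) i(1) less(3)] by (auto split: if_splits)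
      have j': "ix (blk j) (Suc (ht j)) < n" "cht (ix (blk j) (Suc (ht j))) + 1 = cht j"
        using ix[of "blk j" "Suc (ht j)"] blk_less[OF less(3)] j by (auto simp: cht_def)
      have i': "cht ?i + 1 = cht i" using i si by (auto simp: cht_def)
      have "cht ?i \<le> cht (ix (blk j) (Suc (ht j)))"
        using i' by (intro less(1)) (use i j j' in auto)
      then show ?thesis using i' j' by simp
    qed
  qed
qed

lemma commute_to_bottom:
  fixes A :: "'a::comm_ring_1 mat"
  assumes A: "A \<in> carrier_mat n n" "A * J = J * A"
    and "b' < m" "b < m" "u < sz b'" "u < sz b"
  shows "A $$ (ix b' u, ix b u) = A $$ (ix b' 0, ix b 0)"
  using assms(5,6)
proof (induction u)
  case (Suc u)
  then show ?case using commute_shift[OF A assms(3,4) Suc(2,3)] by simp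
qed simp

section \<open>Reduction modulo \<open>t\<close> on the blocks of one size\<close>

definition cls :: "nat \<Rightarrow> nat list" where "cls p = sorted_list_of_set {b. b < m \<and> sz b = p}"

lemma cls: "distinct (cls p)" "sorted_wrt (<) (cls p)" "set (cls p) = {b. b < m \<and> sz b = p}"
  unfolding cls_def by auto

lemma cls_nth: "k < length (cls p) \<Longrightarrow> cls p ! k < m \<and> sz (cls p ! k) = p"
  using cls(3)[of p] nth_mem[of k "cls p"] by auto

lemma cls_mono: "k < l \<Longrightarrow> l < length (cls p) \<Longrightarrow> cls p ! k < cls p ! l"
  using cls(2)[of p] by (simp add: sorted_wrt_iff_nth_less)

lemma cls_ex: "b < m \<Longrightarrow> \<exists>k<length (cls (sz b)). cls (sz b) ! k = b"
  using cls(3)[of "sz b"] by (metis (mono_tags, lifting) in_set_conv_nth mem_Collect_eq)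

definition rk :: "nat \<Rightarrow> nat" where "rk b = (SOME k. k < length (cls (sz b)) \<and> cls (sz b) ! k = b)"

lemma rk: "b < m \<Longrightarrow> rk b < length (cls (sz b)) \<and> cls (sz b) ! rk b = b"
  unfolding rk_def by (rule someI_ex) (use cls_ex in blast)

lemma rk_cls: "k < length (cls p) \<Longrightarrow> rk (cls p ! k) = k"
  using rk[of "cls p ! k"] cls_nth[of k p] cls(1)[of p] by (auto simp: nth_eq_iff_index_eq)

lemma rk_less_iff:
  assumes "b < m" "b' < m" "sz b = sz b'"
  shows "rk b < rk b' \<longleftrightarrow> b < b'"
  using rk[OF assms(1)] rk[OF assms(2)] cls_mono assms(3) by (metis less_asym linorder_neqE_nat)

lemma sum_class:
  assumes "u < p"
  shows "(\<Sum>l<n. if ht l = u \<and> sz (blk l) = p then f l else 0) = (\<Sum>k<length (cls p). f (ix (cls p ! k) u))"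
proof -
  let ?X = "{l \<in> {..<n}. ht l = u \<and> sz (blk l) = p}"
  have "(\<Sum>l<n. if ht l = u \<and> sz (blk l) = p then f l else 0) = (\<Sum>l\<in>?X. f l)"
    by (subst sum.inter_filter) auto
  also have "\<dots> = (\<Sum>k<length (cls p). f (ix (cls p ! k) u))"
  proof (rule sum.reindex_bij_witness[where j = "\<lambda>l. rk (blk l)" and i = "\<lambda>k. ix (cls p ! k) u"])
    fix l assume "l \<in> ?X"
    then have l: "l < n" "ht l = u" "sz (blk l) = p" by auto
    note r = rk[OF blk_less[OF l(1)]]
    show "ix (cls p ! rk (blk l)) u = l" using r l by auto
    then show "f (ix (cls p ! rk (blk l)) u) = f l" by simp
    show "rk (blk l) \<in> {..<length (cls p)}" using r l by auto
  next
    fix k assume "k \<in> {..<length (cls p)}"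
    then have k: "k < length (cls p)" by simp
    then show "rk (blk (ix (cls p ! k) u)) = k" "ix (cls p ! k) u \<in> ?X"
      using ix[of "cls p ! k" u] cls_nth[OF k] assms rk_cls by auto
  qed
  finally show ?thesis .
qed

text \<open>The entries between generators (height 0) of the blocks of size \<open>p\<close>. For a
  matrix commuting with \<open>J\<close> they determine the entries between these blocks at all
  equal heights, by \<open>commute_to_bottom\<close>.\<close>

definition res :: "nat \<Rightarrow> 'a::comm_ring_1 mat \<Rightarrow> 'a mat" where
  "res p A = mat (length (cls p)) (length (cls p)) (\<lambda>(i, j). A $$ (ix (cls p ! i) 0, ix (cls p ! j) 0))"

lemma res_carrier [simp]: "res p A \<in> carrier_mat (length (cls p)) (length (cls p))"
  by (simp add: res_def)

text \<open>A nonzero product of two entries passes through an index whose height and coheight are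
  squeezed between those of the two ends. So only generators of blocks of the same size contribute
  to the sum.\<close>

lemma res_mult:
  fixes A A' :: "'a::comm_ring_1 mat"
  assumes A: "A \<in> carrier_mat n n" "A * J = J * A" and A': "A' \<in> carrier_mat n n" "A' * J = J * A'"
  shows "res p (A * A') = res p A * res p A'"
proof (intro eq_matI)
  fix i j assume "i < dim_row (res p A * res p A')" "j < dim_col (res p A * res p A')"
  then have ij: "i < length (cls p)" "j < length (cls p)" by (auto simp: res_def)
  define x y where "x = ix (cls p ! i) 0" and "y = ix (cls p ! j) 0"
  have p: "0 < p" using cls_nth[OF ij(1)] sz_pos[of "cls p ! i"] by auto
  have x: "x < n" "ht x = 0" "sz (blk x) = p" and y: "y < n" "ht y = 0" "sz (blk y) = p"
    using ix[of "cls p ! i" 0] ix[of "cls p ! j" 0] cls_nth[OF ij(1)] cls_nth[OF ij(2)] p by (auto simp: x_def y_def)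
  have "res p (A * A') $$ (i, j) = (\<Sum>l<n. A $$ (x, l) * A' $$ (l, y))"
    using ij index_mult_mat_sum[OF A(1) A'(1) x(1) y(1)] by (simp add: res_def x_def y_def)
  also have "\<dots> = (\<Sum>l<n. if ht l = 0 \<and> sz (blk l) = p then A $$ (x, l) * A' $$ (l, y) else 0)"
  proof (rule sum.cong)
    fix l assume "l \<in> {..<n}"
    then have l: "l < n" by simp
    have "ht l = 0 \<and> sz (blk l) = p" if "A $$ (x, l) \<noteq> 0" "A' $$ (l, y) \<noteq> 0"
      using commute_height[OF A x(1) l that(1)] commute_height[OF A' l y(1) that(2)] x y
      by (auto simp: cht_def)
    then show "A $$ (x, l) * A' $$ (l, y) = (if ht l = 0 \<and> sz (blk l) = p then A $$ (x, l) * A' $$ (l, y) else 0)"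
      by (cases "A $$ (x, l) = 0"; cases "A' $$ (l, y) = 0") auto
  qed simp
  also have "\<dots> = (\<Sum>k<length (cls p). A $$ (x, ix (cls p ! k) 0) * A' $$ (ix (cls p ! k) 0, y))"
    by (rule sum_class[OF p])
  also have "\<dots> = (\<Sum>k<length (cls p). res p A $$ (i, k) * res p A' $$ (k, j))"
    using ij by (intro sum.cong) (auto simp: res_def x_def y_def)
  also have "\<dots> = (res p A * res p A') $$ (i, j)"
    by (rule index_mult_mat_sum[OF res_carrier res_carrier ij, symmetric])
  finally show "res p (A * A') $$ (i, j) = (res p A * res p A') $$ (i, j)" .
qed (auto simp: res_def)

lemma commute_mult:
  fixes A A' :: "'a::comm_ring_1 mat"
  assumes A: "A \<in> carrier_mat n n" "A * J = J * A" and A': "A' \<in> carrier_mat n n" "A' * J = J * A'"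
  shows "A * A' * J = J * (A * A')"
proof -
  have "A * A' * J = A * (A' * J)" using A A' by (intro assoc_mult_mat[of _ n n _ n _ n]) auto
  also have "\<dots> = A * J * A'" unfolding A'(2) using A A' by (intro assoc_mult_mat[of _ n n _ n _ n, symmetric]) auto
  also have "\<dots> = J * (A * A')" unfolding A(2) using A A' by (intro assoc_mult_mat[of _ n n _ n _ n]) auto
  finally show ?thesis .
qed

lemma commute_pow:
  fixes A :: "'a::comm_ring_1 mat"
  assumes A: "A \<in> carrier_mat n n" "A * J = J * A"
  shows "A ^\<^sub>m k * J = J * A ^\<^sub>m k"
proof (induction k)
  case 0
  show ?case using A by (simp add: left_mult_one_mat[of _ n n] right_mult_one_mat[of _ n n])
next
  case (Suc k)
  then show ?case using commute_mult[OF pow_carrier_mat[OF A(1)] Suc A] by simp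
qed

lemma res_pow:
  fixes A :: "'a::comm_ring_1 mat"
  assumes A: "A \<in> carrier_mat n n" "A * J = J * A"
  shows "res p (A ^\<^sub>m k) = res p A ^\<^sub>m k"
proof (induction k)
  case 0
  show ?case
  proof (intro eq_matI)
    fix i j assume "i < dim_row (res p A ^\<^sub>m 0)" "j < dim_col (res p A ^\<^sub>m 0)"
    then have ij: "i < length (cls p)" "j < length (cls p)" by (auto simp: res_def)
    have p: "0 < p" using cls_nth[OF ij(1)] sz_pos[of "cls p ! i"] by auto
    note x = ix[of "cls p ! i" 0] ix[of "cls p ! j" 0]
    have "ix (cls p ! i) 0 = ix (cls p ! j) 0 \<longleftrightarrow> i = j"
      using x cls_nth[OF ij(1)] cls_nth[OF ij(2)] p cls(1)[of p] ij by (metis nth_eq_iff_index_eq)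
    then show "res p (A ^\<^sub>m 0) $$ (i, j) = (res p A ^\<^sub>m 0) $$ (i, j)"
      using x ij A cls_nth[OF ij(1)] cls_nth[OF ij(2)] p by (auto simp: res_def)
  qed (auto simp: res_def)
next
  case (Suc k)
  then show ?case using res_mult[OF pow_carrier_mat[OF A(1)] commute_pow[OF A] A] by simp
qed

text \<open>A section of \<open>res\<close>: repeating the same matrix at every height gives a
  matrix that commutes with \<open>J\<close>.\<close>

definition lift :: "(nat \<Rightarrow> 'a::comm_ring_1 mat) \<Rightarrow> 'a mat" where
  "lift X = mat n n (\<lambda>(i, j). if ht i = ht j \<and> sz (blk i) = sz (blk j)
     then X (sz (blk i)) $$ (rk (blk i), rk (blk j)) else 0)"

lemma lift_carrier [simp]: "lift X \<in> carrier_mat n n"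
  by (simp add: lift_def)

lemma lift_commute: "lift X * J = J * lift X"
proof (intro eq_matI)
  fix i j assume "i < dim_row (J * lift X)" "j < dim_col (J * lift X)"
  then have ij: "i < n" "j < n" by (auto simp: lift_def shift_mat_def)
  show "(lift X * J) $$ (i, j) = (J * lift X) $$ (i, j)"
    unfolding commute_entries[OF lift_carrier ij]
    using ij ix[of "blk j" "Suc (ht j)"] ix[of "blk i" "ht i - 1"] blk_less[of i] blk_less[of j] ht_less[of i] ht_less[of j]
    by (auto simp: lift_def)
qed (auto simp: lift_def shift_mat_def)

lemma lift_inverse:
  fixes X Y :: "nat \<Rightarrow> 'a::comm_ring_1 mat"
  assumes X: "\<And>p. X p \<in> carrier_mat (length (cls p)) (length (cls p))"
    and Y: "\<And>p. Y p \<in> carrier_mat (length (cls p)) (length (cls p))"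
    and XY: "\<And>p. X p * Y p = 1\<^sub>m (length (cls p))"
  shows "lift X * lift Y = 1\<^sub>m n"
proof (intro eq_matI)
  fix i j assume "i < dim_row (1\<^sub>m n :: 'a mat)" "j < dim_col (1\<^sub>m n :: 'a mat)"
  then have ij: "i < n" "j < n" by auto
  define p where "p = sz (blk i)"
  have u: "ht i < p" using ht_less[OF ij(1)] by (simp add: p_def)
  have ri: "rk (blk i) < length (cls p)" using rk[OF blk_less[OF ij(1)]] by (simp add: p_def)
  have "(lift X * lift Y) $$ (i, j) = (\<Sum>l<n. lift X $$ (i, l) * lift Y $$ (l, j))"
    by (rule index_mult_mat_sum[OF lift_carrier lift_carrier ij])
  also have "\<dots> = (\<Sum>l<n. if ht l = ht i \<and> sz (blk l) = p then lift X $$ (i, l) * lift Y $$ (l, j) else 0)"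
    by (rule sum.cong) (use ij in \<open>auto simp: lift_def p_def\<close>)
  also have "\<dots> = (\<Sum>k<length (cls p). lift X $$ (i, ix (cls p ! k) (ht i)) * lift Y $$ (ix (cls p ! k) (ht i), j))"
    by (rule sum_class[OF u])
  also have "\<dots> = (\<Sum>k<length (cls p). X p $$ (rk (blk i), k) *
      (if ht i = ht j \<and> p = sz (blk j) then Y p $$ (k, rk (blk j)) else 0))"
  proof (rule sum.cong)
    fix k assume "k \<in> {..<length (cls p)}"
    then have k: "k < length (cls p)" by simp
    note c = cls_nth[OF k]
    define z where "z = ix (cls p ! k) (ht i)"
    have "z < n" "sz (blk z) = p" "rk (blk z) = k" "ht z = ht i" "sz (blk i) = p"
      using ix[of "cls p ! k" "ht i"] c u rk_cls[OF k] by (auto simp: z_def p_def)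
    then show "lift X $$ (i, ix (cls p ! k) (ht i)) * lift Y $$ (ix (cls p ! k) (ht i), j) =
      X p $$ (rk (blk i), k) * (if ht i = ht j \<and> p = sz (blk j) then Y p $$ (k, rk (blk j)) else 0)"
      unfolding z_def[symmetric] using ij by (auto simp: lift_def)
  qed simp
  also have "\<dots> = 1\<^sub>m n $$ (i, j)"
  proof (cases "ht i = ht j \<and> p = sz (blk j)")
    case True
    then have rj: "rk (blk j) < length (cls p)" using rk[OF blk_less[OF ij(2)]] by simp
    have "(\<Sum>k<length (cls p). X p $$ (rk (blk i), k) * Y p $$ (k, rk (blk j))) = (X p * Y p) $$ (rk (blk i), rk (blk j))"
      using index_mult_mat_sum[OF X Y ri rj] by simp
    also have "\<dots> = (if rk (blk i) = rk (blk j) then 1 else 0)" using XY ri rj by simp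
    also have "\<dots> = 1\<^sub>m n $$ (i, j)"
    proof -
      have "cls p ! rk (blk i) = blk i" "cls p ! rk (blk j) = blk j"
        using rk[OF blk_less[OF ij(1)]] rk[OF blk_less[OF ij(2)]] True by (simp_all add: p_def)
      then have "i = j" if "rk (blk i) = rk (blk j)" using that True coord_inj[OF ij] by simp
      then show ?thesis using ij by auto
    qed
    finally show ?thesis using True by simp
  next
    case False
    then have "i \<noteq> j" by (auto simp: p_def)
    then show ?thesis using False ij by auto
  qed
  finally show "(lift X * lift Y) $$ (i, j) = 1\<^sub>m n $$ (i, j)" .
qed (auto simp: lift_def)

lemma res_lift:
  assumes "X p \<in> carrier_mat (length (cls p)) (length (cls p))"
  shows "res p (lift X) = X p"
proof (intro eq_matI)
  fix i j assume "i < dim_row (X p)" "j < dim_col (X p)"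
  then have ij: "i < length (cls p)" "j < length (cls p)" using assms by auto
  have p: "0 < p" using cls_nth[OF ij(1)] sz_pos[of "cls p ! i"] by auto
  show "res p (lift X) $$ (i, j) = X p $$ (i, j)"
    using ij ix[of "cls p ! i" 0] ix[of "cls p ! j" 0] cls_nth[OF ij(1)] cls_nth[OF ij(2)] p rk_cls
    by (simp add: res_def lift_def)
qed (use assms in \<open>auto simp: res_def\<close>)

text \<open>
  Modulo \<open>t\<close>, the diagonal blocks of an element of the nilpotent commutator are nilpotent, and
  conjugating them into triangular form can be done within the centralizer of \<open>J\<close>.
\<close>

lemma nilp_commutator_conj_tri:
  fixes A :: "'a::field mat"
  assumes "A \<in> nilp_commutator n J"
  obtains G H where "G \<in> carrier_mat n n" "H \<in> carrier_mat n n" "G * H = 1\<^sub>m n" "H * G = 1\<^sub>m n"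
    "G * J = J * G" "H * J = J * H" "G * A * H \<in> tri"
proof -
  have A: "A \<in> carrier_mat n n" "A * J = J * A" and nil: "A ^\<^sub>m n = 0\<^sub>m n n"
    using assms unfolding nilp_commutator_def commutator_def by auto
  have "res p A ^\<^sub>m n = 0\<^sub>m (length (cls p)) (length (cls p))" for p
  proof -
    have "res p A ^\<^sub>m n = res p (0\<^sub>m n n)" using res_pow[OF A, of p n] nil by simp
    also have "\<dots> = 0\<^sub>m (length (cls p)) (length (cls p))"
    proof (intro eq_matI)
      fix i j assume "i < dim_row (0\<^sub>m (length (cls p)) (length (cls p)) :: 'a mat)"
        "j < dim_col (0\<^sub>m (length (cls p)) (length (cls p)) :: 'a mat)"
      then have ij: "i < length (cls p)" "j < length (cls p)" by auto
      have p: "0 < p" using cls_nth[OF ij(1)] sz_pos[of "cls p ! i"] by auto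
      show "res p (0\<^sub>m n n :: 'a mat) $$ (i, j) = 0\<^sub>m (length (cls p)) (length (cls p)) $$ (i, j)"
        using ij ix[of "cls p ! i" 0] ix[of "cls p ! j" 0] cls_nth[OF ij(1)] cls_nth[OF ij(2)] p
        by (simp add: res_def)
    qed (auto simp: res_def)
    finally show ?thesis .
  qed
  then have "\<forall>p. \<exists>P Q. P \<in> carrier_mat (length (cls p)) (length (cls p)) \<and> Q \<in> carrier_mat (length (cls p)) (length (cls p)) \<and>
    P * Q = 1\<^sub>m (length (cls p)) \<and> Q * P = 1\<^sub>m (length (cls p)) \<and>
    (\<forall>i<length (cls p). \<forall>j<length (cls p). (P * res p A * Q) $$ (i, j) \<noteq> 0 \<longrightarrow> i < j)"
    using nilpotent_strictly_triangular[OF res_carrier] by blast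
  then obtain P Q where PQ: "\<And>p. P p \<in> carrier_mat (length (cls p)) (length (cls p))"
    "\<And>p. Q p \<in> carrier_mat (length (cls p)) (length (cls p))"
    "\<And>p. P p * Q p = 1\<^sub>m (length (cls p))" "\<And>p. Q p * P p = 1\<^sub>m (length (cls p))"
    "\<And>p i j. i < length (cls p) \<Longrightarrow> j < length (cls p) \<Longrightarrow> (P p * res p A * Q p) $$ (i, j) \<noteq> 0 \<Longrightarrow> i < j"
    by metis
  define G H where "G = lift P" and "H = lift Q"
  have G: "G \<in> carrier_mat n n" "G * J = J * G" and H: "H \<in> carrier_mat n n" "H * J = J * H"
    using lift_commute by (auto simp: G_def H_def)
  have GA: "G * A \<in> carrier_mat n n" "G * A * J = J * (G * A)" using G A commute_mult[OF G A] by auto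
  have GAH: "G * A * H \<in> carrier_mat n n" "G * A * H * J = J * (G * A * H)"
    using GA H commute_mult[OF GA H] by auto
  have res: "res p (G * A * H) = P p * res p A * Q p" for p
    using res_mult[OF GA H] res_mult[OF G A] res_lift[of P p, OF PQ(1)] res_lift[of Q p, OF PQ(2)] by (simp add: G_def H_def)
  have "prec j i" if i: "i < n" and j: "j < n" and nz: "(G * A * H) $$ (i, j) \<noteq> 0" for i j
  proof -
    note h = commute_height[OF GAH i j nz]
    have "blk i < blk j" if e: "ht j = ht i" "cht j = cht i"
    proof -
      define p where "p = sz (blk i)"
      have p: "sz (blk i) = p" "sz (blk j) = p" using e ht_cht[OF i] ht_cht[OF j] by (auto simp: p_def)
      have r: "rk (blk i) < length (cls p)" "cls p ! rk (blk i) = blk i"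
        "rk (blk j) < length (cls p)" "cls p ! rk (blk j) = blk j"
        using rk[OF blk_less[OF i]] rk[OF blk_less[OF j]] p by auto
      have "(G * A * H) $$ (i, j) = (G * A * H) $$ (ix (blk i) 0, ix (blk j) 0)"
        using commute_to_bottom[OF GAH blk_less[OF i] blk_less[OF j], of "ht i"]
          ht_less[OF i] ht_less[OF j] e i j by (metis ix_coord)
      also have "\<dots> = res p (G * A * H) $$ (rk (blk i), rk (blk j))" using r by (simp add: res_def)
      finally have "(P p * res p A * Q p) $$ (rk (blk i), rk (blk j)) \<noteq> 0" using nz res by simp
      then show ?thesis using PQ(5) r rk_less_iff[OF blk_less[OF i] blk_less[OF j]] p by auto
    qed
    then show ?thesis using h by (simp add: prec_def)
  qed
  then have "G * A * H \<in> tri" using GAH by (auto simp: tri_def)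
  moreover have "G * H = 1\<^sub>m n" "H * G = 1\<^sub>m n"
    unfolding G_def H_def using lift_inverse[of P Q] lift_inverse[of Q P] PQ by auto
  ultimately show ?thesis using that G H by blast
qed

lemma nilpotent_of_rank:
  fixes A :: "'a::comm_ring_1 mat"
  assumes A: "A \<in> carrier_mat n n" and r: "\<And>i. i < n \<Longrightarrow> r i < n"
    and up: "\<And>i j. i < n \<Longrightarrow> j < n \<Longrightarrow> A $$ (i, j) \<noteq> 0 \<Longrightarrow> r j < r i"
  shows "A ^\<^sub>m n = 0\<^sub>m n n"
proof -
  have "r j + k \<le> r i" if "i < n" "j < n" "(A ^\<^sub>m k) $$ (i, j) \<noteq> 0" for i j and k :: nat
    using that
  proof (induction k arbitrary: i j)
    case 0
    then show ?case using A by (auto split: if_splits)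
  next
    case (Suc k)
    have "(A ^\<^sub>m Suc k) $$ (i, j) = (\<Sum>l<n. (A ^\<^sub>m k) $$ (i, l) * A $$ (l, j))"
      using index_mult_mat_sum[OF pow_carrier_mat[OF A] A Suc.prems(1,2)] by simp
    then obtain l where l: "l < n" "(A ^\<^sub>m k) $$ (i, l) * A $$ (l, j) \<noteq> 0"
      using Suc.prems(3) by (metis (no_types, lifting) lessThan_iff sum.neutral)
    then have "r l + k \<le> r i" "r j < r l" using Suc.IH[of i l] Suc.prems up[of l j] by (force, force)
    then show ?case by simp
  qed
  then have "(A ^\<^sub>m n) $$ (i, j) = 0" if "i < n" "j < n" for i j
    using that r[of i] by (meson add_leE leD)
  then show ?thesis using A by (intro eq_matI) auto
qed

lemma tri_nilp_commutator: "tri \<subseteq> (nilp_commutator n J :: 'a::comm_ring_1 mat set)"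
proof
  fix A :: "'a mat" assume A: "A \<in> tri"
  \<comment> \<open>The number of predecessors is a rank function, since \<open>prec\<close> is
    transitive and irreflexive.\<close>
  let ?r = "\<lambda>i. card {j. j < n \<and> prec j i}"
  have "A ^\<^sub>m n = 0\<^sub>m n n"
  proof (rule nilpotent_of_rank[where r = ?r])
    fix i assume i: "i < n"
    have "card {j. j < n \<and> prec j i} < card {..<n}"
    proof (rule psubset_card_mono)
      have "i \<in> {..<n}" "i \<notin> {j. j < n \<and> prec j i}" using i by auto
      then show "{j. j < n \<and> prec j i} \<subset> {..<n}" by blast
    qed simp
    then show "?r i < n" by (simp only: card_lessThan)
    fix j assume "j < n" "A $$ (i, j) \<noteq> 0"
    then have "prec j i" "j < n" using A i by (auto simp: tri_def)
    then have "j \<in> {l. l < n \<and> prec l i}" "j \<notin> {l. l < n \<and> prec l j}"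
      "{l. l < n \<and> prec l j} \<subseteq> {l. l < n \<and> prec l i}" using prec_trans by auto
    then have "{l. l < n \<and> prec l j} \<subset> {l. l < n \<and> prec l i}" by blast
    then show "?r j < ?r i" by (rule psubset_card_mono[rotated]) simp
  qed (use A in \<open>auto simp: tri_def\<close>)
  then show "A \<in> nilp_commutator n J" using A by (auto simp: tri_def nilp_commutator_def commutator_def)
qed

end

section \<open>Genericity\<close>

definition ispoly :: "('a::comm_ring_1 \<Rightarrow> 'a) \<Rightarrow> bool" where
  "ispoly f \<longleftrightarrow> (\<exists>p. \<forall>s. f s = poly p s)"

lemma ispoly_const: "ispoly (\<lambda>s. c)"
  unfolding ispoly_def by (intro exI[of _ "[:c:]"]) simp

lemma ispoly_id: "ispoly (\<lambda>s. s)"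
  unfolding ispoly_def by (intro exI[of _ "[:0, 1:]"]) simp

lemma ispoly_add: "ispoly f \<Longrightarrow> ispoly g \<Longrightarrow> ispoly (\<lambda>s. f s + g s)"
  unfolding ispoly_def
  by (elim exE, rule_tac x = "p + pa" in exI) simp

lemma ispoly_mult: "ispoly f \<Longrightarrow> ispoly g \<Longrightarrow> ispoly (\<lambda>s. f s * g s)"
  unfolding ispoly_def
  by (elim exE, rule_tac x = "p * pa" in exI) simp

lemma ispoly_sum: "(\<And>x. x \<in> S \<Longrightarrow> ispoly (f x)) \<Longrightarrow> ispoly (\<lambda>s. \<Sum>x\<in>S. f x s)"
  by (induction S rule: infinite_finite_induct) (auto intro: ispoly_const ispoly_add)

lemma ispoly_power: "ispoly (\<lambda>s. s ^ k)"
  by (induction k) (auto intro: ispoly_const ispoly_mult ispoly_id)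

text \<open>All uses of the infinite field go through this lemma: a nonzero product of polynomials
  has only finitely many roots. It replaces irreducibility of the variety by irreducibility of the
  affine line.\<close>

lemma common_nonroot:
  fixes f g :: "'a::field \<Rightarrow> 'a"
  assumes "infinite (UNIV :: 'a set)" "ispoly f" "ispoly g" "f a \<noteq> 0" "g b \<noteq> 0"
  obtains s where "f s \<noteq> 0" "g s \<noteq> 0"
proof -
  obtain p q where p: "\<And>s. f s = poly p s" "\<And>s. g s = poly q s"
    using assms unfolding ispoly_def by blast
  then have "p * q \<noteq> 0" using assms by auto
  then have "finite {s. poly (p * q) s = 0}" by (rule poly_roots_finite)
  then obtain s where "poly (p * q) s \<noteq> 0" using ex_new_if_finite[OF assms(1)] by blast
  then show ?thesis using that[of s] p by simp
qed

definition poly_path :: "nat \<Rightarrow> ('a::comm_ring_1 \<Rightarrow> 'a mat) \<Rightarrow> bool" where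
  "poly_path n M \<longleftrightarrow> (\<forall>s. M s \<in> carrier_mat n n) \<and> (\<forall>i<n. \<forall>j<n. ispoly (\<lambda>s. M s $$ (i, j)))"

lemma poly_path_const: "C \<in> carrier_mat n n \<Longrightarrow> poly_path n (\<lambda>s. C)"
  by (simp add: poly_path_def ispoly_const)

lemma poly_pathD:
  assumes "poly_path n M"
  shows "M s \<in> carrier_mat n n" "i < n \<Longrightarrow> j < n \<Longrightarrow> ispoly (\<lambda>s. M s $$ (i, j))"
  using assms unfolding poly_path_def by blast+

lemma poly_path_mult:
  assumes "poly_path n M" "poly_path n N"
  shows "poly_path n (\<lambda>s. M s * N s)"
  unfolding poly_path_def
proof (intro conjI allI impI)
  fix i j assume ij: "i < n" "j < n"
  show "ispoly (\<lambda>s. (M s * N s) $$ (i, j))"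
    unfolding index_mult_mat_sum[OF poly_pathD(1)[OF assms(1)] poly_pathD(1)[OF assms(2)] ij]
    by (intro ispoly_sum ispoly_mult poly_pathD(2)[OF assms(1)] poly_pathD(2)[OF assms(2)]) (use ij in simp_all)
qed (rule mult_carrier_mat[OF poly_pathD(1)[OF assms(1)] poly_pathD(1)[OF assms(2)]])

lemma poly_functions_path:
  assumes "f \<in> poly_functions n" "poly_path n M"
  shows "ispoly (\<lambda>s. f (M s))"
  using assms(1)
proof induction
  case (entry i j)
  then show ?case by (rule poly_pathD(2)[OF assms(2)])
qed (intro ispoly_const ispoly_add ispoly_mult; assumption)+

text \<open>Members of \<open>poly_functions\<close> are functions on matrices of all sizes, whereas
  formulas such as the Leibniz expansion of \<open>det\<close> hold for size \<open>n\<close>; hence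
  agreement is only asked for there.\<close>

definition regular :: "nat \<Rightarrow> ('a::comm_ring_1 mat \<Rightarrow> 'a) \<Rightarrow> bool" where
  "regular n g \<longleftrightarrow> (\<exists>f\<in>poly_functions n. \<forall>A\<in>carrier_mat n n. f A = g A)"

lemma regular_const: "regular n (\<lambda>A. c)"
  unfolding regular_def by (rule bexI[OF _ poly_functions.const[of c]]) simp

lemma regular_entry: "i < n \<Longrightarrow> j < n \<Longrightarrow> regular n (\<lambda>A. A $$ (i, j))"
  unfolding regular_def by (rule bexI[OF _ poly_functions.entry[of i n j]]) simp_all

lemma regular_add:
  assumes "regular n f" "regular n g"
  shows "regular n (\<lambda>A. f A + g A)"
proof -
  obtain f' g' where "f' \<in> poly_functions n" "\<forall>A\<in>carrier_mat n n. f' A = f A"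
    "g' \<in> poly_functions n" "\<forall>A\<in>carrier_mat n n. g' A = g A"
    using assms unfolding regular_def by blast
  then show ?thesis unfolding regular_def by (intro bexI[OF _ poly_functions.add[of f' n g']]) auto
qed

lemma regular_mult:
  assumes "regular n f" "regular n g"
  shows "regular n (\<lambda>A. f A * g A)"
proof -
  obtain f' g' where "f' \<in> poly_functions n" "\<forall>A\<in>carrier_mat n n. f' A = f A"
    "g' \<in> poly_functions n" "\<forall>A\<in>carrier_mat n n. g' A = g A"
    using assms unfolding regular_def by blast
  then show ?thesis unfolding regular_def by (intro bexI[OF _ poly_functions.mult[of f' n g']]) auto
qed

lemma regular_sum: "(\<And>x. x \<in> S \<Longrightarrow> regular n (f x)) \<Longrightarrow> regular n (\<lambda>A. \<Sum>x\<in>S. f x A)"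
  by (induction S rule: infinite_finite_induct) (auto intro: regular_const regular_add)

lemma regular_prod: "(\<And>x. x \<in> S \<Longrightarrow> regular n (f x)) \<Longrightarrow> regular n (\<lambda>A. \<Prod>x\<in>S. f x A)"
  by (induction S rule: infinite_finite_induct) (auto intro: regular_const regular_mult)

lemma regular_cong:
  assumes "\<And>A. A \<in> carrier_mat n n \<Longrightarrow> f A = g A" "regular n g"
  shows "regular n f"
proof -
  obtain h where "h \<in> poly_functions n" "\<forall>A\<in>carrier_mat n n. h A = g A"
    using assms(2) unfolding regular_def by (elim bexE)
  then show ?thesis using assms(1) unfolding regular_def by (intro bexI[of _ h]) simp_all
qed

lemma regular_pow_entry:
  assumes "i < n" "j < n"
  shows "regular n (\<lambda>A. (A ^\<^sub>m k) $$ (i, j))"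
  using assms
proof (induction k arbitrary: i j)
  case 0
  show ?case
  proof (rule regular_cong)
    show "(A ^\<^sub>m 0) $$ (i, j) = (if i = j then 1 else 0)" if "A \<in> carrier_mat n n" for A :: "'a mat"
      using that 0 by auto
  qed (rule regular_const)
next
  case (Suc k)
  show ?case
  proof (rule regular_cong)
    show "(A ^\<^sub>m Suc k) $$ (i, j) = (\<Sum>l<n. (A ^\<^sub>m k) $$ (i, l) * A $$ (l, j))"
      if "A \<in> carrier_mat n n" for A :: "'a mat"
      using index_mult_mat_sum[OF pow_carrier_mat[OF that] that Suc.prems] by simp
    show "regular n (\<lambda>A :: 'a mat. \<Sum>l<n. (A ^\<^sub>m k) $$ (i, l) * A $$ (l, j))"
      using Suc by (intro regular_sum regular_mult regular_entry) auto
  qed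
qed

lemma regular_det_pow:
  assumes "C \<in> carrier_mat n n"
  shows "regular n (\<lambda>A. det (A ^\<^sub>m k + C))"
proof (rule regular_cong)
  fix A :: "'a mat" assume A: "A \<in> carrier_mat n n"
  have c: "A ^\<^sub>m k + C \<in> carrier_mat n n" using A assms by simp
  have e: "(A ^\<^sub>m k + C) $$ (i, p i) = (A ^\<^sub>m k) $$ (i, p i) + C $$ (i, p i)" if "i < n" "p permutes {0..<n}" for i p
    using that A assms permutes_in_image[OF that(2), of i] by simp
  show "det (A ^\<^sub>m k + C) = (\<Sum>p\<in>{p. p permutes {0..<n}}. signof p * (\<Prod>i\<in>{0..<n}. (A ^\<^sub>m k) $$ (i, p i) + C $$ (i, p i)))"
    unfolding det_def'[OF c] using e by (intro sum.cong refl arg_cong2[where f = "(*)"] prod.cong) auto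
next
  have "i < n \<Longrightarrow> p permutes {0..<n} \<Longrightarrow> p i < n" for p i
    using permutes_in_image[of p "{0..<n}" i] by simp
  then show "regular n (\<lambda>A :: 'a mat. \<Sum>p\<in>{p. p permutes {0..<n}}. signof p * (\<Prod>i\<in>{0..<n}. (A ^\<^sub>m k) $$ (i, p i) + C $$ (i, p i)))"
    by (intro regular_sum regular_mult regular_prod regular_add regular_const regular_pow_entry) auto
qed

lemma regular_path:
  assumes "regular n g" "poly_path n M"
  shows "ispoly (\<lambda>s. g (M s))"
proof -
  obtain f where f: "f \<in> poly_functions n" "\<forall>A\<in>carrier_mat n n. f A = g A"
    using assms unfolding regular_def by blast
  then have "(\<lambda>s. g (M s)) = (\<lambda>s. f (M s))" using poly_pathD(1)[OF assms(2)] by simp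
  then show ?thesis using poly_functions_path[OF f(1) assms(2)] by simp
qed

text \<open>The matrices \<open>K\<close> and \<open>R\<close> that work for \<open>A\<close> are
  kept fixed. They work for every \<open>X\<close> at which the determinant, now a polynomial
  function of \<open>X\<close>, does not vanish.\<close>

lemma corank_le_open:
  fixes A :: "'a::field mat"
  assumes "A \<in> carrier_mat n n" "corank_le n (A ^\<^sub>m k) d"
  obtains g where "regular n g" "g A \<noteq> 0"
    "\<And>X. X \<in> carrier_mat n n \<Longrightarrow> g X \<noteq> 0 \<Longrightarrow> corank_le n (X ^\<^sub>m k) d"
proof -
  obtain K R D where K: "K \<in> carrier_mat n n" "R \<in> carrier_mat n n" "D \<subseteq> {..<n}" "card D \<le> d"
    "rows_in D R" "det (A ^\<^sub>m k + K * R) \<noteq> 0" using assms unfolding corank_le_def by blast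
  show ?thesis
  proof (rule that)
    show "regular n (\<lambda>X. det (X ^\<^sub>m k + K * R))" using K by (intro regular_det_pow) simp
    show "det (A ^\<^sub>m k + K * R) \<noteq> 0" by fact
    show "corank_le n (X ^\<^sub>m k) d" if "det (X ^\<^sub>m k + K * R) \<noteq> 0" for X
      unfolding corank_le_def using K that by (intro exI[of _ K] exI[of _ R] exI[of _ D]) simp
  qed
qed

lemma corank_le_trivial:
  fixes F :: "'a::field mat"
  assumes "F \<in> carrier_mat n n"
  shows "corank_le n F n"
  by (rule corank_le_unit_columns[OF assms, of "{}"]) auto

definition line :: "nat \<Rightarrow> 'a::comm_ring_1 mat \<Rightarrow> 'a mat \<Rightarrow> 'a \<Rightarrow> 'a mat" where
  "line n X Y s = mat n n (\<lambda>(i, j). X $$ (i, j) + s * (Y $$ (i, j) - X $$ (i, j)))"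

lemma poly_path_line: "poly_path n (line n X Y)"
  unfolding poly_path_def line_def
  by (auto intro!: ispoly_add ispoly_mult ispoly_const ispoly_id)

lemma line_ends:
  assumes "X \<in> carrier_mat n n" "Y \<in> carrier_mat n n"
  shows "line n X Y 0 = X" "line n X Y 1 = Y"
  using assms by (auto simp: line_def intro!: eq_matI)

lemma sum_min_ge: "(\<And>q. q \<in># Q \<Longrightarrow> q \<le> k) \<Longrightarrow> (\<Sum>q\<in>#Q. min k q) = sum_mset (Q :: nat multiset)"
  by (induction Q) auto

lemma partition_part_le: "partition_of n Q \<Longrightarrow> q \<in># Q \<Longrightarrow> q \<le> n"
  unfolding partition_of_def by (metis le_add1 sum_mset.remove)

section \<open>Minimal kernel dimensions and the generic Jordan type\<close>

context pos_block_coords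
begin

lemma tri_carrier: "A \<in> tri \<Longrightarrow> A \<in> carrier_mat n n" by (simp add: tri_def)

lemma line_tri:
  assumes X: "X \<in> tri" and Y: "Y \<in> tri"
  shows "line n X Y s \<in> tri"
proof -
  have c: "X \<in> carrier_mat n n" "Y \<in> carrier_mat n n" "line n X Y s \<in> carrier_mat n n"
    using X Y by (auto simp: tri_def line_def)
  have eX: "(X * J) $$ (i, j) = (J * X) $$ (i, j)" and eY: "(Y * J) $$ (i, j) = (J * Y) $$ (i, j)" for i j
    using X Y by (auto simp: tri_def)
  have "line n X Y s * J = J * line n X Y s"
  proof (intro eq_matI)
    fix i j assume "i < dim_row (J * line n X Y s)" "j < dim_col (J * line n X Y s)"
    then have ij: "i < n" "j < n" by (auto simp: line_def shift_mat_def)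
    note e = eX[of i j, unfolded commute_entries[OF c(1) ij]] eY[of i j, unfolded commute_entries[OF c(2) ij]]
    show "(line n X Y s * J) $$ (i, j) = (J * line n X Y s) $$ (i, j)"
      unfolding commute_entries[OF c(3) ij]
      using e ij ix[of "blk j" "Suc (ht j)"] ix[of "blk i" "ht i - 1"] blk_less[of i] blk_less[of j] ht_less[of i]
      by (auto simp: line_def split: if_splits)
  qed (auto simp: line_def shift_mat_def)
  moreover have "prec j i" if "i < n" "j < n" "line n X Y s $$ (i, j) \<noteq> 0" for i j
  proof -
    have "X $$ (i, j) \<noteq> 0 \<or> Y $$ (i, j) \<noteq> 0" using that by (auto simp: line_def)
    then show ?thesis using X Y that by (auto simp: tri_def)
  qed
  ultimately show ?thesis using c by (auto simp: tri_def)
qed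

lemma zero_tri: "0\<^sub>m n n \<in> tri"
  by (auto simp: tri_def left_mult_zero_mat[of _ n n] right_mult_zero_mat[of _ n n])

lemma tri_pow_ge:
  assumes "A \<in> tri" "n \<le> k"
  shows "A ^\<^sub>m k = 0\<^sub>m n n"
proof -
  have "A ^\<^sub>m n = 0\<^sub>m n n" "A \<in> carrier_mat n n"
    using assms tri_nilp_commutator by (auto simp: nilp_commutator_def tri_def)
  moreover have "A ^\<^sub>m (n + l) = 0\<^sub>m n n" if "A ^\<^sub>m n = 0\<^sub>m n n" "A \<in> carrier_mat n n" for l
    using that by (induction l) auto
  ultimately show ?thesis using assms(2) le_Suc_ex by metis
qed

text \<open>Each bound holds on an open set. Two open sets that both meet the linear space
  \<open>tri\<close> also meet on the line through their witnesses, which stays in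
  \<open>tri\<close>; so the exponents can be added one by one.\<close>

lemma ex_simultaneous:
  fixes nu :: "nat \<Rightarrow> nat"
  assumes inf: "infinite (UNIV :: 'a::field set)"
    and nu: "\<And>k. \<exists>A\<in>(tri :: 'a mat set). corank_le n (A ^\<^sub>m k) (nu k)"
  shows "\<exists>A\<in>(tri :: 'a mat set). \<exists>g. regular n g \<and> g A \<noteq> 0 \<and>
    (\<forall>X\<in>carrier_mat n n. g X \<noteq> 0 \<longrightarrow> (\<forall>k<M. corank_le n (X ^\<^sub>m k) (nu k)))"
proof (induction M)
  case 0
  show ?case by (intro bexI[OF _ zero_tri] exI[of _ "\<lambda>A. 1"]) (auto intro: regular_const)
next
  case (Suc M)
  then obtain A g where A: "A \<in> (tri :: 'a mat set)" "regular n g" "g A \<noteq> 0"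
    "\<And>X k. X \<in> carrier_mat n n \<Longrightarrow> g X \<noteq> 0 \<Longrightarrow> k < M \<Longrightarrow> corank_le n (X ^\<^sub>m k) (nu k)" by blast
  obtain B where B: "B \<in> (tri :: 'a mat set)" "corank_le n (B ^\<^sub>m M) (nu M)" using nu by blast
  obtain h where h: "regular n h" "h B \<noteq> 0"
    "\<And>X. X \<in> carrier_mat n n \<Longrightarrow> h X \<noteq> 0 \<Longrightarrow> corank_le n (X ^\<^sub>m M) (nu M)"
    using corank_le_open[OF tri_carrier[OF B(1)] B(2)] by blast
  note le = line_ends[OF tri_carrier[OF A(1)] tri_carrier[OF B(1)]]
  obtain s where s: "g (line n A B s) \<noteq> 0" "h (line n A B s) \<noteq> 0"
  proof (rule common_nonroot[OF inf regular_path[OF A(2) poly_path_line[of n A B]]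
        regular_path[OF h(1) poly_path_line[of n A B]], of 0 1])
    show "g (line n A B 0) \<noteq> 0" "h (line n A B 1) \<noteq> 0" using le A h by auto
  qed blast
  show ?case
    by (intro bexI[OF _ line_tri[OF A(1) B(1), of s]] exI[of _ "\<lambda>X. g X * h X"] conjI)
      (use s A h in \<open>auto intro: regular_mult simp: less_Suc_eq\<close>)
qed

text \<open>Where \<open>g\<close> does not vanish, all kernel dimensions of a nilpotent commuting
  matrix equal the minima over \<open>tri\<close>, so a single type occurs there. That it is the
  only generic type makes the \<open>THE\<close> in \<open>generic_partition\<close>
  meaningful.\<close>

theorem generic_partition_minimizes_corank:
  assumes inf: "infinite (UNIV :: 'a::field set)"
    and P: "sum_mset P = n" "nilp_jordan_matrix P = (J :: 'a mat)"
  shows "partition_of n (generic_partition TYPE('a) P)"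
    and "\<exists>A\<in>(tri :: 'a mat set). has_jordan_type A (generic_partition TYPE('a) P)"
    and "\<And>A k d. A \<in> (tri :: 'a mat set) \<Longrightarrow> corank_le n (A ^\<^sub>m k) d \<Longrightarrow>
      (\<Sum>q\<in>#generic_partition TYPE('a) P. min k q) \<le> d"
proof -
  let ?T = "tri :: 'a mat set" and ?V = "nilp_commutator n (J :: 'a mat)"
  define nu where "nu k = (LEAST d. \<exists>A\<in>?T. corank_le n (A ^\<^sub>m k) d)" for k
  have nu: "\<exists>A\<in>?T. corank_le n (A ^\<^sub>m k) (nu k)" for k
    unfolding nu_def using corank_le_trivial[of "0\<^sub>m n n ^\<^sub>m k :: 'a mat" n] zero_tri
    by (intro LeastI[of "\<lambda>d. \<exists>A\<in>?T. corank_le n (A ^\<^sub>m k) d" n]) auto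
  have nu_le: "nu k \<le> d" if "A \<in> ?T" "corank_le n (A ^\<^sub>m k) d" for A k d
    unfolding nu_def using that by (intro Least_le) auto
  obtain A0 g where A0: "A0 \<in> ?T" "regular n g" "g A0 \<noteq> 0"
    "\<And>X k. X \<in> carrier_mat n n \<Longrightarrow> g X \<noteq> 0 \<Longrightarrow> k < n \<Longrightarrow> corank_le n (X ^\<^sub>m k) (nu k)"
    using ex_simultaneous[OF inf nu, of n] by blast
  have V: "X \<in> carrier_mat n n" "X ^\<^sub>m n = 0\<^sub>m n n" if "X \<in> ?V" for X
    using that by (auto simp: nilp_commutator_def commutator_def)
  have type: "partition_of n Q \<and> (\<forall>k. (\<Sum>q\<in>#Q. min k q) = (if k < n then nu k else n))"
    if X: "X \<in> ?V" "g X \<noteq> 0" "has_jordan_type X Q" for X Q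
  proof -
    note Q = has_jordan_type_dim[OF V(1)[OF X(1)] X(3)]
    have "(\<Sum>q\<in>#Q. min k q) = nu k" if k: "k < n" for k
    proof (rule antisym)
      show "(\<Sum>q\<in>#Q. min k q) \<le> nu k"
        using corank_ge_le has_jordan_type_corank(2)[OF V(1)[OF X(1)] X(3)] A0(4)[OF V(1)[OF X(1)] X(2) k] by blast
      \<comment> \<open>A conjugate of \<open>X\<close> lies in \<open>tri\<close>, so the kernel
        dimensions of \<open>X\<close> cannot fall below the minima taken there.\<close>
      obtain G H where GH: "G \<in> carrier_mat n n" "H \<in> carrier_mat n n" "G * H = 1\<^sub>m n" "H * G = 1\<^sub>m n"
        "G * X * H \<in> tri" using nilp_commutator_conj_tri[OF X(1)] by metis
      have w: "similar_mat_wit (G * X * H) X G H"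
        unfolding similar_mat_wit_def using GH V(1)[OF X(1)] by (simp add: Let_def)
      have "similar_mat (X ^\<^sub>m k) ((G * X * H) ^\<^sub>m k)"
        using similar_mat_wit_pow[OF w] similar_mat_sym unfolding similar_mat_def by blast
      then have "corank_le n ((G * X * H) ^\<^sub>m k) (\<Sum>q\<in>#Q. min k q)"
        using corank_le_similar[OF pow_carrier_mat[OF V(1)[OF X(1)]]]
          has_jordan_type_corank(1)[OF V(1)[OF X(1)] X(3)] by blast
      then show "nu k \<le> (\<Sum>q\<in>#Q. min k q)" using nu_le GH(5) by blast
    qed
    moreover have "(\<Sum>q\<in>#Q. min k q) = n" if "\<not> k < n" for k
      using sum_min_ge[of Q k] partition_part_le[OF Q] that Q by (force simp: partition_of_def)
    ultimately show ?thesis using Q by simp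
  qed
  have TV: "X \<in> ?V" if "X \<in> ?T" for X using that tri_nilp_commutator by blast
  have jt: "\<exists>Q. has_jordan_type X Q" if "X \<in> ?V" for X
    using nilpotent_has_jordan_type V[OF that] by blast
  obtain Q where Q: "has_jordan_type A0 Q" using jt TV A0(1) by blast
  note Qt = type[OF TV[OF A0(1)] A0(3) Q]
  have same: "has_jordan_type X Q" if X: "X \<in> ?V" "g X \<noteq> 0" for X
  proof -
    obtain Q' where Q': "has_jordan_type X Q'" using jt X by blast
    have "Q' = Q" using type[OF X Q'] Qt by (intro partition_eqI_sum_min) (auto simp: partition_of_def)
    then show ?thesis using Q' by simp
  qed
  obtain g' where g': "g' \<in> poly_functions n" "\<And>A. A \<in> carrier_mat n n \<Longrightarrow> g' A = g A"
    using A0(2) unfolding regular_def by blast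
  have "is_generic_jordan_type n ?V Q" unfolding is_generic_jordan_type_def zariski_open_in_def zariski_closed_def
  proof (intro conjI exI)
    show "partition_of n Q" using Qt by simp
    show "{g'} \<subseteq> poly_functions n" using g' by simp
    show "?V - {A \<in> carrier_mat n n. \<forall>f\<in>{g'}. f A = 0} \<noteq> {}"
      using A0 TV tri_carrier g'(2) by force
    show "\<forall>A\<in>?V - {A \<in> carrier_mat n n. \<forall>f\<in>{g'}. f A = 0}. has_jordan_type A Q"
      using same V(1) g'(2) by auto
  qed (rule refl)+
  \<comment> \<open>The open set of \<open>Q'\<close> may miss \<open>tri\<close>. A point
    \<open>Y\<close> of it is conjugated into \<open>tri\<close> and joined to \<open>A0\<close> by
    a line; the line conjugated back ends in \<open>Y\<close>. Some parameter satisfies both open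
    conditions, and there the two types belong to similar matrices.\<close>
  moreover have "Q' = Q" if gen: "is_generic_jordan_type n ?V Q'" for Q'
  proof -
    obtain F where F: "F \<subseteq> poly_functions n"
      "?V - {A \<in> carrier_mat n n. \<forall>f\<in>F. f A = 0} \<noteq> {}"
      "\<And>A. A \<in> ?V - {A \<in> carrier_mat n n. \<forall>f\<in>F. f A = 0} \<Longrightarrow> has_jordan_type A Q'"
      using gen unfolding is_generic_jordan_type_def zariski_open_in_def zariski_closed_def by blast
    then obtain Y f where Y: "Y \<in> ?V" "f \<in> F" "f Y \<noteq> 0" using V(1) by blast
    obtain G H where GH: "G \<in> carrier_mat n n" "H \<in> carrier_mat n n" "G * H = 1\<^sub>m n" "H * G = 1\<^sub>m n"
      "G * J = J * G" "H * J = J * H" "G * Y * H \<in> tri" using nilp_commutator_conj_tri[OF Y(1)] by metis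
    let ?L = "line n A0 (G * Y * H)"
    have c: "H * X * G \<in> carrier_mat n n" if "X \<in> carrier_mat n n" for X using that GH by simp
    have path: "poly_path n (\<lambda>s. H * ?L s * G)"
      using GH by (intro poly_path_mult poly_path_const poly_path_line)
    note le = line_ends[OF tri_carrier[OF A0(1)] tri_carrier[OF GH(7)]]
    have HYG: "H * (G * Y * H) * G = Y"
    proof -
      have "H * (G * Y * H) * G = (H * G) * (Y * (H * G))"
        using GH(1,2) V(1)[OF Y(1)] by (simp add: assoc_mult_mat[of _ n n _ n _ n])
      also have "\<dots> = Y" unfolding GH(4) using V(1)[OF Y(1)] by simp
      finally show ?thesis .
    qed
    obtain s where s: "g (?L s) \<noteq> 0" "f (H * ?L s * G) \<noteq> 0"
    proof (rule common_nonroot[OF inf regular_path[OF A0(2) poly_path_line[of n A0 "G * Y * H"]]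
          poly_functions_path[OF _ path, of f], of 0 1])
      show "f \<in> poly_functions n" using F Y by blast
      show "g (?L 0) \<noteq> 0" "f (H * ?L 1 * G) \<noteq> 0" using le A0 HYG Y by auto
    qed blast
    define X where "X = ?L s"
    have X: "X \<in> ?T" "X \<in> carrier_mat n n" unfolding X_def using line_tri[OF A0(1) GH(7)] tri_carrier by blast+
    have w: "similar_mat_wit (H * X * G) X H G"
      unfolding similar_mat_wit_def using GH X by (simp add: Let_def)
    have "(H * X * G) ^\<^sub>m n = 0\<^sub>m n n"
      using similar_mat_witD2(3)[OF pow_carrier_mat[OF c[OF X(2)]] similar_mat_wit_pow[OF w, of n]]
        V(2)[OF TV[OF X(1)]] GH by simp
    moreover have "(H * X * G) * J = J * (H * X * G)"
    proof -
      have HX: "H * X \<in> carrier_mat n n" "H * X * J = J * (H * X)"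
        using GH X commute_mult[OF GH(2,6) X(2)] by (auto simp: tri_def)
      show ?thesis using commute_mult[OF HX GH(1,5)] by simp
    qed
    ultimately have "H * X * G \<in> ?V" using c[OF X(2)] by (simp add: nilp_commutator_def commutator_def)
    then have "has_jordan_type (H * X * G) Q'" using F(3) s(2) Y(2) c[OF X(2)] unfolding X_def[symmetric] by blast
    then have XQ': "has_jordan_type X Q'"
      using w similar_mat_sym similar_mat_trans unfolding has_jordan_type_def jordan_nf_def similar_mat_def by metis
    then show ?thesis
      using type[OF TV[OF X(1)] _ XQ'] s(1) Qt unfolding X_def[symmetric]
      by (intro partition_eqI_sum_min) (auto simp: partition_of_def)
  qed
  ultimately have gp: "generic_partition TYPE('a) P = Q"
    unfolding generic_partition_def P by (rule the_equality)
  show "partition_of n (generic_partition TYPE('a) P)" using Qt gp by simp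
  show "\<exists>A\<in>?T. has_jordan_type A (generic_partition TYPE('a) P)" using Q A0(1) gp by blast
  show "(\<Sum>q\<in>#generic_partition TYPE('a) P. min k q) \<le> d" if "A \<in> ?T" "corank_le n (A ^\<^sub>m k) d" for A k d
  proof (cases "k < n")
    case True
    then show ?thesis using Qt nu_le[OF that] gp by simp
  next
    case False
    \<comment> \<open>Both powers are zero, so the certificate for \<open>A\<close> carries over to
      \<open>A0\<close>, whose type is known.\<close>
    have "A ^\<^sub>m k = A0 ^\<^sub>m k" using tri_pow_ge[OF that(1)] tri_pow_ge[OF A0(1)] False by simp
    then have "corank_le n (A0 ^\<^sub>m k) d" using that by simp
    then show ?thesis
      using corank_ge_le has_jordan_type_corank(2)[OF tri_carrier[OF A0(1)] Q] gp by blast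
  qed
qed

end

section \<open>Antichains force large kernels\<close>

text \<open>Let \<open>\<tau> i\<close> be the first position at which no chain element lies below
  \<open>i\<close>. Nonzero entries of \<open>A\<close> never lower \<open>\<tau>\<close>, and on
  leaving a chain element they raise it. Hence every column of the \<open>N\<close>-th power is a
  combination of the vectors obtained by applying \<open>A ^ (N - \<tau> l)\<close> to the basis
  vectors \<open>l\<close> off the chains, and there are only \<open>n - r * N\<close> of
  these.\<close>

lemma antichains_corank_ge:
  fixes A :: "'a::field mat" and x :: "nat \<Rightarrow> nat \<Rightarrow> nat"
  assumes A: "A \<in> carrier_mat n n" and ord: "\<And>i j. i < n \<Longrightarrow> j < n \<Longrightarrow> A $$ (i, j) \<noteq> 0 \<Longrightarrow> R j i"
    and trans: "\<And>i j k. R i j \<Longrightarrow> R j k \<Longrightarrow> R i k"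
    and x: "\<And>c t. c < r \<Longrightarrow> t < N \<Longrightarrow> x c t < n"
    and step: "\<And>c t. c < r \<Longrightarrow> Suc t < N \<Longrightarrow> R (x c t) (x c (Suc t))"
    and anti: "\<And>c c' t. c < r \<Longrightarrow> c' < r \<Longrightarrow> t < N \<Longrightarrow> \<not> R (x c t) (x c' t)"
    and dist: "\<And>c c' t. c < r \<Longrightarrow> c' < r \<Longrightarrow> t < N \<Longrightarrow> x c t = x c' t \<Longrightarrow> c = c'"
  shows "corank_ge n (A ^\<^sub>m N) (r * N)"
proof -
  define X where "X = (\<lambda>(c, t). x c t) ` ({..<r} \<times> {..<N})"
  have chain: "R (x c s) (x c t)" if "c < r" "s < t" "t < N" for c s t
    using that(2,3)
  proof (induction t)
    case (Suc t)
    then show ?case using step[OF that(1), of t] trans by (cases "s = t") auto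
  qed simp
  have ne: "x c s \<noteq> x c' t" if "c < r" "c' < r" "s < t" "t < N" for c c' s t
    using chain[OF that(2-4)] anti[OF that(2,1), of s] that by auto
  have "inj_on (\<lambda>(c, t). x c t) ({..<r} \<times> {..<N})"
  proof (rule inj_onI, clarsimp)
    fix c t c' t' assume a: "c < r" "t < N" "c' < r" "t' < N" "x c t = x c' t'"
    then have "t = t'" using ne[of c c' t t'] ne[of c' c t' t] by (metis linorder_neqE_nat)
    then show "c = c' \<and> t = t'" using dist a by blast
  qed
  then have cardX: "card X = r * N" unfolding X_def by (simp add: card_image card_cartesian_product)
  have Xn: "X \<subseteq> {..<n}" using x by (auto simp: X_def)
  define U where "U t = {i. \<exists>c<r. R (x c t) i}" for t
  define \<tau> where "\<tau> i = (LEAST t. t = N \<or> i \<notin> U t)" for i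
  have \<tau>: "\<tau> i = N \<or> i \<notin> U (\<tau> i)" "\<tau> i \<le> N" for i
    unfolding \<tau>_def by (rule LeastI[of _ N]) (auto intro: Least_le)
  have U_nested: "i \<in> U s" if "i \<in> U t" "s \<le> t" "t < N" for i s t
    using that chain trans unfolding U_def by (cases "s = t") (auto, meson le_neq_implies_less)
  have \<tau>_less: "t < \<tau> i \<longleftrightarrow> i \<in> U t" if "t < N" for t i
  proof
    assume "t < \<tau> i"
    then show "i \<in> U t" using not_less_Least[of t "\<lambda>t. t = N \<or> i \<notin> U t"] unfolding \<tau>_def by auto
  next
    assume "i \<in> U t"
    show "t < \<tau> i"
    proof (rule ccontr)
      assume "\<not> t < \<tau> i"
      then have "i \<in> U (\<tau> i)" using U_nested \<open>i \<in> U t\<close> that by auto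
      then show False using \<tau>(1)[of i] \<open>\<not> t < \<tau> i\<close> that by auto
    qed
  qed
  have \<tau>_mono: "\<tau> i \<le> \<tau> j" if "R i j" for i j
  proof (rule ccontr)
    assume "\<not> \<tau> i \<le> \<tau> j"
    then have j: "\<tau> j < N" "\<tau> j < \<tau> i" using \<tau>(2)[of i] by auto
    then have "i \<in> U (\<tau> j)" using \<tau>_less by blast
    then have "j \<in> U (\<tau> j)" using that trans unfolding U_def by blast
    then show False using \<tau>(1)[of j] j by auto
  qed
  have \<tau>_X: "\<tau> (x c t) = t" if "c < r" "t < N" for c t
  proof (rule antisym)
    show "\<tau> (x c t) \<le> t" using \<tau>_less[OF that(2), of "x c t"] anti that unfolding U_def by fastforce
    show "t \<le> \<tau> (x c t)"
    proof (rule ccontr)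
      assume "\<not> t \<le> \<tau> (x c t)"
      then have l: "\<tau> (x c t) < t" by simp
      then have "x c t \<in> U (\<tau> (x c t))" unfolding U_def using chain that by blast
      then show False using \<tau>(1)[of "x c t"] l that by auto
    qed
  qed
  \<comment> \<open>Column \<open>l\<close> is the power of exponent \<open>N - \<tau> l\<close>
    applied to the basis vector \<open>l\<close>; \<open>Z\<close> will select only columns outside
    \<open>X\<close>.\<close>
  define Y where "Y = mat n n (\<lambda>(i, j). (A ^\<^sub>m (N - \<tau> j)) $$ (i, j))"
  have unit: "\<exists>z. (\<forall>l\<in>X. z l = 0) \<and> (\<forall>i<n. (A ^\<^sub>m (N - \<tau> j)) $$ (i, j) = (\<Sum>l<n. Y $$ (i, l) * z l))"
    if "j < n" "j \<notin> X" for j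
  proof (intro exI[of _ "\<lambda>l. if l = j then 1 else 0"] conjI allI impI)
    fix i assume i: "i < n"
    have "(\<Sum>l<n. Y $$ (i, l) * (if l = j then 1 else 0)) = (\<Sum>l<n. if l = j then Y $$ (i, j) else 0)"
      by (rule sum.cong) auto
    then show "(A ^\<^sub>m (N - \<tau> j)) $$ (i, j) = (\<Sum>l<n. Y $$ (i, l) * (if l = j then 1 else 0))"
      using i that by (simp add: Y_def)
  qed (use that in auto)
  \<comment> \<open>Factors of \<open>A\<close> are peeled off until exactly
    \<open>N - \<tau> j\<close> remain at an index off the chains, where a column of
    \<open>Y\<close> is reached. At a chain element with just that many left, one more factor can be
    peeled off because every successor has larger \<open>\<tau>\<close>.\<close>
  have rep: "\<exists>z. (\<forall>l\<in>X. z l = 0) \<and> (\<forall>i<n. (A ^\<^sub>m k) $$ (i, j) = (\<Sum>l<n. Y $$ (i, l) * z l))"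
    if "j < n" "N \<le> \<tau> j + k" "k \<le> N" for j k
    using that
  proof (induction k arbitrary: j)
    case 0
    then have N: "\<tau> j = N" using \<tau>(2)[of j] by simp
    have "j \<notin> X"
    proof
      assume "j \<in> X"
      then obtain c t where "c < r" "t < N" "j = x c t" by (auto simp: X_def)
      then show False using \<tau>_X[of c t] N by simp
    qed
    then show ?case using unit[OF 0(1)] N by simp
  next
    case (Suc k)
    show ?case
    proof (cases "\<tau> j + Suc k = N \<and> j \<notin> X")
      case True
      then have "N - \<tau> j = Suc k" by linarith
      then show ?thesis using unit[of j] Suc.prems(1) True by simp
    next
      case False
      have "\<exists>z. (\<forall>m\<in>X. z m = 0) \<and> (\<forall>i<n. A $$ (l, j) * (A ^\<^sub>m k) $$ (i, l) = (\<Sum>m<n. Y $$ (i, m) * z m))"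
        if l: "l < n" for l
      proof (cases "A $$ (l, j) = 0")
        case True
        then show ?thesis by (intro exI[of _ "\<lambda>_. 0"]) simp
      next
        case nz: False
        then have jl: "R j l" using ord l Suc.prems by blast
        have "N \<le> \<tau> l + k"
        proof (cases "\<tau> j + Suc k = N")
          case True
          then obtain c t where ct: "c < r" "t < N" "j = x c t" using False by (auto simp: X_def)
          then have t: "\<tau> j = t" using \<tau>_X by simp
          have "l \<in> U t" using jl ct unfolding U_def by blast
          then have "t < \<tau> l" using \<tau>_less ct by blast
          then show ?thesis using t True by simp
        next
          case False
          then show ?thesis using \<tau>_mono[OF jl] Suc.prems by simp
        qed
        then obtain z where z: "\<forall>m\<in>X. z m = 0" "\<forall>i<n. (A ^\<^sub>m k) $$ (i, l) = (\<Sum>m<n. Y $$ (i, m) * z m)"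
          using Suc.IH[of l] l Suc.prems by auto
        then show ?thesis
          by (intro exI[of _ "\<lambda>m. A $$ (l, j) * z m"]) (auto simp: sum_distrib_left ac_simps)
      qed
      then obtain z where z: "\<And>l m. l < n \<Longrightarrow> m \<in> X \<Longrightarrow> z l m = 0"
        "\<And>l i. l < n \<Longrightarrow> i < n \<Longrightarrow> A $$ (l, j) * (A ^\<^sub>m k) $$ (i, l) = (\<Sum>m<n. Y $$ (i, m) * z l m)" by metis
      show ?thesis
      proof (intro exI[of _ "\<lambda>m. \<Sum>l<n. z l m"] conjI allI impI ballI)
        fix m assume "m \<in> X"
        then show "(\<Sum>l<n. z l m) = 0" using z by simp
      next
        fix i assume i: "i < n"
        have "(A ^\<^sub>m Suc k) $$ (i, j) = (\<Sum>l<n. (A ^\<^sub>m k) $$ (i, l) * A $$ (l, j))"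
          using index_mult_mat_sum[OF pow_carrier_mat[OF A] A i Suc.prems(1)] by simp
        also have "\<dots> = (\<Sum>l<n. \<Sum>m<n. Y $$ (i, m) * z l m)"
          by (rule sum.cong) (use z(2) i in \<open>auto simp: mult.commute\<close>)
        also have "\<dots> = (\<Sum>m<n. Y $$ (i, m) * (\<Sum>l<n. z l m))"
          by (subst sum.swap) (simp add: sum_distrib_left)
        finally show "(A ^\<^sub>m Suc k) $$ (i, j) = (\<Sum>m<n. Y $$ (i, m) * (\<Sum>l<n. z l m))" .
      qed
    qed
  qed
  have "\<forall>j. j < n \<longrightarrow> (\<exists>z. (\<forall>l\<in>X. z l = 0) \<and> (\<forall>i<n. (A ^\<^sub>m N) $$ (i, j) = (\<Sum>l<n. Y $$ (i, l) * z l)))"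
    using rep[of _ N] by simp
  then obtain z where z: "\<And>j l. j < n \<Longrightarrow> l \<in> X \<Longrightarrow> z j l = 0"
    "\<And>j i. j < n \<Longrightarrow> i < n \<Longrightarrow> (A ^\<^sub>m N) $$ (i, j) = (\<Sum>l<n. Y $$ (i, l) * z j l)" by metis
  define Z where "Z = mat n n (\<lambda>(l, j). z j l)"
  have YZ: "Y \<in> carrier_mat n n" "Z \<in> carrier_mat n n" by (auto simp: Y_def Z_def)
  have "A ^\<^sub>m N = Y * Z"
  proof (intro eq_matI)
    fix i j assume "i < dim_row (Y * Z)" "j < dim_col (Y * Z)"
    then have ij: "i < n" "j < n" using YZ by auto
    show "(A ^\<^sub>m N) $$ (i, j) = (Y * Z) $$ (i, j)"
      unfolding index_mult_mat_sum[OF YZ ij] z(2)[OF ij(2,1)] by (rule sum.cong) (use ij in \<open>auto simp: Z_def\<close>)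
  qed (use A YZ in auto)
  moreover have "rows_in ({..<n} - X) Z" using z by (auto simp: rows_in_def Z_def)
  moreover have "card ({..<n} - X) + r * N = n"
    using cardX Xn card_mono[OF _ Xn] by (simp add: card_Diff_subset finite_subset)
  ultimately show ?thesis unfolding corank_ge_def
    using YZ by (intro exI[of _ Y] exI[of _ Z] exI[of _ "{..<n} - X"]) auto
qed

text \<open>Counts the times spent on a row. The starting point is real because the periods of the
  schedule are.\<close>

lemma card_nat_interval_le:
  fixes x :: real
  assumes "finite S" "\<And>t. t \<in> S \<Longrightarrow> x \<le> real t \<and> real t < x + real a"
  shows "card S \<le> a"
proof -
  have "S \<subseteq> {nat \<lceil>x\<rceil>..<nat \<lceil>x\<rceil> + a}"
  proof
    fix t assume "t \<in> S"
    then have "x \<le> real t" "real t < x + real a" using assms(2) by auto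
    then have "\<lceil>x\<rceil> \<le> int t" "int t < \<lceil>x\<rceil> + int a" by linarith+
    then have "nat \<lceil>x\<rceil> \<le> t" "t < nat \<lceil>x\<rceil> + a" by linarith+
    then show "t \<in> {nat \<lceil>x\<rceil>..<nat \<lceil>x\<rceil> + a}" by simp
  qed
  from card_mono[OF _ this] show ?thesis by simp
qed

context pos_block_coords
begin

text \<open>A row consists of the elements of given height and coheight, one for each copy of the
  part \<open>f c t + g c t\<close>. Elements of different chains with both numbers strictly larger
  are incomparable, so the schedule needs only rows; \<open>cap\<close> guarantees a fresh copy at
  each visit.\<close>

lemma row_antichains_corank_ge:
  fixes A :: "'a::field mat" and f g :: "nat \<Rightarrow> nat \<Rightarrow> nat"
  assumes A: "A \<in> tri"
    and mono: "\<And>c t. c < r \<Longrightarrow> Suc t < N \<Longrightarrow> f c t \<le> f c (Suc t) \<and> g c (Suc t) \<le> g c t"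
    and anti: "\<And>c c' t. c < c' \<Longrightarrow> c' < r \<Longrightarrow> t < N \<Longrightarrow> f c t < f c' t \<and> g c t < g c' t"
    and pos: "\<And>c t. c < r \<Longrightarrow> t < N \<Longrightarrow> 0 < g c t"
    and cap: "\<And>c t. c < r \<Longrightarrow> t < N \<Longrightarrow>
      card {s. s < N \<and> f c s = f c t \<and> g c s = g c t} \<le> length (cls (f c t + g c t))"
  shows "corank_ge n (A ^\<^sub>m N) (r * N)"
proof -
  define idx where "idx c t = card {s. s < t \<and> f c s = f c t \<and> g c s = g c t}" for c t
  define p where "p c t = f c t + g c t" for c t
  \<comment> \<open>Within a row, \<open>prec\<close> lowers the block number, so the copies are
    used from the last to the first.\<close>
  define x where "x c t = ix (cls (p c t) ! (length (cls (p c t)) - 1 - idx c t)) (f c t)" for c t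
  have idx: "idx c t < length (cls (p c t))" if "c < r" "t < N" for c t
  proof -
    let ?S = "{s. s < N \<and> f c s = f c t \<and> g c s = g c t}"
    have "{s. s < t \<and> f c s = f c t \<and> g c s = g c t} \<subset> ?S" using that by auto
    then have "idx c t < card ?S" unfolding idx_def by (intro psubset_card_mono) auto
    then show ?thesis using cap[OF that] by (simp add: p_def)
  qed
  have b: "cls (p c t) ! (length (cls (p c t)) - 1 - idx c t) < m"
    "sz (cls (p c t) ! (length (cls (p c t)) - 1 - idx c t)) = p c t" if "c < r" "t < N" for c t
    using cls_nth[of "length (cls (p c t)) - 1 - idx c t" "p c t"] idx[OF that] by auto
  have x: "x c t < n" "ht (x c t) = f c t" "cht (x c t) = g c t"
    "blk (x c t) = cls (p c t) ! (length (cls (p c t)) - 1 - idx c t)" if "c < r" "t < N" for c t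
    using ix[OF b(1)[OF that], of "f c t"] b(2)[OF that] pos[OF that] by (auto simp: x_def p_def cht_def)
  show ?thesis
  proof (rule antichains_corank_ge[where R = prec and x = x])
    show "A \<in> carrier_mat n n" "\<And>i j. i < n \<Longrightarrow> j < n \<Longrightarrow> A $$ (i, j) \<noteq> 0 \<Longrightarrow> prec j i"
      using A by (auto simp: tri_def)
    show "\<And>i j k. prec i j \<Longrightarrow> prec j k \<Longrightarrow> prec i k" by (rule prec_trans)
    show "\<And>c t. c < r \<Longrightarrow> t < N \<Longrightarrow> x c t < n" using x by blast
    show "prec (x c t) (x c (Suc t))" if c: "c < r" "Suc t < N" for c t
    proof -
      have t: "t < N" using c by simp
      have "blk (x c (Suc t)) < blk (x c t)" if e: "f c t = f c (Suc t)" "g c t = g c (Suc t)"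
      proof -
        have "{s. s < Suc t \<and> f c s = f c (Suc t) \<and> g c s = g c (Suc t)} =
          insert t {s. s < t \<and> f c s = f c t \<and> g c s = g c t}" using e by auto
        then have "idx c (Suc t) = Suc (idx c t)" by (simp add: idx_def)
        moreover have "p c (Suc t) = p c t" using e by (simp add: p_def)
        ultimately show ?thesis
          using x(4)[OF c] x(4)[OF c(1) t] idx[OF c] idx[OF c(1) t] by (auto intro!: cls_mono)
      qed
      then show ?thesis using mono[OF c] x[OF c] x[OF c(1) t] by (simp add: prec_def)
    qed
    show "\<not> prec (x c t) (x c' t)" if "c < r" "c' < r" "t < N" for c c' t
      using anti[of c c' t] anti[of c' c t] x(2,3)[of c t] x(2,3)[of c' t] that
      by (cases c c' rule: linorder_cases) (auto simp: prec_def)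
    show "c = c'" if "c < r" "c' < r" "t < N" "x c t = x c' t" for c c' t
      using anti[of c c' t] anti[of c' c t] x(2)[of c t] x(2)[of c' t] that
      by (cases c c' rule: linorder_cases) auto
  qed
qed

text \<open>
  The rows of the two parts \<open>l c + 2 * c\<close>, \<open>l c + 2 * c + 1\<close> are traversed in \<open>N\<close> steps, alternating between rows of the
  larger part, on each of which \<open>B c\<close> steps are spent, and rows of the smaller one. A full period takes
  \<open>(N - B c) / l c\<close> steps, and it is the monotonicity of this number in \<open>c\<close> that makes the positions
  reached at the same time pairwise incomparable.
\<close>

lemma paired_rows_corank_ge:
  fixes A :: "'a::field mat" and l :: "nat \<Rightarrow> nat" and B :: "nat \<Rightarrow> real"
  assumes A: "A \<in> tri" and N: "0 < N" and l: "\<And>c. c < r \<Longrightarrow> 0 < l c"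
    and B0: "\<And>c. c < r \<Longrightarrow> 0 \<le> B c" and BN: "\<And>c. c < r \<Longrightarrow> (real (l c) + 1) * B c \<le> real N"
    and Bb: "\<And>c. c < r \<Longrightarrow> B c \<le> real (length (cls (l c + 2 * c + 1)))"
    and Ba: "\<And>c. c < r \<Longrightarrow> real N - (real (l c) + 1) * B c \<le> real (l c) * real (length (cls (l c + 2 * c)))"
    and mono: "\<And>c. Suc c < r \<Longrightarrow> l c < l (Suc c) \<or> l c = l (Suc c) \<and> B c \<le> B (Suc c)"
  shows "corank_ge n (A ^\<^sub>m N) (r * N)"
proof -
  define \<kappa> where "\<kappa> c = (real N - B c) / real (l c)" for c
  have B_le: "B c < real N" if "c < r" for c
  proof -
    have "2 * B c \<le> (real (l c) + 1) * B c"
      using l[OF that] B0[OF that] by (intro mult_right_mono) auto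
    then show ?thesis using BN[OF that] N B0[OF that] by linarith
  qed
  have \<kappa>0: "0 < \<kappa> c" if "c < r" for c using B_le[OF that] l[OF that] by (simp add: \<kappa>_def)
  have N_eq: "real N = real (l c) * \<kappa> c + B c" if "c < r" for c using l[OF that] by (simp add: \<kappa>_def)
  \<comment> \<open>Equivalent to \<open>B c \<le> \<kappa> c\<close>: the stay on a row of the
    larger part fits into one period.\<close>
  have \<kappa>_ge: "real N \<le> (real (l c) + 1) * \<kappa> c" if "c < r" for c
  proof -
    have "real (l c) * ((real (l c) + 1) * \<kappa> c) = (real (l c) + 1) * (real N - B c)"
      using l[OF that] by (simp add: \<kappa>_def)
    also have "\<dots> \<ge> real (l c) * real N" using BN[OF that] by (simp add: algebra_simps)
    finally show ?thesis using l[OF that] by simp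
  qed
  \<comment> \<open>If \<open>l\<close> grows, the period shrinks whatever the values of
    \<open>B\<close> are: \<open>\<kappa> (Suc c)\<close> is at most \<open>N / l (Suc c)\<close>,
    which is at most \<open>N / (l c + 1)\<close> and thus at most \<open>\<kappa> c\<close>. Only
    for equal \<open>l\<close> does the order of \<open>B\<close> matter.\<close>
  have \<kappa>_Suc: "\<kappa> (Suc c) \<le> \<kappa> c" if "Suc c < r" for c
  proof (cases "l c = l (Suc c)")
    case True
    then show ?thesis using mono[OF that] by (auto simp: \<kappa>_def intro!: divide_right_mono)
  next
    case False
    then have lt: "real (l c) + 1 \<le> real (l (Suc c))" using mono[OF that] by linarith
    have "real (l (Suc c)) * \<kappa> (Suc c) \<le> real N" using N_eq[OF that] B0[OF that] by linarith
    also have "\<dots> \<le> (real (l c) + 1) * \<kappa> c" using \<kappa>_ge[of c] that by simp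
    also have "\<dots> \<le> real (l (Suc c)) * \<kappa> c" using lt \<kappa>0[of c] that by (intro mult_right_mono) auto
    finally show ?thesis using l[OF that] by simp
  qed
  have \<kappa>_mono: "\<kappa> c' \<le> \<kappa> c" if "c \<le> c'" "c' < r" for c c'
    using that
  proof (induction c' rule: dec_induct)
    case (step k)
    then show ?case using \<kappa>_Suc[of k] by simp
  qed simp
  have l_mono: "l c \<le> l c'" if "c \<le> c'" "c' < r" for c c'
    using that
  proof (induction c' rule: dec_induct)
    case (step k)
    then show ?case using mono[of k] by auto
  qed simp
  \<comment> \<open>\<open>F c t\<close> counts the complete periods up to time \<open>t\<close>,
    and \<open>G c t\<close> those that fit strictly into the remaining time. Weak against strict
    inequality makes the stay on each row a half-open interval.\<close>
  define F where "F c t = min (l c) (nat \<lfloor>real t / \<kappa> c\<rfloor>)" for c t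
  define G where "G c t = min (l c) (nat (\<lceil>(real N - real t) / \<kappa> c\<rceil> - 1))" for c t
  have F: "h \<le> F c t \<longleftrightarrow> h \<le> l c \<and> real h * \<kappa> c \<le> real t" if "c < r" for c t h
  proof -
    have "h \<le> nat \<lfloor>real t / \<kappa> c\<rfloor> \<longleftrightarrow> int h \<le> \<lfloor>real t / \<kappa> c\<rfloor>"
      using \<kappa>0[OF that] by (subst le_nat_iff) (auto simp: zero_le_floor)
    also have "\<dots> \<longleftrightarrow> real h * \<kappa> c \<le> real t" using \<kappa>0[OF that] by (simp add: le_floor_iff pos_le_divide_eq)
    finally show ?thesis by (auto simp: F_def)
  qed
  have G: "h \<le> G c t \<longleftrightarrow> h \<le> l c \<and> real h * \<kappa> c < real N - real t" if "c < r" "t < N" for c t h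
  proof -
    have pos: "0 < (real N - real t) / \<kappa> c" using \<kappa>0[OF that(1)] that(2) by simp
    then have "0 \<le> \<lceil>(real N - real t) / \<kappa> c\<rceil> - 1" by linarith
    then have "h \<le> nat (\<lceil>(real N - real t) / \<kappa> c\<rceil> - 1) \<longleftrightarrow> int h \<le> \<lceil>(real N - real t) / \<kappa> c\<rceil> - 1"
      by (subst le_nat_iff) auto
    also have "\<dots> \<longleftrightarrow> int h < \<lceil>(real N - real t) / \<kappa> c\<rceil>" by auto
    also have "\<dots> \<longleftrightarrow> real h * \<kappa> c < real N - real t"
      using \<kappa>0[OF that(1)] by (simp add: less_ceiling_iff pos_less_divide_eq)
    finally show ?thesis by (auto simp: G_def)
  qed
  have FG_le: "F c t + G c t \<le> l c" if "c < r" "t < N" for c t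
  proof -
    have "real (F c t + G c t) * \<kappa> c < real N"
      using F[OF that(1), of "F c t" t] G[OF that, of "G c t"] by (simp add: algebra_simps)
    also have "\<dots> \<le> (real (l c) + 1) * \<kappa> c" by (rule \<kappa>_ge[OF that(1)])
    finally have "real (F c t + G c t) < real (l c) + 1" using \<kappa>0[OF that(1)] by simp
    then show ?thesis by linarith
  qed
  have F_lt: "real t < (real (F c t) + 1) * \<kappa> c" if "c < r" "t < N" "F c t < l c" for c t
    using F[OF that(1), of "Suc (F c t)" t] that by (auto simp: algebra_simps not_le)
  have G_lt: "real N - real t \<le> (real (G c t) + 1) * \<kappa> c" if "c < r" "t < N" "G c t < l c" for c t
    using G[OF that(1,2), of "Suc (G c t)"] that by (auto simp: algebra_simps not_less)
  have FG_ge: "l c \<le> F c t + G c t + 1" if "c < r" "t < N" for c t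
  proof (cases "F c t < l c \<and> G c t < l c")
    case True
    have "real (l c) * \<kappa> c \<le> real N" using N_eq[OF that(1)] B0[OF that(1)] by simp
    also have "\<dots> < (real (F c t) + 1) * \<kappa> c + (real (G c t) + 1) * \<kappa> c"
      using F_lt[OF that] G_lt[OF that] True by simp
    also have "\<dots> = (real (F c t) + real (G c t) + 2) * \<kappa> c" by (simp add: algebra_simps)
    finally have "real (l c) < real (F c t) + real (G c t) + 2" using \<kappa>0[OF that(1)] by simp
    then show ?thesis by linarith
  next
    case False
    then show ?thesis by auto
  qed
  show ?thesis
  \<comment> \<open>The offsets \<open>c\<close> and \<open>c + 1\<close> make chain
    \<open>c\<close> skip the \<open>c\<close> lowest and the \<open>c\<close> highest rows of its
    two parts.\<close>
  proof (rule row_antichains_corank_ge[OF A, where f = "\<lambda>c t. c + F c t" and g = "\<lambda>c t. c + 1 + G c t"])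
    fix c t assume c: "c < r" "Suc t < N"
    have "F c t \<le> F c (Suc t)" using F[OF c(1), of "F c t" t] F[OF c(1), of "F c t" "Suc t"] by auto
    moreover have "G c (Suc t) \<le> G c t"
      using G[of c "Suc t" "G c (Suc t)"] G[of c t "G c (Suc t)"] c by auto
    ultimately show "c + F c t \<le> c + F c (Suc t) \<and> c + 1 + G c (Suc t) \<le> c + 1 + G c t" by simp
  next
    fix c c' t assume c: "c < c'" "c' < r" "t < N"
    have mult: "real h * \<kappa> c' \<le> real h * \<kappa> c" for h
      using \<kappa>_mono[of c c'] c by (intro mult_left_mono) auto
    have "F c t \<le> F c' t"
      using F[of c "F c t" t] F[of c' "F c t" t] l_mono[of c c'] mult[of "F c t"] c by auto
    moreover have "G c t \<le> G c' t"
      using G[of c t "G c t"] G[of c' t "G c t"] l_mono[of c c'] mult[of "G c t"] c by auto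
    ultimately show "c + F c t < c' + F c' t \<and> c + 1 + G c t < c' + 1 + G c' t" using c by simp
  next
    fix c t assume c: "c < r" "t < N"
    show "0 < c + 1 + G c t" by simp
    let ?S = "{s. s < N \<and> c + F c s = c + F c t \<and> c + 1 + G c s = c + 1 + G c t}"
    \<comment> \<open>The first case is a row of the larger part, occupied for time
      \<open>B c\<close>; the second is a row of the smaller part, occupied for time
      \<open>\<kappa> c - B c\<close>.\<close>
    consider "F c t + G c t = l c" | "F c t + G c t + 1 = l c" using FG_le[OF c] FG_ge[OF c] by linarith
    then show "card ?S \<le> length (cls (c + F c t + (c + 1 + G c t)))"
    proof cases
      case 1
      have "card ?S \<le> length (cls (l c + 2 * c + 1))"
      proof (rule card_nat_interval_le[where x = "real (F c t) * \<kappa> c"])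
        fix s assume "s \<in> ?S"
        then have s: "s < N" "F c s = F c t" "G c s = G c t" by auto
        have "real (F c t) * \<kappa> c \<le> real s" using F[OF c(1), of "F c s" s] s by simp
        moreover have "real (G c t) * \<kappa> c < real N - real s" using G[OF c(1) s(1), of "G c s"] s by simp
        moreover have "real (F c t) * \<kappa> c + real (G c t) * \<kappa> c = real (l c) * \<kappa> c"
          unfolding 1[symmetric] by (simp add: algebra_simps)
        ultimately show "real (F c t) * \<kappa> c \<le> real s \<and>
          real s < real (F c t) * \<kappa> c + real (length (cls (l c + 2 * c + 1)))"
          using N_eq[OF c(1)] Bb[OF c(1)] by linarith
      qed simp
      moreover have e: "c + F c t + (c + 1 + G c t) = l c + 2 * c + 1" using 1 by simp
      ultimately show ?thesis unfolding e by simp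
    next
      case 2
      have "card ?S \<le> length (cls (l c + 2 * c))"
      proof (rule card_nat_interval_le[where x = "real (F c t) * \<kappa> c + B c"])
        fix s assume "s \<in> ?S"
        then have s: "s < N" "F c s = F c t" "G c s = G c t" by auto
        have lt: "F c s < l c" "G c s < l c" using s 2 by auto
        have 1: "real s < (real (F c t) + 1) * \<kappa> c" using F_lt[OF c(1) s(1)] lt s by simp
        have "real N - real s \<le> (real (G c t) + 1) * \<kappa> c" using G_lt[OF c(1) s(1)] lt s by simp
        moreover have "real (F c t) * \<kappa> c + (real (G c t) + 1) * \<kappa> c = real (l c) * \<kappa> c"
          unfolding 2[symmetric] by (simp add: algebra_simps)
        moreover have "\<kappa> c - B c \<le> real (length (cls (l c + 2 * c)))"
        proof -
          have "real (l c) * (\<kappa> c - B c) = real N - (real (l c) + 1) * B c"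
            using N_eq[OF c(1)] by (simp add: algebra_simps)
          also have "\<dots> \<le> real (l c) * real (length (cls (l c + 2 * c)))" by (rule Ba[OF c(1)])
          finally show ?thesis using l[OF c(1)] by simp
        qed
        ultimately show "real (F c t) * \<kappa> c + B c \<le> real s \<and>
          real s < real (F c t) * \<kappa> c + B c + real (length (cls (l c + 2 * c)))"
          using N_eq[OF c(1)] 1 by (simp add: algebra_simps)
      qed simp
      moreover have e: "c + F c t + (c + 1 + G c t) = l c + 2 * c" using 2 by simp
      ultimately show ?thesis unfolding e by simp
    qed
  qed
qed

end

section \<open>Degenerations\<close>

text \<open>On \<open>good\<close> the matrix is an injective map of vertices into \<open>C\<close>,
  and at most \<open>S\<close> vertices of \<open>C\<close> are not good. So each further factor
  spoils at most \<open>S\<close> of the unit columns.\<close>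

lemma zero_graph_pow:
  fixes F :: "'a::field mat" and \<nu> :: "nat \<Rightarrow> nat"
  assumes F: "F \<in> carrier_mat n n" and C: "C \<subseteq> {..<n}" and good: "good \<subseteq> C"
    and \<nu>: "\<nu> ` good \<subseteq> C" "inj_on \<nu> good"
    and col: "\<And>x i. x \<in> good \<Longrightarrow> i < n \<Longrightarrow> F $$ (i, x) = (if i = \<nu> x then 1 else 0)"
    and S: "card C \<le> card good + S"
  shows "\<exists>X p. X \<subseteq> {..<n} \<and> p ` X \<subseteq> C \<and> inj_on p X \<and> card C \<le> card X + k * S \<and>
    (\<forall>x\<in>X. \<forall>i<n. (F ^\<^sub>m k) $$ (i, x) = (if i = p x then 1 else 0))"
proof (induction k)
  case 0
  have "\<forall>x\<in>C. \<forall>i<n. (F ^\<^sub>m 0) $$ (i, x) = (if i = x then 1 else 0)" using F C by auto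
  then show ?case using C by (intro exI[of _ C] exI[of _ "\<lambda>x. x"]) auto
next
  case (Suc k)
  then obtain X p where X: "X \<subseteq> {..<n}" "p ` X \<subseteq> C" "inj_on p X" "card C \<le> card X + k * S"
    "\<And>x i. x \<in> X \<Longrightarrow> i < n \<Longrightarrow> (F ^\<^sub>m k) $$ (i, x) = (if i = p x then 1 else 0)" by blast
  have fin: "finite C" "finite X" using C X(1) finite_subset by blast+
  let ?X = "{x \<in> X. p x \<in> good}"
  have "card {x \<in> X. p x \<notin> good} = card (p ` {x \<in> X. p x \<notin> good})"
    using X(3) by (intro card_image[symmetric]) (auto simp: inj_on_def)
  also have "\<dots> \<le> card (C - good)" using X(2) fin by (intro card_mono) auto
  also have "\<dots> \<le> S" using S good fin by (simp add: card_Diff_subset finite_subset)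
  finally have c1: "card {x \<in> X. p x \<notin> good} \<le> S" .
  have "card (?X \<union> {x \<in> X. p x \<notin> good}) = card ?X + card {x \<in> X. p x \<notin> good}"
    using fin by (intro card_Un_disjoint) auto
  moreover have "?X \<union> {x \<in> X. p x \<notin> good} = X" by auto
  ultimately have card: "card C \<le> card ?X + Suc k * S" using X(4) c1 by simp
  have cols: "(F ^\<^sub>m Suc k) $$ (i, x) = (if i = \<nu> (p x) then 1 else 0)" if x: "x \<in> ?X" and i: "i < n" for x i
  proof -
    have xn: "x < n" "p x < n" using x X C by auto
    have "F ^\<^sub>m k * F = F * F ^\<^sub>m k"
    proof (induction k)
      case (Suc k)
      have "F ^\<^sub>m Suc k * F = F * F ^\<^sub>m k * F" using Suc by simp
      also have "\<dots> = F * F ^\<^sub>m Suc k"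
        using F by (simp add: assoc_mult_mat[OF F pow_carrier_mat[OF F] F])
      finally show ?case .
    qed (use F in simp)
    then have "F ^\<^sub>m Suc k = F * F ^\<^sub>m k" by simp
    then have "(F ^\<^sub>m Suc k) $$ (i, x) = (\<Sum>l<n. F $$ (i, l) * (F ^\<^sub>m k) $$ (l, x))"
      using index_mult_mat_sum[OF F pow_carrier_mat[OF F] i xn(1)] by simp
    also have "\<dots> = (\<Sum>l<n. if l = p x then F $$ (i, p x) else 0)"
      by (rule sum.cong) (use x X(5) in auto)
    also have "\<dots> = (if i = \<nu> (p x) then 1 else 0)" using xn col[of "p x" i] x i by simp
    finally show ?thesis .
  qed
  have "inj_on (\<lambda>x. \<nu> (p x)) ?X"
    using X(3) \<nu>(2) by (auto simp: inj_on_def)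
  then show ?case
    using card cols X(1) \<nu>(1) by (intro exI[of _ ?X] exI[of _ "\<lambda>x. \<nu> (p x)"]) auto
qed

context pos_block_coords
begin

text \<open>
  A matrix in \<open>tri\<close> whose entries are powers of a parameter \<open>s\<close>, conjugated by the diagonal matrix
  with entries \<open>s\<close> to the potential \<open>om\<close>, has a limit for \<open>s = 0\<close> that keeps only the edges of exponent 0.
\<close>

lemma degeneration_corank_le:
  fixes E :: "nat \<Rightarrow> nat \<Rightarrow> bool" and cc :: "nat \<Rightarrow> nat \<Rightarrow> nat" and wt :: "nat \<Rightarrow> nat \<Rightarrow> int"
    and om :: "nat \<Rightarrow> int"
  defines "edge \<equiv> \<lambda>x y. E (blk x) (blk y) \<and> ht y = ht x + cc (blk x) (blk y)"
    and "ex \<equiv> \<lambda>x y. wt (blk x) (blk y) + om y - om x"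
  assumes inf: "infinite (UNIV :: 'a::field set)"
    and hom: "\<And>b b'. b < m \<Longrightarrow> b' < m \<Longrightarrow> E b b' \<Longrightarrow> sz b' \<le> sz b + cc b b'"
    and low: "\<And>b b'. b < m \<Longrightarrow> b' < m \<Longrightarrow> E b b' \<Longrightarrow> cc b b' = 0 \<Longrightarrow> sz b = sz b' \<Longrightarrow> b' < b"
    and nonneg: "\<And>x y. x < n \<Longrightarrow> y < n \<Longrightarrow> edge x y \<Longrightarrow> 0 \<le> ex x y"
    and C: "C \<subseteq> {..<n}" and good: "good \<subseteq> C" and S: "card C \<le> card good + S"
    and out: "\<And>x. x \<in> good \<Longrightarrow> \<exists>w\<in>C. \<forall>y<n. edge x y \<and> ex x y = 0 \<longleftrightarrow> y = w"
    and inj: "\<And>x x' w. x \<in> good \<Longrightarrow> x' \<in> good \<Longrightarrow> w < n \<Longrightarrow> edge x w \<Longrightarrow> ex x w = 0 \<Longrightarrow>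
       edge x' w \<Longrightarrow> ex x' w = 0 \<Longrightarrow> x = x'"
  shows "\<exists>A\<in>(tri :: 'a mat set). corank_le n (A ^\<^sub>m k) (n - card C + k * S)"
proof -
  \<comment> \<open>At \<open>s = 0\<close> the convention \<open>0 ^ 0 = 1\<close> leaves exactly
    the edges of exponent 0, with coefficient 1. For \<open>s \<noteq> 0\<close> this is a diagonal
    conjugate of \<open>A s\<close>, and the coefficients of \<open>A s\<close> depend only on the
    blocks, which is what commuting with \<open>J\<close> requires.\<close>
  define M where "M s = mat n n (\<lambda>(i, j). if edge j i then s ^ nat (ex j i) else 0 :: 'a)" for s
  define A where "A s = mat n n (\<lambda>(i, j). if edge j i then s powi wt (blk j) (blk i) else 0 :: 'a)" for s
  have Mc: "M s \<in> carrier_mat n n" and Ac: "A s \<in> carrier_mat n n" for s by (auto simp: M_def A_def)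
  obtain \<nu> where \<nu>: "\<And>x. x \<in> good \<Longrightarrow> \<nu> x \<in> C"
    "\<And>x y. x \<in> good \<Longrightarrow> y < n \<Longrightarrow> edge x y \<and> ex x y = 0 \<longleftrightarrow> y = \<nu> x" using out by metis
  have col: "M 0 $$ (i, x) = (if i = \<nu> x then 1 else 0)" if "x \<in> good" "i < n" for x i
  proof -
    have x: "x < n" using that good C by auto
    then have "M 0 $$ (i, x) = (if edge x i \<and> ex x i = 0 then 1 else 0)"
      using that nonneg[OF x that(2)] by (auto simp: M_def)
    then show ?thesis using \<nu>(2)[OF that] by simp
  qed
  have "inj_on \<nu> good"
  proof (rule inj_onI)
    fix x y assume a: "x \<in> good" "y \<in> good" "\<nu> x = \<nu> y"
    have w: "\<nu> x < n" using \<nu>(1)[OF a(1)] C by auto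
    show "x = y" using inj[OF a(1,2) w] \<nu>(2)[OF a(1) w] \<nu>(2)[OF a(2) w] a(3) by simp
  qed
  then obtain X p where X: "X \<subseteq> {..<n}" "p ` X \<subseteq> C" "inj_on p X" "card C \<le> card X + k * S"
    "\<And>x i. x \<in> X \<Longrightarrow> i < n \<Longrightarrow> (M 0 ^\<^sub>m k) $$ (i, x) = (if i = p x then 1 else 0)"
    using zero_graph_pow[OF Mc C good _ _ col S, of k] \<nu>(1) by blast
  have "corank_le n (M 0 ^\<^sub>m k) (n - card C + k * S)"
  proof (rule corank_le_unit_columns[OF pow_carrier_mat[OF Mc] X(1) _ X(3)])
    show "p ` X \<subseteq> {..<n}" using X(2) C by blast
    show "n \<le> n - card C + k * S + card X" using X(4) by linarith
  qed (rule X(5))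
  then obtain g where g: "regular n g" "g (M 0) \<noteq> 0"
    "\<And>X. X \<in> carrier_mat n n \<Longrightarrow> g X \<noteq> 0 \<Longrightarrow> corank_le n (X ^\<^sub>m k) (n - card C + k * S)"
    using corank_le_open[OF Mc] by blast
  have path: "poly_path n M"
    unfolding poly_path_def
  proof (intro conjI allI impI)
    fix i j assume "i < n" "j < n"
    then show "ispoly (\<lambda>s. M s $$ (i, j))"
      by (cases "edge j i") (simp_all add: M_def ispoly_power ispoly_const)
  qed (rule Mc)
  \<comment> \<open>The bound found at \<open>M 0\<close> is carried to a nonzero parameter, where
    the conjugation is available.\<close>
  obtain s where s: "g (M s) \<noteq> 0" "s \<noteq> 0"
    by (rule common_nonroot[OF inf regular_path[OF g(1) path] ispoly_id, of 0 1]) (use g in auto)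
  define D D' where "D = mat n n (\<lambda>(i, j). if i = j then s powi om i else 0)"
    and "D' = mat n n (\<lambda>(i, j). if i = j then s powi (- om i) else 0)"
  have Dc: "D \<in> carrier_mat n n" "D' \<in> carrier_mat n n" by (auto simp: D_def D'_def)
  have diag: "(mat n n (\<lambda>(i, j). if i = j then d i else 0) * F) $$ (i, j) = d i * F $$ (i, j)"
    if "F \<in> carrier_mat n n" "i < n" "j < n" for F :: "'a mat" and d i j
  proof -
    have "(mat n n (\<lambda>(i, j). if i = j then d i else 0) * F) $$ (i, j) = (\<Sum>l<n. if l = i then d i * F $$ (i, j) else 0)"
      unfolding index_mult_mat_sum[OF mat_carrier that] by (rule sum.cong) (use that in auto)
    then show ?thesis using that by simp
  qed
  have diag': "(F * mat n n (\<lambda>(i, j). if i = j then d i else 0)) $$ (i, j) = F $$ (i, j) * d j"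
    if "F \<in> carrier_mat n n" "i < n" "j < n" for F :: "'a mat" and d i j
  proof -
    have "(F * mat n n (\<lambda>(i, j). if i = j then d i else 0)) $$ (i, j) = (\<Sum>l<n. if l = j then F $$ (i, j) * d j else 0)"
      unfolding index_mult_mat_sum[OF that(1) mat_carrier that(2,3)] by (rule sum.cong) (use that in auto)
    then show ?thesis using that by simp
  qed
  have "M s = D * A s * D'"
  proof (intro eq_matI)
    fix i j assume "i < dim_row (D * A s * D')" "j < dim_col (D * A s * D')"
    then have ij: "i < n" "j < n" using Dc by auto
    have "(D * A s * D') $$ (i, j) = s powi om i * A s $$ (i, j) * s powi (- om j)"
      unfolding D'_def diag'[OF mult_carrier_mat[OF Dc(1) Ac] ij] unfolding D_def diag[OF Ac ij] by simp
    also have "\<dots> = M s $$ (i, j)"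
    proof (cases "edge j i")
      case True
      have "s powi om i * s powi wt (blk j) (blk i) * s powi (- om j) = s powi (om i + wt (blk j) (blk i) + - om j)"
        using power_int_add[of s "om i + wt (blk j) (blk i)" "- om j"]
          power_int_add[of s "om i" "wt (blk j) (blk i)"] s(2) by metis
      also have "om i + wt (blk j) (blk i) + - om j = int (nat (ex j i))"
        using nonneg[OF ij(2,1) True] by (simp add: ex_def)
      also have "s powi int (nat (ex j i)) = s ^ nat (ex j i)" by (rule power_int_of_nat)
      finally show ?thesis using True ij by (simp add: M_def A_def)
    qed (use ij in \<open>simp add: M_def A_def\<close>)
    finally show "M s $$ (i, j) = (D * A s * D') $$ (i, j)" by simp
  qed (use Dc in \<open>auto simp: M_def\<close>)
  moreover have inv: "D * D' = 1\<^sub>m n" "D' * D = 1\<^sub>m n"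
  proof -
    show "D * D' = 1\<^sub>m n"
    proof (intro eq_matI)
      fix i j assume "i < dim_row (1\<^sub>m n :: 'a mat)" "j < dim_col (1\<^sub>m n :: 'a mat)"
      then have ij: "i < n" "j < n" by auto
      show "(D * D') $$ (i, j) = 1\<^sub>m n $$ (i, j)"
        unfolding D_def diag[OF Dc(2) ij] using ij s
        by (auto simp: D'_def power_int_add[symmetric])
    qed (use Dc in auto)
    then show "D' * D = 1\<^sub>m n" using mat_mult_left_right_inverse[OF Dc] by blast
  qed
  ultimately have w: "similar_mat_wit (M s) (A s) D D'"
    unfolding similar_mat_wit_def using Dc Mc[of s] Ac by (auto simp: Let_def)
  have "corank_le n (M s ^\<^sub>m k) (n - card C + k * S)" using g(3)[OF Mc s(1)] .
  moreover have "similar_mat (M s ^\<^sub>m k) (A s ^\<^sub>m k)"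
    using similar_mat_wit_pow[OF w, of k] unfolding similar_mat_def by blast
  ultimately have cor: "corank_le n (A s ^\<^sub>m k) (n - card C + k * S)"
    using corank_le_similar[OF pow_carrier_mat[OF Mc]] by blast
  have "A s * J = J * A s"
  proof (intro eq_matI)
    fix i j assume "i < dim_row (J * A s)" "j < dim_col (J * A s)"
    then have ij: "i < n" "j < n" by (auto simp: A_def shift_mat_def)
    note bl = blk_less[OF ij(1)] blk_less[OF ij(2)] ht_less[OF ij(1)] ht_less[OF ij(2)]
    have l: "(if Suc (ht j) < sz (blk j) then A s $$ (i, ix (blk j) (Suc (ht j))) else 0) =
      (if Suc (ht j) < sz (blk j) \<and> E (blk j) (blk i) \<and> ht i = Suc (ht j) + cc (blk j) (blk i)
       then s powi wt (blk j) (blk i) else 0)"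
      using ix[OF bl(2), of "Suc (ht j)"] ij by (auto simp: A_def edge_def)
    have r: "(if 0 < ht i then A s $$ (ix (blk i) (ht i - 1), j) else 0) =
      (if 0 < ht i \<and> E (blk j) (blk i) \<and> ht i - 1 = ht j + cc (blk j) (blk i)
       then s powi wt (blk j) (blk i) else 0)"
      using ix[OF bl(1), of "ht i - 1"] ij bl by (auto simp: A_def edge_def)
    \<comment> \<open>By \<open>hom\<close> the rows of the target run out no later than those of
      the source, so the block map is well defined on \<open>k[t]/(t ^ sz b)\<close>.\<close>
    have "Suc (ht j) < sz (blk j)" if "E (blk j) (blk i)" "ht i = Suc (ht j) + cc (blk j) (blk i)"
      using hom[OF bl(2,1) that(1)] that(2) bl by linarith
    then have "(Suc (ht j) < sz (blk j) \<and> E (blk j) (blk i) \<and> ht i = Suc (ht j) + cc (blk j) (blk i)) \<longleftrightarrow>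
      (0 < ht i \<and> E (blk j) (blk i) \<and> ht i - 1 = ht j + cc (blk j) (blk i))" by auto
    then show "(A s * J) $$ (i, j) = (J * A s) $$ (i, j)"
      unfolding commute_entries[OF Ac ij] l r by simp
  qed (auto simp: A_def shift_mat_def)
  moreover have "prec j i" if ij: "i < n" "j < n" and nz: "A s $$ (i, j) \<noteq> 0" for i j
  proof -
    note bl = blk_less[OF ij(1)] blk_less[OF ij(2)] ht_cht[OF ij(1)] ht_cht[OF ij(2)]
    have e: "E (blk j) (blk i)" "ht i = ht j + cc (blk j) (blk i)"
      using nz ij by (auto simp: A_def edge_def split: if_splits)
    then show ?thesis using hom[OF bl(2,1) e(1)] low[OF bl(2,1) e(1)] bl(3,4) by (auto simp: prec_def)
  qed
  ultimately have "A s \<in> tri" using Ac by (auto simp: tri_def)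
  then show ?thesis using cor by blast
qed

end

text \<open>
  The potential of height \<open>u\<close> in a part \<open>q\<close> of level \<open>s\<close>: it has slope \<open>s\<close>, except that up to two
  steps at either end have the larger slopes 4 and 1.
\<close>

definition bump :: "int \<Rightarrow> nat \<Rightarrow> int" where
  "bump s x = (if 1 \<le> x then max 0 (4 - s) else 0) + (if 2 \<le> x then max 0 (1 - s) else 0)"

definition pot :: "int \<Rightarrow> nat \<Rightarrow> nat \<Rightarrow> int" where
  "pot s q u = s * int u + bump s u - bump s (q - 1 - u)"

text \<open>The first level belongs to the smaller of two linked parts. Unequal levels fall as the
  parts grow, so that the exponent of a link vanishes only near the ends; equal levels let a string
  alternate between two parts. The pairs listed are those that occur in the constructions
  below.\<close>

definition linkable :: "int \<Rightarrow> int \<Rightarrow> bool" where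
  "linkable s s' \<longleftrightarrow> (s, s') \<in> {(6, 6), (3, 3), (6, 5), (6, 3), (5, 3), (3, 2), (3, 0), (2, 0)}"

text \<open>The last height up to which the two potentials grow in parallel from height 0. Levels 3,
  2 and 0 share the slope 4 of the first step and part at the second; below level 5 or 6 the slopes
  differ at once. For levels 3 and 3 only the steep last step of the smaller part breaks the
  tie.\<close>

definition reach :: "int \<Rightarrow> int \<Rightarrow> nat \<Rightarrow> nat" where
  "reach s s' p = (if s = 6 \<and> s' = 6 then p - 1 else if s = 3 \<and> s' = 3 then p - 2
     else if 5 \<le> s then 0 else 1)"

text \<open>A part of level 3 has slope 4 in its first and last step, so a step along it has
  exponent 0 only one row further in.\<close>

definition inset :: "int \<Rightarrow> nat" where "inset s = (if s = 6 then 0 else 1)"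

lemma linkable_cases:
  assumes "linkable s s'"
  obtains "s = 6" "s' = 6" | "s = 3" "s' = 3" | "s = 6" "s' = 5" | "s = 6" "s' = 3" | "s = 5" "s' = 3"
    | "s = 3" "s' = 2" | "s = 3" "s' = 0" | "s = 2" "s' = 0"
  using assms unfolding linkable_def by auto

lemma reach_less: "linkable s s' \<Longrightarrow> 0 < p \<Longrightarrow> (s \<le> 3 \<Longrightarrow> 3 \<le> p) \<Longrightarrow> reach s s' p < p"
  by (erule linkable_cases) (auto simp: reach_def)

lemma pot_reverse:
  assumes "u < q"
  shows "pot s q (q - 1 - u) = pot s q (q - 1) + pot s q 0 - pot s q u"
  using assms by (auto simp: pot_def of_nat_diff algebra_simps bump_def)

text \<open>At every step the potential of the larger part grows no faster than that of the smaller
  one; \<open>reach\<close> marks the first strict difference. The condition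
  \<open>3 \<le> p\<close> keeps the steep first and last steps of the smaller part apart.\<close>

lemma pot_down:
  assumes "linkable s s'" "p < q" "s \<le> 3 \<Longrightarrow> 3 \<le> p" "u < p"
  shows "pot s' q u - pot s p u \<le> pot s' q 0 - pot s p 0"
    and "pot s' q u - pot s p u = pot s' q 0 - pot s p 0 \<longleftrightarrow> u \<le> reach s s' p"
proof -
  obtain v where p: "p = u + Suc v" using less_imp_Suc_add[OF assms(4)] by auto
  obtain d where q: "q = p + Suc d" using less_imp_Suc_add[OF assms(2)] by auto
  have u: "u = 0 \<or> u = 1 \<or> (\<exists>u'. u = Suc (Suc u'))" and v: "v = 0 \<or> v = 1 \<or> (\<exists>v'. v = Suc (Suc v'))"
    by presburger+
  have "pot s' q u - pot s p u \<le> pot s' q 0 - pot s p 0 \<and>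
    (pot s' q u - pot s p u = pot s' q 0 - pot s p 0 \<longleftrightarrow> u \<le> reach s s' p)"
    using assms(1)
    by (rule linkable_cases)
      (use u v assms(3) in \<open>auto simp: pot_def bump_def reach_def p q\<close>)
  then show "pot s' q u - pot s p u \<le> pot s' q 0 - pot s p 0"
    "pot s' q u - pot s p u = pot s' q 0 - pot s p 0 \<longleftrightarrow> u \<le> reach s s' p" by auto
qed

text \<open>By \<open>pot_reverse\<close>, reflecting the heights negates a potential up to a
  constant, so that upward links are downward links seen from the other end.\<close>

lemma pot_up:
  assumes l: "linkable s s'" and pq: "p < q" "s \<le> 3 \<Longrightarrow> 3 \<le> p" and u: "u < p"
  shows "pot s p u - pot s' q (u + (q - p)) \<le> pot s p (p - 1) - pot s' q (q - 1)"
    and "pot s p u - pot s' q (u + (q - p)) = pot s p (p - 1) - pot s' q (q - 1) \<longleftrightarrow> p - 1 - u \<le> reach s s' p"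
proof -
  have e: "q - 1 - (p - 1 - u) = u + (q - p)" "p - 1 - (p - 1 - u) = u" "p - 1 - u < p" "p - 1 - u < q" using pq u by auto
  have 1: "pot s p u = pot s p (p - 1) + pot s p 0 - pot s p (p - 1 - u)"
    using pot_reverse[of "p - 1 - u" p s] e by simp
  have 2: "pot s' q (u + (q - p)) = pot s' q (q - 1) + pot s' q 0 - pot s' q (p - 1 - u)"
    using pot_reverse[of "p - 1 - u" q s'] e by simp
  note d = pot_down[OF l pq e(3)]
  show "pot s p u - pot s' q (u + (q - p)) \<le> pot s p (p - 1) - pot s' q (q - 1)"
    unfolding 1 2 using d(1) by simp
  have "pot s p u - pot s' q (u + (q - p)) = pot s p (p - 1) - pot s' q (q - 1) \<longleftrightarrow>
    pot s' q (p - 1 - u) - pot s p (p - 1 - u) = pot s' q 0 - pot s p 0" unfolding 1 2 by linarith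
  then show "pot s p u - pot s' q (u + (q - p)) = pot s p (p - 1) - pot s' q (q - 1) \<longleftrightarrow> p - 1 - u \<le> reach s s' p"
    using d(2) by simp
qed

lemma pot_self:
  assumes "s = 6 \<or> s = 3" "Suc u < p"
  shows "s \<le> pot s p (Suc u) - pot s p u"
    and "pot s p (Suc u) - pot s p u = s \<longleftrightarrow> inset s \<le> u \<and> u + 2 + inset s \<le> p"
proof -
  obtain v where p: "p = Suc u + Suc v" using less_imp_Suc_add[OF assms(2)] by auto
  have u: "u = 0 \<or> (\<exists>u'. u = Suc u')" and v: "v = 0 \<or> v = 1 \<or> (\<exists>v'. v = Suc (Suc v'))"
    by presburger+
  have "s \<le> pot s p (Suc u) - pot s p u \<and> (pot s p (Suc u) - pot s p u = s \<longleftrightarrow> inset s \<le> u \<and> u + 2 + inset s \<le> p)"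
    using assms(1) by (rule disjE) (use u v in \<open>auto simp: pot_def bump_def inset_def p algebra_simps\<close>)
  then show "s \<le> pot s p (Suc u) - pot s p u"
    "pot s p (Suc u) - pot s p u = s \<longleftrightarrow> inset s \<le> u \<and> u + 2 + inset s \<le> p" by auto
qed

lemma corank_le_mono: "corank_le n F d \<Longrightarrow> d \<le> d' \<Longrightarrow> corank_le n F d'"
  unfolding corank_le_def by (meson le_trans)

context pos_block_coords
begin

lemma rk_inj: "b < m \<Longrightarrow> b' < m \<Longrightarrow> sz b = sz b' \<Longrightarrow> rk b = rk b' \<Longrightarrow> b = b'"
  using rk_less_iff[of b b'] rk_less_iff[of b' b] by simp

text \<open>
  Rows are pairs of a part and a height. The matrix moves through each row from copy to copy, and
  from the last copy down (to the next smaller linked part), up (to the next larger one) or along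
  (to the next height of the same part). The rows in \<open>T\<close> may be final rows of a string, and the rows in
  \<open>Del\<close> are left out.
\<close>

lemma rows_corank_le:
  fixes sg :: "nat \<Rightarrow> int" and hi lo :: "nat \<Rightarrow> nat option" and Sf :: "nat set" and Del T :: "(nat \<times> nat) set"
  defines "dn \<equiv> \<lambda>q u. \<exists>p. lo q = Some p \<and> u \<le> reach (sg p) (sg q) p"
    and "up \<equiv> \<lambda>p u. \<exists>q. hi p = Some q \<and> p - 1 - u \<le> reach (sg p) (sg q) p"
    and "al \<equiv> \<lambda>p u. p \<in> Sf \<and> inset (sg p) \<le> u \<and> u + 2 + inset (sg p) \<le> p"
  assumes inf: "infinite (UNIV :: 'a::field set)"
    and hilo: "\<And>p q. hi p = Some q \<longleftrightarrow> lo q = Some p"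
    and link: "\<And>p q. hi p = Some q \<Longrightarrow> p < q \<and> linkable (sg p) (sg q) \<and> (sg p \<le> 3 \<longrightarrow> 3 \<le> p) \<and>
      cls p \<noteq> [] \<and> cls q \<noteq> []"
    and self: "\<And>p. p \<in> Sf \<Longrightarrow> sg p = 6 \<or> sg p = 3"
    and excl: "\<And>q u. cls q \<noteq> [] \<Longrightarrow> u < q \<Longrightarrow> \<not> (dn q u \<and> up q u) \<and> \<not> (dn q u \<and> al q u) \<and> \<not> (up q u \<and> al q u)"
    and cover: "\<And>q u. cls q \<noteq> [] \<Longrightarrow> u < q \<Longrightarrow> (q, u) \<notin> Del \<Longrightarrow> (q, u) \<notin> T \<Longrightarrow> dn q u \<or> up q u \<or> al q u"
    and exn: "\<And>q u. cls q \<noteq> [] \<Longrightarrow> u < q \<Longrightarrow> (q, u) \<in> Del \<Longrightarrow> \<not> dn q u \<and> \<not> up q u \<and> \<not> al q u"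
    and sym: "\<And>q u. u < q \<Longrightarrow> (q, u) \<in> Del \<Longrightarrow> (q, q - 1 - u) \<in> Del"
    and T: "finite T" "card T \<le> t"
    and X: "card {i. i < n \<and> (sz (blk i), ht i) \<in> Del} \<le> X"
  shows "\<exists>A\<in>(tri :: 'a mat set). corank_le n (A ^\<^sub>m k) (X + k * t)"
proof -
  \<comment> \<open>In a row the copies are passed from the largest rank to 0, as
    \<open>prec\<close> demands; the next row is entered at its last copy.\<close>
  define E where "E b b' \<longleftrightarrow> sz b = sz b' \<and> rk b = Suc (rk b') \<or>
    rk b = 0 \<and> Suc (rk b') = length (cls (sz b')) \<and>
      (lo (sz b) = Some (sz b') \<or> hi (sz b) = Some (sz b') \<or> sz b = sz b' \<and> sz b \<in> Sf)" for b b'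
  define cc where "cc b b' = (if sz b = sz b' then (if rk b = 0 then 1 else 0) else sz b' - sz b)" for b b'
  define P where "P q u = pot (sg q) q u" for q u
  \<comment> \<open>Normalized so that the exponent is 0 at height 0 for a step down and at the last
    height for a step up. \<open>pot_down\<close>, \<open>pot_up\<close> and \<open>pot_self\<close>
    then show that no exponent is negative and where else it vanishes.\<close>
  define wt where "wt b b' = (if sz b = sz b' then (if rk b = 0 then - sg (sz b) else 0)
     else if sz b' < sz b then P (sz b) 0 - P (sz b') 0
     else P (sz b) (sz b - 1) - P (sz b') (sz b' - 1))" for b b'
  define om where "om i = P (sz (blk i)) (ht i)" for i
  define edge where "edge x y \<longleftrightarrow> E (blk x) (blk y) \<and> ht y = ht x + cc (blk x) (blk y)" for x y
  define ex where "ex x y = wt (blk x) (blk y) + om y - om x" for x y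
  define rstep where "rstep q u q' u' \<longleftrightarrow> (lo q = Some q' \<and> u' = u \<and> dn q u) \<or>
    (hi q = Some q' \<and> u' = u + (q' - q) \<and> up q u) \<or> (q' = q \<and> u' = Suc u \<and> al q u)" for q u q' u'
  have lo_link: "p < q \<and> linkable (sg p) (sg q) \<and> (sg p \<le> 3 \<longrightarrow> 3 \<le> p) \<and> cls p \<noteq> [] \<and> cls q \<noteq> []"
    if "lo q = Some p" for p q using that link hilo by blast
  have pres: "cls (sz (blk i)) \<noteq> []" if "i < n" for i using rk[OF blk_less[OF that]] by auto
  have zero: "0 \<le> ex x y \<and> (ex x y = 0 \<longleftrightarrow> sz (blk x) = sz (blk y) \<and> rk (blk x) = Suc (rk (blk y)) \<and> ht x = ht y \<or>
      rk (blk x) = 0 \<and> Suc (rk (blk y)) = length (cls (sz (blk y))) \<and> rstep (sz (blk x)) (ht x) (sz (blk y)) (ht y))"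
    if xy: "x < n" "y < n" and e: "edge x y" for x y
  proof -
    define q u q' u' where "q = sz (blk x)" and "u = ht x" and "q' = sz (blk y)" and "u' = ht y"
    note d = q_def[symmetric] u_def[symmetric] q'_def[symmetric] u'_def[symmetric]
    have lt: "u < q" "u' < q'" using ht_less xy by (auto simp: q_def u_def q'_def u'_def)
    consider (inner) "q = q'" "rk (blk x) = Suc (rk (blk y))" "u' = u"
      | (down) "rk (blk x) = 0" "Suc (rk (blk y)) = length (cls q')" "lo q = Some q'" "u' = u"
      | (up) "rk (blk x) = 0" "Suc (rk (blk y)) = length (cls q')" "hi q = Some q'" "u' = u + (q' - q)"
      | (along) "rk (blk x) = 0" "Suc (rk (blk y)) = length (cls q')" "q' = q" "q \<in> Sf" "u' = Suc u"
    proof -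
      have ee: "E (blk x) (blk y)" "u' = u + cc (blk x) (blk y)" using e unfolding edge_def d by auto
      from ee(1) show thesis unfolding E_def d
      proof (elim disjE conjE)
        assume a: "q = q'" "rk (blk x) = Suc (rk (blk y))"
        then show thesis using inner ee(2) by (simp add: cc_def d)
      next
        assume a: "rk (blk x) = 0" "Suc (rk (blk y)) = length (cls q')" "lo q = Some q'"
        then show thesis using down ee(2) lo_link[OF a(3)] by (simp add: cc_def d)
      next
        assume a: "rk (blk x) = 0" "Suc (rk (blk y)) = length (cls q')" "hi q = Some q'"
        then show thesis using up ee(2) link[OF a(3)] by (simp add: cc_def d)
      next
        assume a: "rk (blk x) = 0" "Suc (rk (blk y)) = length (cls q')" "q = q'" "q \<in> Sf"
        have "cc (blk x) (blk y) = 1" unfolding cc_def d using a(1,3) by simp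
        then show thesis using along[OF a(1,2) a(3)[symmetric] a(4)] ee(2) by simp
      qed
    qed
    then show ?thesis
    proof cases
      case inner
      then show ?thesis unfolding ex_def wt_def om_def d by simp
    next
      case down
      note l = lo_link[OF down(3)]
      have "ex x y = P q 0 - P q' 0 + P q' u - P q u" unfolding ex_def wt_def om_def d using l down by simp
      moreover have "rstep q u q' u' \<longleftrightarrow> u \<le> reach (sg q') (sg q) q'"
        unfolding rstep_def dn_def using down l hilo[of q q'] link[of q q'] by auto
      ultimately show ?thesis
        using pot_down[of "sg q'" "sg q" q' q u] l down lt unfolding d P_def by auto
    next
      case up
      note l = link[OF up(3)]
      have "ex x y = P q (q - 1) - P q' (q' - 1) + P q' (u + (q' - q)) - P q u"
        unfolding ex_def wt_def om_def d using l up by simp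
      moreover have "rstep q u q' u' \<longleftrightarrow> q - 1 - u \<le> reach (sg q) (sg q') q"
        unfolding rstep_def up_def using up l lo_link[of q q'] by auto
      ultimately show ?thesis
        using pot_up[of "sg q" "sg q'" q q' u] l up lt unfolding d P_def by auto
    next
      case along
      have "ex x y = - sg q + P q (Suc u) - P q u" unfolding ex_def wt_def om_def d using along by simp
      moreover have "rstep q u q' u' \<longleftrightarrow> inset (sg q) \<le> u \<and> u + 2 + inset (sg q) \<le> q"
        unfolding rstep_def al_def using along lo_link[of q q] link[of q q] by auto
      ultimately show ?thesis
        using pot_self[of "sg q" u q] self[of q] along lt unfolding d P_def by auto
    qed
  qed
  have ze: "edge x y \<and> ex x y = 0 \<longleftrightarrow> sz (blk x) = sz (blk y) \<and> rk (blk x) = Suc (rk (blk y)) \<and> ht x = ht y \<or>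
      rk (blk x) = 0 \<and> Suc (rk (blk y)) = length (cls (sz (blk y))) \<and> rstep (sz (blk x)) (ht x) (sz (blk y)) (ht y)"
    (is "?l \<longleftrightarrow> ?r") if xy: "x < n" "y < n" for x y
  proof
    assume r: ?r
    then have "edge x y"
      unfolding rstep_def
    proof (elim disjE conjE)
      assume "sz (blk x) = sz (blk y)" "rk (blk x) = Suc (rk (blk y))" "ht x = ht y"
      then show ?thesis by (simp add: edge_def E_def cc_def)
    next
      assume a: "rk (blk x) = 0" "Suc (rk (blk y)) = length (cls (sz (blk y)))" "lo (sz (blk x)) = Some (sz (blk y))" "ht y = ht x"
      then show ?thesis using lo_link[OF a(3)] by (simp add: edge_def E_def cc_def)
    next
      assume a: "rk (blk x) = 0" "Suc (rk (blk y)) = length (cls (sz (blk y)))" "hi (sz (blk x)) = Some (sz (blk y))"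
        "ht y = ht x + (sz (blk y) - sz (blk x))"
      then show ?thesis using link[OF a(3)] by (simp add: edge_def E_def cc_def)
    next
      assume a: "rk (blk x) = 0" "Suc (rk (blk y)) = length (cls (sz (blk y)))" "sz (blk y) = sz (blk x)"
        "ht y = Suc (ht x)" "al (sz (blk x)) (ht x)"
      then show ?thesis by (simp add: edge_def E_def cc_def al_def)
    qed
    then show ?l using zero[OF xy] r by blast
  qed (use zero[OF xy] in blast)
  \<comment> \<open>Reflecting heights turns a step into a row into a step out of the reflected row.
    So \<open>excl\<close>, which says that at most one step leaves a row, also says that at most
    one enters it.\<close>
  have rev: "(u' = u \<and> hi q' = Some q \<and> up q' (q' - 1 - u')) \<or>
     (u' = u + (q' - q) \<and> lo q' = Some q \<and> dn q' (q' - 1 - u')) \<or> (q' = q \<and> u' = Suc u \<and> al q' (q' - 1 - u'))"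
    if "rstep q u q' u'" "u < q" "u' < q'" for q u q' u'
    using that(1) unfolding rstep_def
  proof (elim disjE conjE)
    assume a: "lo q = Some q'" "u' = u" "dn q u"
    then have "u \<le> reach (sg q') (sg q) q'" by (auto simp: dn_def)
    moreover have "hi q' = Some q" using a hilo by blast
    moreover have "q' - 1 - (q' - 1 - u') = u" using a that by simp
    ultimately show ?thesis using a by (auto simp: up_def)
  next
    assume a: "hi q = Some q'" "u' = u + (q' - q)" "up q u"
    then have "q - 1 - u \<le> reach (sg q) (sg q') q" by (auto simp: up_def)
    moreover have "lo q' = Some q" using a hilo by blast
    moreover have "q' - 1 - u' = q - 1 - u" using a that link[OF a(1)] by auto
    ultimately show ?thesis using a by (auto simp: dn_def)
  next
    assume a: "q' = q" "u' = Suc u" "al q u"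
    then show ?thesis using that by (auto simp: al_def)
  qed
  have rinj: "q = r \<and> u = v" if "rstep q u q' u'" "rstep r v q' u'" "u < q" "v < r" "u' < q'" "cls q' \<noteq> []" for q u r v q' u'
    using rev[OF that(1,3,5)] rev[OF that(2,4,5)] excl[OF that(6), of "q' - 1 - u'"] that(5) by auto
  have rfun: "q' = r' \<and> u' = v'" if "rstep q u q' u'" "rstep q u r' v'" "u < q" "cls q \<noteq> []" for q u q' u' r' v'
    using that(1,2) excl[OF that(4,3)] unfolding rstep_def by auto
  have rex: "\<exists>q' u'. rstep q u q' u' \<and> u' < q' \<and> cls q' \<noteq> [] \<and> (q', u') \<notin> Del"
    if q: "cls q \<noteq> []" "u < q" "(q, u) \<notin> Del" "(q, u) \<notin> T" for q u
  proof -
    have "\<exists>q' u'. rstep q u q' u' \<and> u' < q' \<and> cls q' \<noteq> []"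
      using cover[OF q]
    proof (elim disjE)
      assume a: "dn q u"
      then obtain p where p: "lo q = Some p" "u \<le> reach (sg p) (sg q) p" by (auto simp: dn_def)
      have "0 < p" using lo_link[OF p(1)] cls_nth[of 0 p] sz_pos[of "cls p ! 0"] by auto
      then have "reach (sg p) (sg q) p < p" using reach_less lo_link[OF p(1)] by blast
      then have "u < p" using p(2) by simp
      then show ?thesis using a p lo_link[OF p(1)] by (intro exI[of _ p] exI[of _ u]) (auto simp: rstep_def)
    next
      assume a: "up q u"
      then obtain p where p: "hi q = Some p" by (auto simp: up_def)
      then show ?thesis using a q link[OF p] by (intro exI[of _ p] exI[of _ "u + (p - q)"]) (auto simp: rstep_def)
    next
      assume a: "al q u"
      then show ?thesis using q by (intro exI[of _ q] exI[of _ "Suc u"]) (auto simp: rstep_def al_def)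
    qed
    then obtain q' u' where r: "rstep q u q' u'" "u' < q'" "cls q' \<noteq> []" by blast
    \<comment> \<open>A step into a deleted row would reflect to a step out of a row that is deleted
      by \<open>sym\<close>, against \<open>exn\<close>.\<close>
    have "(q', u') \<notin> Del"
    proof
      assume "(q', u') \<in> Del"
      then have "(q', q' - 1 - u') \<in> Del" using sym r by blast
      then show False using exn[OF r(3), of "q' - 1 - u'"] rev[OF r(1) q(2) r(2)] r(2) by auto
    qed
    then show ?thesis using r by blast
  qed
  define C where "C = {i. i < n \<and> (sz (blk i), ht i) \<notin> Del}"
  \<comment> \<open>Only the copy of rank 0 in a row of \<open>T\<close> may lack a successor, so at
    most one element of \<open>C\<close> is lost for each row of \<open>T\<close>.\<close>
  define good where "good = {i \<in> C. rk (blk i) \<noteq> 0 \<or> (sz (blk i), ht i) \<notin> T}"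
  have C: "C \<subseteq> {..<n}" "finite C" by (auto simp: C_def)
  have "card (C - good) \<le> card T"
  proof (rule card_inj_on_le[where f = "\<lambda>i. (sz (blk i), ht i)"])
    show "inj_on (\<lambda>i. (sz (blk i), ht i)) (C - good)"
    proof (rule inj_onI)
      fix i j assume a: "i \<in> C - good" "j \<in> C - good" "(sz (blk i), ht i) = (sz (blk j), ht j)"
      then have ij: "i < n" "j < n" "rk (blk i) = rk (blk j)" by (auto simp: C_def good_def)
      have "blk i = blk j" using rk_inj[OF blk_less[OF ij(1)] blk_less[OF ij(2)]] a(3) ij(3) by simp
      then show "i = j" using coord_inj[OF ij(1,2)] a(3) by simp
    qed
  qed (use T(1) in \<open>auto simp: good_def\<close>)
  moreover have "card C = card good + card (C - good)"
  proof -
    have "good \<subseteq> C" by (auto simp: good_def)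
    then show ?thesis using C(2) card_mono[of C good] by (simp add: card_Diff_subset finite_subset)
  qed
  ultimately have S: "card C \<le> card good + card T" by simp
  have "\<exists>A\<in>(tri :: 'a mat set). corank_le n (A ^\<^sub>m k) (n - card C + k * card T)"
  proof (rule degeneration_corank_le[OF inf, where E = E and cc = cc and wt = wt and om = om and good = good,
        folded edge_def ex_def])
    show "sz b' \<le> sz b + cc b b'" if "E b b'" for b b'
      using that by (auto simp: cc_def)
    show "b' < b" if "b < m" "b' < m" "E b b'" "cc b b' = 0" "sz b = sz b'" for b b'
      using that rk_less_iff[of b' b] by (auto simp: cc_def E_def split: if_splits)
    show "0 \<le> ex x y" if "x < n" "y < n" "edge x y" for x y using zero[OF that] by blast
    show "\<exists>w\<in>C. \<forall>y<n. edge x y \<and> ex x y = 0 \<longleftrightarrow> y = w" if g: "x \<in> good" for x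
    proof -
      have x: "x < n" "(sz (blk x), ht x) \<notin> Del" using g by (auto simp: good_def C_def)
      note bx = blk_less[OF x(1)] ht_less[OF x(1)]
      show ?thesis
      proof (cases "rk (blk x)")
        case (Suc k)
        have k: "k < length (cls (sz (blk x)))" using rk[OF bx(1)] Suc by simp
        note c = cls_nth[OF k]
        define w where "w = ix (cls (sz (blk x)) ! k) (ht x)"
        have w: "w < n" "blk w = cls (sz (blk x)) ! k" "ht w = ht x" "sz (blk w) = sz (blk x)" "rk (blk w) = k"
          using ix[of "cls (sz (blk x)) ! k" "ht x"] c bx(2) rk_cls[OF k] by (auto simp: w_def)
        have "edge x y \<and> ex x y = 0 \<longleftrightarrow> y = w" if y: "y < n" for y
        proof
          assume "edge x y \<and> ex x y = 0"
          then have a: "sz (blk x) = sz (blk y)" "rk (blk y) = k" "ht x = ht y" using ze[OF x(1) y] Suc by auto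
          then have "blk y = blk w" using rk_inj[OF blk_less[OF y] blk_less[OF w(1)]] w(4,5) by simp
          then show "y = w" using coord_inj[OF y w(1)] w(3) a(3) by simp
        qed (use ze[OF x(1) y] w(3-5) Suc in simp)
        moreover have "w \<in> C" using w(1,3,4) x by (simp add: C_def)
        ultimately show ?thesis by blast
      next
        case 0
        then have "(sz (blk x), ht x) \<notin> T" using g by (auto simp: good_def)
        then obtain q' u' where r: "rstep (sz (blk x)) (ht x) q' u'" "u' < q'" "cls q' \<noteq> []" "(q', u') \<notin> Del"
          using rex[OF pres[OF x(1)] bx(2) x(2)] by blast
        let ?k = "length (cls q') - 1"
        have k: "?k < length (cls q')" using r(3) by simp
        define w where "w = ix (cls q' ! ?k) u'"
        have w: "w < n" "blk w = cls q' ! ?k" "ht w = u'" "sz (blk w) = q'" "rk (blk w) = ?k"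
          using ix[of "cls q' ! ?k" u'] cls_nth[OF k] r(2) rk_cls[OF k] by (auto simp: w_def)
        have "edge x y \<and> ex x y = 0 \<longleftrightarrow> y = w" if y: "y < n" for y
        proof
          assume "edge x y \<and> ex x y = 0"
          then have a: "Suc (rk (blk y)) = length (cls (sz (blk y)))" "rstep (sz (blk x)) (ht x) (sz (blk y)) (ht y)"
            using ze[OF x(1) y] 0 by auto
          then have e: "sz (blk y) = q'" "ht y = u'" using rfun[OF r(1) a(2) bx(2) pres[OF x(1)]] by auto
          then have "rk (blk y) = ?k" using a(1) by simp
          then have "blk y = blk w" using rk_inj[OF blk_less[OF y] blk_less[OF w(1)]] w(4,5) e(1) by simp
          then show "y = w" using coord_inj[OF y w(1)] w(3) e(2) by simp
        qed (use ze[OF x(1) y] w(3-5) 0 r(1) k in simp)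
        moreover have "w \<in> C" using w(1,3,4) r(4) by (simp add: C_def)
        ultimately show ?thesis by blast
      qed
    qed
    show "x = x'" if g: "x \<in> good" "x' \<in> good" and w: "w < n" "edge x w" "ex x w = 0" "edge x' w" "ex x' w = 0" for x x' w
    proof -
      have x: "x < n" "x' < n" using g by (auto simp: good_def C_def)
      note z = ze[OF x(1) w(1)] ze[OF x(2) w(1)]
      have rw: "rk (blk w) < length (cls (sz (blk w)))" "rk (blk x) < length (cls (sz (blk x)))"
        "rk (blk x') < length (cls (sz (blk x')))" using rk blk_less x w(1) by auto
      have "sz (blk x) = sz (blk x') \<and> rk (blk x) = rk (blk x') \<and> ht x = ht x'"
        using z w rw rinj[of "sz (blk x)" "ht x" "sz (blk w)" "ht w" "sz (blk x')" "ht x'"]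
          ht_less[OF x(1)] ht_less[OF x(2)] ht_less[OF w(1)] pres[OF w(1)] by auto
      then show ?thesis using coord_inj[OF x] rk_inj[OF blk_less[OF x(1)] blk_less[OF x(2)]] by simp
    qed
  qed (use C S in \<open>auto simp: good_def\<close>)
  moreover have "n - card C \<le> X"
  proof -
    have "{i. i < n \<and> (sz (blk i), ht i) \<in> Del} = {..<n} - C" by (auto simp: C_def)
    then show ?thesis using X C by (simp add: card_Diff_subset)
  qed
  ultimately show ?thesis using corank_le_mono T(2) by (meson add_le_mono mult_le_mono2)
qed

lemma card_rows:
  assumes "finite Del" "\<And>q u. (q, u) \<in> Del \<Longrightarrow> u < q"
  shows "card {i. i < n \<and> (sz (blk i), ht i) \<in> Del} = (\<Sum>(q, u)\<in>Del. length (cls q))"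
proof -
  have 1: "card {i. i < n \<and> sz (blk i) = q \<and> ht i = u} = length (cls q)" if "u < q" for q u
  proof -
    have "(\<Sum>l<n. if ht l = u \<and> sz (blk l) = q then 1 else 0 :: nat) = card {i. i < n \<and> sz (blk i) = q \<and> ht i = u}"
      by (subst sum.inter_filter[symmetric]) (auto intro!: arg_cong[where f = card])
    then show ?thesis using sum_class[OF that, of "\<lambda>_. 1 :: nat"] by simp
  qed
  let ?A = "\<lambda>x. {i. i < n \<and> (sz (blk i), ht i) = x}"
  have "card {i. i < n \<and> (sz (blk i), ht i) \<in> Del} = card (\<Union>x\<in>Del. ?A x)"
    by (rule arg_cong[where f = card]) auto
  also have "\<dots> = (\<Sum>x\<in>Del. card (?A x))"
    by (rule card_UN_disjoint) (use assms(1) in auto)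
  also have "\<dots> = (\<Sum>(q, u)\<in>Del. length (cls q))"
  proof (rule sum.cong)
    fix x assume "x \<in> Del"
    then show "card (?A x) = (case x of (q, u) \<Rightarrow> length (cls q))"
      using 1[of "snd x" "fst x"] assms(2) by (cases x) simp
  qed simp
  finally show ?thesis .
qed

end

section \<open>Partitions covered by three almost rectangular ones\<close>

text \<open>The numbers \<open>c + 1\<close>, \<open>c + d + 3\<close> and
  \<open>c + d + e + 5\<close> begin the three pairs; \<open>c\<close>, \<open>d\<close> and
  \<open>e\<close> record the slack. Strings may mix the two lower pairs when \<open>c + 2\<close>
  occurs and \<open>d = 0\<close>, the two upper ones when \<open>c + d + 4\<close> occurs and
  \<open>e = 0\<close>.\<close>

locale three_pairs = pos_block_coords +
  fixes c d e :: nat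
  assumes present: "cls q \<noteq> [] \<Longrightarrow> q \<in> {c + 1, c + 2, c + d + 3, c + d + 4, c + d + e + 5, c + d + e + 6}"
    and lower_present: "cls (c + 1) \<noteq> []" "cls (c + d + 3) \<noteq> []" "cls (c + d + e + 5) \<noteq> []"
begin

lemma present_cases:
  assumes "cls q \<noteq> []"
  obtains "q = c + 1" | "q = c + 2" "cls (c + 2) \<noteq> []" | "q = c + d + 3" | "q = c + d + 4" "cls (c + d + 4) \<noteq> []"
    | "q = c + d + e + 5" | "q = c + d + e + 6" "cls (c + d + e + 6) \<noteq> []"
  using present[OF assms] assms by auto

lemma card_two_row_blocks:
  assumes "p \<noteq> q" "i + l \<le> p" "j + l' \<le> q"
  shows "card {x. x < n \<and> (sz (blk x), ht x) \<in> {p} \<times> {i..<i + l} \<union> {q} \<times> {j..<j + l'}} \<le>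
    l * length (cls p) + l' * length (cls q)"
proof -
  have "card {x. x < n \<and> (sz (blk x), ht x) \<in> {p} \<times> {i..<i + l} \<union> {q} \<times> {j..<j + l'}} =
    (\<Sum>(q, u)\<in>{p} \<times> {i..<i + l} \<union> {q} \<times> {j..<j + l'}. length (cls q))"
    by (rule card_rows) (use assms in auto)
  also have "\<dots> = (\<Sum>(q, u)\<in>{p} \<times> {i..<i + l}. length (cls q)) + (\<Sum>(q, u)\<in>{q} \<times> {j..<j + l'}. length (cls q))"
    by (rule sum.union_disjoint) (use assms in auto)
  also have "\<dots> = l * length (cls p) + l' * length (cls q)"
    by (simp add: sum.cartesian_product[symmetric])
  finally show ?thesis by simp
qed

abbreviation "top1 \<equiv> if cls (c + 2) \<noteq> [] then c + 2 else c + 1"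
abbreviation "top2 \<equiv> if cls (c + d + 4) \<noteq> [] then c + d + 4 else c + d + 3"
abbreviation "top3 \<equiv> if cls (c + d + e + 6) \<noteq> [] then c + d + e + 6 else c + d + e + 5"

text \<open>At level 6 throughout, each pair is a string of its own: it alternates between the rows
  of its two parts, or runs along a single part, and ends in the last row of the larger part
  present.\<close>

lemma three_strings:
  assumes inf: "infinite (UNIV :: 'a::field set)"
  shows "\<exists>A\<in>(tri :: 'a mat set). corank_le n (A ^\<^sub>m k) (0 + k * 3)"
proof (rule rows_corank_le[OF inf, where sg = "\<lambda>q. 6"
    and hi = "\<lambda>q. if q = c + 1 \<and> cls (c + 2) \<noteq> [] then Some (c + 2)
        else if q = c + d + 3 \<and> cls (c + d + 4) \<noteq> [] then Some (c + d + 4)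
        else if q = c + d + e + 5 \<and> cls (c + d + e + 6) \<noteq> [] then Some (c + d + e + 6) else None"
    and lo = "\<lambda>q. if q = c + 2 \<and> cls (c + 2) \<noteq> [] then Some (c + 1)
        else if q = c + d + 4 \<and> cls (c + d + 4) \<noteq> [] then Some (c + d + 3)
        else if q = c + d + e + 6 \<and> cls (c + d + e + 6) \<noteq> [] then Some (c + d + e + 5) else None"
    and Sf = "{q. q = c + 1 \<and> cls (c + 2) = [] \<or> q = c + d + 3 \<and> cls (c + d + 4) = []
        \<or> q = c + d + e + 5 \<and> cls (c + d + e + 6) = []}"
    and Del = "{}" and T = "{(top1, top1 - 1), (top2, top2 - 1), (top3, top3 - 1)}"], goal_cases)
  case (1 p q) show ?case
    by (cases "cls (c + 2) = []"; cases "cls (c + d + 4) = []"; cases "cls (c + d + e + 6) = []"; simp; arith?)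
next
  case (2 p q) then show ?case using lower_present by (auto simp: linkable_def split: if_splits)
next
  case (3 p) then show ?case by (auto split: if_splits)
qed (((erule present_cases; auto simp: reach_def inset_def split: if_splits)[1])+,
    fastforce, simp, simp add: card_insert_if, simp)

text \<open>The lowest pair is given up altogether; the other two remain strings at level 6.\<close>

lemma two_strings_11:
  assumes inf: "infinite (UNIV :: 'a::field set)"
  shows "\<exists>A\<in>(tri :: 'a mat set).
    corank_le n (A ^\<^sub>m k) ((c + 1) * length (cls (c + 1)) + (c + 2) * length (cls (c + 2)) + k * 2)"
proof (rule rows_corank_le[OF inf, where sg = "\<lambda>q. 6"
    and hi = "\<lambda>q. if q = c + d + 3 \<and> cls (c + d + 4) \<noteq> [] then Some (c + d + 4)
        else if q = c + d + e + 5 \<and> cls (c + d + e + 6) \<noteq> [] then Some (c + d + e + 6) else None"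
    and lo = "\<lambda>q. if q = c + d + 4 \<and> cls (c + d + 4) \<noteq> [] then Some (c + d + 3)
        else if q = c + d + e + 6 \<and> cls (c + d + e + 6) \<noteq> [] then Some (c + d + e + 5) else None"
    and Sf = "{q. q = c + d + 3 \<and> cls (c + d + 4) = [] \<or> q = c + d + e + 5 \<and> cls (c + d + e + 6) = []}"
    and Del = "{c + 1} \<times> {0..<0 + (c + 1)}
        \<union> {c + 2} \<times> {0..<0 + (c + 2)}" and T = "{(top2, top2 - 1), (top3, top3 - 1)}"], goal_cases)
  case (1 p q) show ?case
    by (cases "cls (c + 2) = []"; cases "cls (c + d + 4) = []"; cases "cls (c + d + e + 6) = []"; simp; arith?)
next
  case (2 p q) then show ?case using lower_present by (auto simp: linkable_def split: if_splits)
next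
  case (3 p) then show ?case by (auto split: if_splits)
qed (((erule present_cases; auto simp: reach_def inset_def split: if_splits)[1])+,
    fastforce, simp, simp add: card_insert_if, rule card_two_row_blocks, auto)

text \<open>The parts of the middle pair keep only their first and last rows, since the levels 6, 5,
  3 confine the links to those. One string enters the lowest pair through the first rows, exhausts
  it and leaves through the last rows; the top pair is the other string.\<close>

lemma two_strings_22:
  assumes inf: "infinite (UNIV :: 'a::field set)"
  shows "\<exists>A\<in>(tri :: 'a mat set).
    corank_le n (A ^\<^sub>m k) ((c + d + 1) * length (cls (c + d + 3)) + (c + d + 2) * length (cls (c + d + 4)) + k * 2)"
proof (rule rows_corank_le[OF inf, where sg = "\<lambda>q. if q = c + d + 3 then 5
    else if q = c + d + 4 then 3 else 6"
    and hi = "\<lambda>q. if q = c + 1 then Some (if cls (c + 2) \<noteq> [] then c + 2 else c + d + 3)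
        else if q = c + 2 \<and> cls (c + 2) \<noteq> [] then Some (c + d + 3)
        else if q = c + d + 3 \<and> cls (c + d + 4) \<noteq> [] then Some (c + d + 4)
        else if q = c + d + e + 5 \<and> cls (c + d + e + 6) \<noteq> [] then Some (c + d + e + 6) else None"
    and lo = "\<lambda>q. if q = c + 2 \<and> cls (c + 2) \<noteq> [] then Some (c + 1)
        else if q = c + d + 3 then Some top1
        else if q = c + d + 4 \<and> cls (c + d + 4) \<noteq> [] then Some (c + d + 3)
        else if q = c + d + e + 6 \<and> cls (c + d + e + 6) \<noteq> [] then Some (c + d + e + 5) else None"
    and Sf = "{q. q = c + 1 \<and> cls (c + 2) = [] \<or> q = c + d + e + 5 \<and> cls (c + d + e + 6) = []}"
    and Del = "{c + d + 3} \<times> {1..<1 + (c + d + 1)}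
        \<union> {c + d + 4} \<times> {1..<1 + (c + d + 2)}" and T = "{(top2, top2 - 1), (top3, top3 - 1)}"], goal_cases)
  case (1 p q) show ?case
    by (cases "cls (c + 2) = []"; cases "cls (c + d + 4) = []"; cases "cls (c + d + e + 6) = []"; simp; arith?)
next
  case (2 p q) then show ?case using lower_present by (auto simp: linkable_def split: if_splits)
next
  case (3 p) then show ?case by (auto split: if_splits)
qed (((erule present_cases; auto simp: reach_def inset_def split: if_splits)[1])+,
    fastforce, simp, simp add: card_insert_if, rule card_two_row_blocks, auto)

text \<open>Now \<open>c + 2\<close> and \<open>c + 3\<close> are consecutive and carry a string at
  level 6, to which \<open>c + 4\<close> is attached by its first and last row. The rows of
  \<open>c + 1\<close> and the inner rows of \<open>c + 4\<close> are given up.\<close>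

lemma two_strings_12:
  assumes inf: "infinite (UNIV :: 'a::field set)" and "cls (c + 2) \<noteq> []" and "d = 0"
  shows "\<exists>A\<in>(tri :: 'a mat set).
    corank_le n (A ^\<^sub>m k) ((c + 1) * length (cls (c + 1)) + (c + d + 2) * length (cls (c + d + 4)) + k * 2)"
proof (rule rows_corank_le[OF inf, where sg = "\<lambda>q. if q = c + d + 4 then 3 else 6"
    and hi = "\<lambda>q. if q = c + 2 then Some (c + d + 3)
        else if q = c + d + 3 \<and> cls (c + d + 4) \<noteq> [] then Some (c + d + 4)
        else if q = c + d + e + 5 \<and> cls (c + d + e + 6) \<noteq> [] then Some (c + d + e + 6) else None"
    and lo = "\<lambda>q. if q = c + d + 3 then Some (c + 2)
        else if q = c + d + 4 \<and> cls (c + d + 4) \<noteq> [] then Some (c + d + 3)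
        else if q = c + d + e + 6 \<and> cls (c + d + e + 6) \<noteq> [] then Some (c + d + e + 5) else None"
    and Sf = "{q. q = c + d + e + 5 \<and> cls (c + d + e + 6) = []}"
    and Del = "{c + 1} \<times> {0..<0 + (c + 1)}
        \<union> {c + d + 4} \<times> {1..<1 + (c + d + 2)}" and T = "{(top2, top2 - 1), (top3, top3 - 1)}"], goal_cases)
  case (1 p q) show ?case using assms(2-)
    by (cases "cls (c + 2) = []"; cases "cls (c + d + 4) = []"; cases "cls (c + d + e + 6) = []"; simp; arith?)
next
  case (2 p q) then show ?case using assms(2-) lower_present by (auto simp: linkable_def split: if_splits)
next
  case (3 p) then show ?case by (auto split: if_splits)
qed (((erule present_cases; use assms(2-) in \<open>auto simp: reach_def inset_def split: if_splits\<close>)[1])+,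
    (use assms(2-) in auto)[1], simp, simp add: card_insert_if, rule card_two_row_blocks, auto)

text \<open>Two rows at either end of the top parts remain, because links among the levels 3, 2, 0
  reach 1. From height 0 a string goes on into the lowest pair; from height 1 it turns round in the
  middle pair, as the link between levels 6 and 3 has reach 0. Both strings end in the last two rows
  of the largest part.\<close>

lemma two_strings_33:
  assumes inf: "infinite (UNIV :: 'a::field set)"
  shows "\<exists>A\<in>(tri :: 'a mat set).
    corank_le n (A ^\<^sub>m k) ((c + d + e + 1) * length (cls (c + d + e + 5)) + (c + d + e + 2) * length (cls (c + d + e + 6)) + k * 2)"
proof (rule rows_corank_le[OF inf, where sg = "\<lambda>q. if q = c + d + 3 then 3 else if q = c + d + 4 then 3
    else if q = c + d + e + 5 then 2 else if q = c + d + e + 6 then 0 else 6"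
    and hi = "\<lambda>q. if q = c + 1 then Some (if cls (c + 2) \<noteq> [] then c + 2 else c + d + 3)
        else if q = c + 2 \<and> cls (c + 2) \<noteq> [] then Some (c + d + 3)
        else if q = c + d + 3 then Some (if cls (c + d + 4) \<noteq> [] then c + d + 4 else c + d + e + 5)
        else if q = c + d + 4 \<and> cls (c + d + 4) \<noteq> [] then Some (c + d + e + 5)
        else if q = c + d + e + 5 \<and> cls (c + d + e + 6) \<noteq> [] then Some (c + d + e + 6) else None"
    and lo = "\<lambda>q. if q = c + 2 \<and> cls (c + 2) \<noteq> [] then Some (c + 1)
        else if q = c + d + 3 then Some top1
        else if q = c + d + 4 \<and> cls (c + d + 4) \<noteq> [] then Some (c + d + 3)
        else if q = c + d + e + 5 then Some top2
        else if q = c + d + e + 6 \<and> cls (c + d + e + 6) \<noteq> [] then Some (c + d + e + 5) else None"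
    and Sf = "{q. q = c + 1 \<and> cls (c + 2) = [] \<or> q = c + d + 3 \<and> cls (c + d + 4) = []}"
    and Del = "{c + d + e + 5} \<times> {2..<2 + (c + d + e + 1)}
        \<union> {c + d + e + 6} \<times> {2..<2 + (c + d + e + 2)}" and T = "{(top3, top3 - 1), (top3, top3 - 2)}"], goal_cases)
  case (1 p q) show ?case
    by (cases "cls (c + 2) = []"; cases "cls (c + d + 4) = []"; cases "cls (c + d + e + 6) = []"; simp; arith?)
next
  case (2 p q) then show ?case using lower_present by (auto simp: linkable_def split: if_splits)
next
  case (3 p) then show ?case by (auto split: if_splits)
qed (((erule present_cases; auto simp: reach_def inset_def split: if_splits)[1])+,
    fastforce, simp, simp add: card_insert_if, rule card_two_row_blocks, auto)

text \<open>With \<open>e = 0\<close>, level 3 joins \<open>c + d + 4\<close> and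
  \<open>c + d + 5\<close>, between which the string of height 1 alternates. The string of height 0
  passes through the outer rows of \<open>c + d + 3\<close> to the lowest pair, and two rows at
  either end of \<open>c + d + 6\<close> serve both.\<close>

lemma two_strings_23:
  assumes inf: "infinite (UNIV :: 'a::field set)" and "cls (c + d + 4) \<noteq> []" and "e = 0"
  shows "\<exists>A\<in>(tri :: 'a mat set).
    corank_le n (A ^\<^sub>m k) ((c + d + 1) * length (cls (c + d + 3)) + (c + d + e + 2) * length (cls (c + d + e + 6)) + k * 2)"
proof (rule rows_corank_le[OF inf, where sg = "\<lambda>q. if q = c + d + 3 then 5 else if q = c + d + 4 then 3
    else if q = c + d + e + 5 then 3 else if q = c + d + e + 6 then 0 else 6"
    and hi = "\<lambda>q. if q = c + 1 then Some (if cls (c + 2) \<noteq> [] then c + 2 else c + d + 3)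
        else if q = c + 2 \<and> cls (c + 2) \<noteq> [] then Some (c + d + 3)
        else if q = c + d + 3 then Some (if cls (c + d + 4) \<noteq> [] then c + d + 4 else c + d + e + 5)
        else if q = c + d + 4 \<and> cls (c + d + 4) \<noteq> [] then Some (c + d + e + 5)
        else if q = c + d + e + 5 \<and> cls (c + d + e + 6) \<noteq> [] then Some (c + d + e + 6) else None"
    and lo = "\<lambda>q. if q = c + 2 \<and> cls (c + 2) \<noteq> [] then Some (c + 1)
        else if q = c + d + 3 then Some top1
        else if q = c + d + 4 \<and> cls (c + d + 4) \<noteq> [] then Some (c + d + 3)
        else if q = c + d + e + 5 then Some top2
        else if q = c + d + e + 6 \<and> cls (c + d + e + 6) \<noteq> [] then Some (c + d + e + 5) else None"
    and Sf = "{q. q = c + 1 \<and> cls (c + 2) = []}"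
    and Del = "{c + d + 3} \<times> {1..<1 + (c + d + 1)}
        \<union> {c + d + e + 6} \<times> {2..<2 + (c + d + e + 2)}" and T = "{(top3, top3 - 1), (top3, top3 - 2)}"], goal_cases)
  case (1 p q) show ?case using assms(2-)
    by (cases "cls (c + 2) = []"; cases "cls (c + d + 4) = []"; cases "cls (c + d + e + 6) = []"; simp; arith?)
next
  case (2 p q) then show ?case using assms(2-) lower_present by (auto simp: linkable_def split: if_splits)
next
  case (3 p) then show ?case by (auto split: if_splits)
qed (((erule present_cases; use assms(2-) in \<open>auto simp: reach_def inset_def split: if_splits\<close>)[1])+,
    (use assms(2-) in auto)[1], simp, simp add: card_insert_if, rule card_two_row_blocks, auto)

text \<open>All parts lie in one run of consecutive numbers. One string alternates between
  \<open>c + 2\<close> and \<open>c + 3\<close>, the other between the inner rows of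
  \<open>c + 4\<close> and \<open>c + 5\<close>; what is given up is \<open>c + 1\<close> and all
  but two rows at either end of \<open>c + 6\<close>.\<close>

lemma two_strings_13:
  assumes inf: "infinite (UNIV :: 'a::field set)" and "cls (c + 2) \<noteq> []" and "cls (c + d + 4) \<noteq> []" and "d = 0" and "e = 0"
  shows "\<exists>A\<in>(tri :: 'a mat set).
    corank_le n (A ^\<^sub>m k) ((c + 1) * length (cls (c + 1)) + (c + d + e + 2) * length (cls (c + d + e + 6)) + k * 2)"
proof (rule rows_corank_le[OF inf, where sg = "\<lambda>q. if q = c + d + 4 then 3
    else if q = c + d + e + 5 then 3 else if q = c + d + e + 6 then 0 else 6"
    and hi = "\<lambda>q. if q = c + 2 then Some (c + d + 3) else if q = c + d + 3 then Some (c + d + 4)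
        else if q = c + d + 4 then Some (c + d + e + 5)
        else if q = c + d + e + 5 \<and> cls (c + d + e + 6) \<noteq> [] then Some (c + d + e + 6) else None"
    and lo = "\<lambda>q. if q = c + d + 3 then Some (c + 2) else if q = c + d + 4 then Some (c + d + 3)
        else if q = c + d + e + 5 then Some (c + d + 4)
        else if q = c + d + e + 6 \<and> cls (c + d + e + 6) \<noteq> [] then Some (c + d + e + 5) else None"
    and Sf = "{q. False}"
    and Del = "{c + 1} \<times> {0..<0 + (c + 1)}
        \<union> {c + d + e + 6} \<times> {2..<2 + (c + d + e + 2)}" and T = "{(top3, top3 - 1), (top3, top3 - 2)}"], goal_cases)
  case (1 p q) show ?case using assms(2-)
    by (cases "cls (c + 2) = []"; cases "cls (c + d + 4) = []"; cases "cls (c + d + e + 6) = []"; simp; arith?)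
next
  case (2 p q) then show ?case using assms(2-) lower_present by (auto simp: linkable_def split: if_splits)
next
  case (3 p) then show ?case by (auto split: if_splits)
qed (((erule present_cases; use assms(2-) in \<open>auto simp: reach_def inset_def split: if_splits\<close>)[1])+,
    (use assms(2-) in auto)[1], simp, simp add: card_insert_if, rule card_two_row_blocks, auto)

end

section \<open>The lower bound on kernels for three pairs\<close>

context three_pairs
begin

abbreviation (input) mult :: "nat \<Rightarrow> nat" where "mult q \<equiv> length (cls q)"

lemma three_antichains:
  fixes A :: "'a::field mat"
  assumes A: "A \<in> tri" and N: "0 < N"
    and N11: "N \<le> (c + 1) * mult (c + 1) + (c + 2) * mult (c + 2)"
    and N22: "N \<le> (c + d + 1) * mult (c + d + 3) + (c + d + 2) * mult (c + d + 4)"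
    and N33: "N \<le> (c + d + e + 1) * mult (c + d + e + 5) + (c + d + e + 2) * mult (c + d + e + 6)"
    and N12: "mult (c + 2) \<noteq> 0 \<Longrightarrow> d = 0 \<Longrightarrow> N \<le> (c + 1) * mult (c + 1) + (c + 2) * mult (c + d + 4)"
    and N23: "mult (c + d + 4) \<noteq> 0 \<Longrightarrow> e = 0 \<Longrightarrow>
      N \<le> (c + d + 1) * mult (c + d + 3) + (c + d + 2) * mult (c + d + e + 6)"
    and N13: "mult (c + 2) \<noteq> 0 \<Longrightarrow> d = 0 \<Longrightarrow> mult (c + d + 4) \<noteq> 0 \<Longrightarrow> e = 0 \<Longrightarrow>
      N \<le> (c + 1) * mult (c + 1) + (c + 2) * mult (c + d + e + 6)"
  shows "corank_ge n (A ^\<^sub>m N) (3 * N)"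
proof -
  define j12 j23 where "j12 \<longleftrightarrow> mult (c + 2) \<noteq> 0 \<and> d = 0" and "j23 \<longleftrightarrow> mult (c + d + 4) \<noteq> 0 \<and> e = 0"
  \<comment> \<open>The number of copies of each larger part that are used. If two pairs touch,
    their values of \<open>l\<close> agree and \<open>B\<close> must be monotone; so the lower
    number is capped by the upper one. The mixed bounds \<open>N12\<close>, \<open>N23\<close> and
    \<open>N13\<close> ensure that enough copies remain.\<close>
  define \<beta>3 where "\<beta>3 = mult (c + d + e + 6)"
  define \<beta>2 where "\<beta>2 = (if j23 then min (mult (c + d + 4)) \<beta>3 else mult (c + d + 4))"
  define \<beta>1 where "\<beta>1 = (if j12 then min (mult (c + 2)) \<beta>2 else mult (c + 2))"
  define l where "l x = (if x = 0 then c + 1 else if x = 1 then c + d + 1 else c + d + e + 1)" for x :: nat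
  define \<beta> where "\<beta> x = (if x = 0 then \<beta>1 else if x = 1 then \<beta>2 else \<beta>3)" for x :: nat
  \<comment> \<open>The second term would spread all \<open>N\<close> steps evenly over the
    \<open>l x + 1\<close> rows of the larger part, leaving none for the smaller part.\<close>
  define B where "B x = min (real (\<beta> x)) (real N / (real (l x) + 1))" for x
  have x3: "x = 0 \<or> x = 1 \<or> x = 2" if "x < 3" for x :: nat using that by auto
  have key: "N \<le> l x * mult (l x + 2 * x) + (l x + 1) * \<beta> x" if "x < 3" for x
  proof -
    have 3: "N \<le> l 2 * mult (l 2 + 2 * 2) + (l 2 + 1) * \<beta> 2"
      using N33 by (simp add: l_def \<beta>_def \<beta>3_def add.commute add.left_commute)
    have 2: "N \<le> l 1 * mult (l 1 + 2 * 1) + (l 1 + 1) * \<beta> 1"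
      using N22 N23 by (auto simp: l_def \<beta>_def \<beta>2_def \<beta>3_def j23_def min_def numeral_eq_Suc)
    have 1: "N \<le> l 0 * mult (l 0 + 2 * 0) + (l 0 + 1) * \<beta> 0"
      using N11 N12 N13 by (auto simp: l_def \<beta>_def \<beta>1_def \<beta>2_def \<beta>3_def j12_def j23_def min_def numeral_eq_Suc)
    show ?thesis using x3[OF that] 1 2 3 by auto
  qed
  have \<beta>_le: "\<beta> x \<le> mult (l x + 2 * x + 1)" if "x < 3" for x
    using x3[OF that] by (auto simp: \<beta>_def \<beta>1_def \<beta>2_def \<beta>3_def l_def numeral_eq_Suc)
  show ?thesis
  proof (rule paired_rows_corank_ge[OF A N, where l = l and B = B])
    fix x :: nat assume x: "x < 3"
    show l: "0 < l x" by (simp add: l_def)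
    show "0 \<le> B x" by (simp add: B_def)
    have "(real (l x) + 1) * B x \<le> (real (l x) + 1) * (real N / (real (l x) + 1))"
      by (intro mult_left_mono) (auto simp: B_def)
    then show "(real (l x) + 1) * B x \<le> real N" by simp
    show "B x \<le> real (mult (l x + 2 * x + 1))" using \<beta>_le[OF x] by (simp add: B_def)
    show "real N - (real (l x) + 1) * B x \<le> real (l x) * real (mult (l x + 2 * x))"
    proof (cases "real (\<beta> x) \<le> real N / (real (l x) + 1)")
      case True
      then have "B x = real (\<beta> x)" by (simp add: B_def)
      moreover have "real N \<le> real (l x) * real (mult (l x + 2 * x)) + (real (l x) + 1) * real (\<beta> x)"
        using of_nat_mono[OF key[OF x], where ?'a = real] by (simp add: algebra_simps)
      ultimately show ?thesis by simp
    next
      case False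
      then have "B x = real N / (real (l x) + 1)" by (simp add: B_def)
      then have "(real (l x) + 1) * B x = real N" by (simp add: add_nonneg_eq_0_iff)
      then show ?thesis by simp
    qed
  next
    fix x :: nat assume "Suc x < 3"
    then have x: "x = 0 \<or> x = 1" by auto
    show "l x < l (Suc x) \<or> l x = l (Suc x) \<and> B x \<le> B (Suc x)"
    proof (cases "l x < l (Suc x)")
      case False
      then have e: "l x = l (Suc x)" using x by (auto simp: l_def)
      have "\<beta> x \<le> \<beta> (Suc x)" using x e
        by (auto simp: \<beta>_def \<beta>1_def \<beta>2_def l_def j12_def j23_def numeral_eq_Suc)
      then show ?thesis unfolding B_def e by (simp add: min.coboundedI1)
    qed simp
  qed
qed

end

lemma parts_of_three:
  assumes Q: "partition_of n Q" and N: "0 < N" and s1: "(\<Sum>q\<in>#Q. min 1 q) \<le> 3"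
    and sN: "3 * N \<le> (\<Sum>q\<in>#Q. min N q)" and sN1: "(\<Sum>q\<in>#Q. min (N + 1) q) \<le> N + (N + 1) * 2"
  shows "parts Q = [index Q, n - index Q - N, N]"
proof -
  have Q0: "0 \<notin># Q" "sum_mset Q = n" using Q by (auto simp: partition_of_def)
  have "(\<Sum>q\<in>#Q. min 1 q) = size Q" using Q0(1) by (induction Q) auto
  then have le3: "size Q \<le> 3" using s1 by simp
  have "(\<Sum>q\<in>#Q. min N q) \<le> N * size Q" by (induction Q) auto
  then have "N * 3 \<le> N * size Q" using sN by linarith
  then have "3 \<le> size Q" using N by (simp only: mult_le_cancel1)
  then have size: "size Q = 3" using le3 by simp
  have len: "length (parts Q) = 3" using size by (metis mset_parts size_mset)
  then obtain x y z where p: "parts Q = [x, y, z]"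
    by (auto simp: numeral_eq_Suc length_Suc_conv)
  then have QQ: "Q = {#x, y, z#}" by (metis mset_parts mset.simps)
  have "sorted (rev (parts Q))" by (simp add: parts_def)
  then have ord: "z \<le> y" "y \<le> x" unfolding p by auto
  have "N \<le> z" using sN ord unfolding QQ by (auto simp: min_def split: if_splits)
  \<comment> \<open>The bound \<open>N + (N + 1) * 2\<close> is one less than
    \<open>3 * (N + 1)\<close>, so not all three parts exceed \<open>N\<close>.\<close>
  moreover have "z \<le> N" using sN1 ord unfolding QQ by (auto simp: min_def split: if_splits)
  ultimately have z: "z = N" by simp
  have "Max (set_mset Q) = x" unfolding QQ using ord by (intro Max_eqI) auto
  then have "index Q = x" by (simp add: index_def)
  moreover have "n = x + y + z" using Q0(2) unfolding QQ by simp
  ultimately show ?thesis unfolding p using z by simp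
qed

section \<open>Almost rectangular decompositions and spreads\<close>

text \<open>The left ends of intervals of two consecutive numbers that cover \<open>P\<close>, as
  found by a greedy choice from below. It is a certificate for \<open>r(P)\<close> in both
  directions: the intervals give a decomposition, and the spacing rules out a shorter one.\<close>

definition skeleton :: "nat multiset \<Rightarrow> nat list \<Rightarrow> bool" where
  "skeleton P os \<longleftrightarrow> sorted_wrt (\<lambda>x y. x + 2 \<le> y) os \<and> set os \<subseteq> set_mset P \<and>
     (\<forall>v\<in>#P. \<exists>x\<in>set os. v = x \<or> v = x + 1)"

lemma skeleton_exists: "\<exists>os. skeleton P os"
proof (induction "card (set_mset P)" arbitrary: P rule: less_induct)
  case less
  show ?case
  proof (cases "P = {#}")
    case True
    then show ?thesis by (intro exI[of _ "[]"]) (simp add: skeleton_def)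
  next
    case False
    define x where "x = Min_mset P"
    have x: "x \<in># P" "\<And>v. v \<in># P \<Longrightarrow> x \<le> v" using False by (auto simp: x_def)
    define P' where "P' = filter_mset (\<lambda>v. x + 1 < v) P"
    have "x \<notin># P'" "set_mset P' \<subseteq> set_mset P" by (auto simp: P'_def)
    then have "set_mset P' \<subset> set_mset P" using x(1) by blast
    then have "card (set_mset P') < card (set_mset P)" by (intro psubset_card_mono) auto
    then obtain os where os: "skeleton P' os" using less by blast
    have "skeleton P (x # os)" unfolding skeleton_def
    proof (intro conjI ballI)
      show "sorted_wrt (\<lambda>x y. x + 2 \<le> y) (x # os)" "set (x # os) \<subseteq> set_mset P"
        using os x(1) by (auto simp: skeleton_def P'_def)
      fix v assume v: "v \<in># P"
      show "\<exists>y\<in>set (x # os). v = y \<or> v = y + 1"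
      proof (cases "x + 1 < v")
        case True
        then show ?thesis using os v by (auto simp: skeleton_def P'_def)
      next
        case False
        then have "v = x \<or> v = x + 1" using x(2)[OF v] by linarith
        then show ?thesis by auto
      qed
    qed
    then show ?thesis by blast
  qed
qed

lemma skeleton_distinct: "sorted_wrt (\<lambda>x y. x + 2 \<le> (y :: nat)) os \<Longrightarrow> distinct os"
  by (induction os) auto

text \<open>Two parts at distance at least 2 cannot lie in the same almost rectangular
  piece.\<close>

lemma skeleton_length_le:
  assumes os: "skeleton P os" and ar: "\<forall>R\<in>#D. almost_rectangular R" and D: "sum_mset D = P"
  shows "length os \<le> size D"
proof -
  have "\<forall>v\<in>set os. \<exists>R. R \<in># D \<and> v \<in># R"
    using os D by (auto simp: skeleton_def in_Union_mset_iff)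
  then obtain f where f: "\<And>v. v \<in> set os \<Longrightarrow> f v \<in># D \<and> v \<in># f v" by metis
  have gap: "v = w \<or> v + 2 \<le> w \<or> w + 2 \<le> v" if "v \<in> set os" "w \<in> set os" for v w
  proof -
    have "sorted_wrt (\<lambda>x y. x + 2 \<le> y) os" using os by (simp add: skeleton_def)
    then show ?thesis using that by (induction os) auto
  qed
  have "inj_on f (set os)"
  proof (rule inj_onI)
    fix v w assume a: "v \<in> set os" "w \<in> set os" "f v = f w"
    have R: "v \<in># f v" "w \<in># f v" "almost_rectangular (f v)" using f[OF a(1)] f[OF a(2)] a(3) ar by auto
    then have m: "Max_mset (f v) \<le> Min_mset (f v) + 1" unfolding almost_rectangular_def by linarith
    have "v \<le> Max_mset (f v)" "w \<le> Max_mset (f v)" "Min_mset (f v) \<le> v" "Min_mset (f v) \<le> w"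
      using R by auto
    then show "v = w" using m gap[OF a(1,2)] by linarith
  qed
  then have "card (set os) \<le> card (set_mset D)"
    using f by (intro card_inj_on_le[of f]) auto
  also have "\<dots> \<le> size D" by (induction D) (auto simp: card_insert_if)
  finally show ?thesis using os by (simp add: skeleton_def skeleton_distinct distinct_card)
qed

lemma skeleton_decomposition:
  "skeleton P os \<Longrightarrow> \<exists>D. size D = length os \<and> (\<forall>R\<in>#D. almost_rectangular R) \<and> sum_mset D = P"
proof (induction os arbitrary: P)
  case Nil
  then have "P = {#}" by (auto simp: skeleton_def)
  then show ?case by (intro exI[of _ "{#}"]) auto
next
  case (Cons x os)
  define R P' where "R = filter_mset (\<lambda>v. v = x \<or> v = x + 1) P" and "P' = filter_mset (\<lambda>v. \<not> (v = x \<or> v = x + 1)) P"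
  have P: "P = R + P'" unfolding R_def P'_def by (rule multiset_partition)
  have s: "sorted_wrt (\<lambda>x y. x + 2 \<le> y) os" "\<forall>y\<in>set os. x + 2 \<le> y" "x \<in># P" "set os \<subseteq> set_mset P"
    "\<forall>v\<in>#P. \<exists>y\<in>set (x # os). v = y \<or> v = y + 1" using Cons.prems by (auto simp: skeleton_def)
  have "skeleton P' os" unfolding skeleton_def
  proof (intro conjI)
    show "set os \<subseteq> set_mset P'" using s(2,4) by (force simp: P'_def)
    show "\<forall>v\<in>#P'. \<exists>y\<in>set os. v = y \<or> v = y + 1" using s(5) by (auto simp: P'_def)
  qed (rule s(1))
  then obtain D where D: "size D = length os" "\<forall>R\<in>#D. almost_rectangular R" "sum_mset D = P'" using Cons.IH by blast
  have xR: "x \<in># R" using s(3) by (simp add: R_def)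
  then have "R \<noteq> {#}" by auto
  then have "Max_mset R \<in># R" "Min_mset R \<in># R" by auto
  then have "almost_rectangular R" using \<open>R \<noteq> {#}\<close> by (auto simp: almost_rectangular_def R_def)
  then show ?case using D P by (intro exI[of _ "add_mset R D"]) auto
qed

lemma ar_number_skeleton:
  assumes "skeleton P os"
  shows "ar_number P = length os"
  unfolding ar_number_def
proof (rule Least_equality)
  show "\<exists>D. size D = length os \<and> (\<forall>R\<in>#D. almost_rectangular R) \<and> sum_mset D = P"
    by (rule skeleton_decomposition[OF assms])
  show "length os \<le> r" if "\<exists>D. size D = r \<and> (\<forall>R\<in>#D. almost_rectangular R) \<and> sum_mset D = P" for r
    using that skeleton_length_le[OF assms] by blast
qed

lemma ar_number_shift_down:
  assumes "\<And>v. v \<in># S \<Longrightarrow> c \<le> v"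
  shows "ar_number (shift_down c S) = ar_number S"
proof -
  obtain os where os: "skeleton S os" using skeleton_exists by blast
  have ge: "\<And>x. x \<in> set os \<Longrightarrow> c \<le> x" using os assms by (auto simp: skeleton_def)
  have "skeleton (shift_down c S) (map (\<lambda>x. x - c) os)"
    unfolding skeleton_def
  proof (intro conjI ballI)
    have "sorted_wrt (\<lambda>x y. x + 2 \<le> y) os" using os by (simp add: skeleton_def)
    then have "sorted_wrt (\<lambda>x y. x - c + 2 \<le> y - c) os"
    proof (rule sorted_wrt_mono_rel[rotated])
      fix x y assume "x \<in> set os" "x + 2 \<le> y"
      then show "x - c + 2 \<le> y - c" using ge[of x] by linarith
    qed
    then show "sorted_wrt (\<lambda>x y. x + 2 \<le> y) (map (\<lambda>x. x - c) os)" by (simp add: sorted_wrt_map)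
    show "set (map (\<lambda>x. x - c) os) \<subseteq> set_mset (shift_down c S)"
      using os by (auto simp: skeleton_def shift_down_def)
    fix v assume "v \<in># shift_down c S"
    then obtain w where w: "w \<in># S" "v = w - c" by (auto simp: shift_down_def)
    then obtain x where "x \<in> set os" "w = x \<or> w = x + 1" using os by (auto simp: skeleton_def)
    then show "\<exists>x\<in>set (map (\<lambda>x. x - c) os). v = x \<or> v = x + 1"
      using w ge[of x] by (intro bexI[of _ "x - c"]) auto
  qed
  then show ?thesis using ar_number_skeleton os by fastforce
qed

section \<open>Spread decompositions and the evaluation of \<open>mu\<close>\<close>

lemma spreadI: "set_mset S = {p..<p + s} \<Longrightarrow> 0 < p \<Longrightarrow> 0 < s \<Longrightarrow> spread S"
  unfolding spread_def by blast

lemma spread_Min_Max: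
  fixes S :: "nat multiset"
  assumes "set_mset S = {p..<p + s}" "0 < s"
  shows "Min_mset S = p" "Max_mset S = p + s - 1"
  unfolding assms(1) using assms(2) by (auto intro!: Min_eqI Max_eqI)

lemma spread_decomposition_tail:
  assumes "successively (\<lambda>S T. Max_mset S + 2 \<le> Min_mset T) (S # Ss)" "\<forall>T\<in>set (S # Ss). spread T" "T \<in> set Ss"
  shows "Max_mset S + 2 \<le> Min_mset T"
  using assms
proof (induction Ss arbitrary: S)
  case (Cons T' Ss)
  have 1: "Max_mset S + 2 \<le> Min_mset T'" using Cons.prems(1) by simp
  show ?case
  proof (cases "T = T'")
    case False
    then have "Max_mset T' + 2 \<le> Min_mset T" using Cons.prems by (intro Cons.IH) auto
    moreover have "Min_mset T' \<le> Max_mset T'"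
    proof -
      have "T' \<noteq> {#}" using Cons.prems(2) by (auto simp: spread_def)
      then show ?thesis by (metis Max_ge Min_in finite_set_mset set_mset_eq_empty_iff)
    qed
    ultimately show ?thesis using 1 by linarith
  qed (use 1 in simp)
qed simp

text \<open>The first spread can be read off from \<open>P\<close>: it takes all parts from the
  smallest up to the first missing number \<open>p + s\<close>. Uniqueness of the whole list follows
  by induction.\<close>

lemma spread_decomposition_Cons:
  assumes "spread_decomposition P (S # Ss)"
  obtains p s where "0 < s" "set_mset S = {p..<p + s}" "p \<in># P" "\<forall>v\<in>#P. p \<le> v" "p + s \<notin># P"
    "S = filter_mset (\<lambda>v. v < p + s) P" "spread_decomposition (P - S) Ss"
proof -
  have a: "P = S + sum_list Ss" "\<forall>T\<in>set (S # Ss). spread T"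
    "successively (\<lambda>S T. Max_mset S + 2 \<le> Min_mset T) (S # Ss)"
    using assms by (auto simp: spread_decomposition_def)
  obtain p s where p: "0 < s" "set_mset S = {p..<p + s}" using a(2) by (auto simp: spread_def)
  have rest: "p + s + 1 \<le> v" if "v \<in># sum_list Ss" for v
  proof -
    have "v \<in># \<Sum>\<^sub># (mset Ss)" using that by (simp add: sum_mset_sum_list)
    then obtain T where T: "T \<in> set Ss" "v \<in># T" by (auto simp: in_Union_mset_iff)
    then have "Max_mset S + 2 \<le> Min_mset T" using spread_decomposition_tail[OF a(3,2)] by blast
    moreover have "Min_mset T \<le> v" using T by simp
    ultimately show ?thesis using spread_Min_Max[OF p(2,1)] p(1) by linarith
  qed
  have "filter_mset (\<lambda>v. v < p + s) P = filter_mset (\<lambda>v. v < p + s) S + filter_mset (\<lambda>v. v < p + s) (sum_list Ss)"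
    using a(1) by simp
  moreover have "filter_mset (\<lambda>v. v < p + s) S = S"
    unfolding filter_mset_eq_conv using p(2) by auto
  moreover have "filter_mset (\<lambda>v. v < p + s) (sum_list Ss) = {#}"
    using rest by (force simp: filter_mset_eq_conv)
  ultimately have S: "S = filter_mset (\<lambda>v. v < p + s) P" by simp
  have mem: "v \<in># P \<longleftrightarrow> v \<in> {p..<p + s} \<or> v \<in># sum_list Ss" for v using p(2) unfolding a(1) by auto
  have "spread_decomposition (P - S) Ss"
    using a by (cases Ss) (auto simp: spread_decomposition_def)
  moreover have "p \<in># P" "\<forall>v\<in>#P. p \<le> v" "p + s \<notin># P" using p(1) rest by (force simp: mem)+
  ultimately show ?thesis using that p S by blast
qed

lemma spread_decomposition_unique:
  "spread_decomposition P Ss \<Longrightarrow> spread_decomposition P Ts \<Longrightarrow> Ss = Ts"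
proof (induction Ss arbitrary: P Ts)
  case Nil
  then have "P = {#}" by (simp add: spread_decomposition_def)
  show ?case
  proof (cases Ts)
    case (Cons T Ts')
    then have "spread_decomposition P (T # Ts')" using Nil(2) by simp
    then obtain p where "p \<in># P" by (rule spread_decomposition_Cons)
    then show ?thesis using \<open>P = {#}\<close> by simp
  qed simp
next
  case (Cons S Ss)
  obtain p s where S: "0 < s" "set_mset S = {p..<p + s}" "p \<in># P" "\<forall>v\<in>#P. p \<le> v" "p + s \<notin># P"
    "S = filter_mset (\<lambda>v. v < p + s) P" "spread_decomposition (P - S) Ss"
    using spread_decomposition_Cons[OF Cons.prems(1)] .
  show ?case
  proof (cases Ts)
    case Nil
    then show ?thesis using Cons.prems(2) S(3) by (simp add: spread_decomposition_def)
  next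
    case (Cons T Ts')
    obtain q t where T: "0 < t" "set_mset T = {q..<q + t}" "q \<in># P" "\<forall>v\<in>#P. q \<le> v" "q + t \<notin># P"
      "T = filter_mset (\<lambda>v. v < q + t) P" "spread_decomposition (P - T) Ts'"
      using spread_decomposition_Cons[OF Cons.prems(2)[unfolded Cons]] .
    have pq: "p = q" using S(3,4) T(3,4) by (meson le_antisym)
    have sub: "set_mset S \<subseteq> set_mset P" "set_mset T \<subseteq> set_mset P" using S(6) T(6) by auto
    have "\<not> s < t" using S(5) sub(2) T(2) pq by auto
    moreover have "\<not> t < s" using T(5) sub(1) S(2) pq by auto
    ultimately have "S = T" using S(6) T(6) pq by simp
    then show ?thesis using Cons.IH[OF S(7)] T(7) Cons by simp
  qed
qed

lemma spreads_eqI: "spread_decomposition P Ss \<Longrightarrow> spreads P = Ss"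
  unfolding spreads_def using spread_decomposition_unique by (intro the_equality) auto

text \<open>The shift changes the coefficients but not the multiplicities. As
  \<open>spread_mult\<close> counts from 1, the positions \<open>2 * i - 1\<close> and
  \<open>2 * j\<close> have offsets \<open>2 * i - 2\<close> and \<open>2 * j - 1\<close> from the
  smallest part.\<close>

lemma spread_mu_shift_down:
  assumes S: "set_mset S = {p..<p + s}" "0 < s" and c: "c \<le> p"
  shows "spread_mu (shift_down c S) = Min {(p - c) * count S (p + (2 * i - 2)) + (p - c + 1) * count S (p + (2 * j - 1)) | i j.
    1 \<le> i \<and> i \<le> j \<and> j \<le> ar_number S}"
proof -
  have ge: "\<And>v. v \<in># S \<Longrightarrow> c \<le> v" using S c by auto
  have cnt: "count (shift_down c S) v = count S (v + c)" for v
  proof -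
    have "count (shift_down c S) v = (\<Sum>x | x \<in># S \<and> v = x - c. count S x)"
      by (simp add: shift_down_def count_image_mset')
    also have "{x. x \<in># S \<and> v = x - c} = (if v + c \<in># S then {v + c} else {})"
    proof -
      have "x \<in># S \<and> v = x - c \<longleftrightarrow> x = v + c \<and> v + c \<in># S" for x using ge[of x] by auto
      then show ?thesis by auto
    qed
    also have "(\<Sum>x\<in>\<dots>. count S x) = count S (v + c)" by (auto simp: not_in_iff)
    finally show ?thesis .
  qed
  have mn: "Min_mset (shift_down c S) = p - c"
    unfolding shift_down_def using S c by (auto intro!: Min_eqI)
  have sm: "spread_mult (shift_down c S) k = count S (p + (k - 1))" if "1 \<le> k" for k
    unfolding spread_mult_def mn cnt using c that by simp
  have "(\<exists>i j. x = (p - c) * spread_mult (shift_down c S) (2 * i - 1) + (p - c + 1) * spread_mult (shift_down c S) (2 * j) \<and>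
      1 \<le> i \<and> i \<le> j \<and> j \<le> ar_number S) \<longleftrightarrow>
    (\<exists>i j. x = (p - c) * count S (p + (2 * i - 2)) + (p - c + 1) * count S (p + (2 * j - 1)) \<and>
      1 \<le> i \<and> i \<le> j \<and> j \<le> ar_number S)" for x
  proof (intro iff_exI)
    fix i j :: nat
    have "2 * i - 1 - 1 = 2 * i - 2" by simp
    then show "(x = (p - c) * spread_mult (shift_down c S) (2 * i - 1) + (p - c + 1) * spread_mult (shift_down c S) (2 * j) \<and>
      1 \<le> i \<and> i \<le> j \<and> j \<le> ar_number S) \<longleftrightarrow>
      (x = (p - c) * count S (p + (2 * i - 2)) + (p - c + 1) * count S (p + (2 * j - 1)) \<and>
      1 \<le> i \<and> i \<le> j \<and> j \<le> ar_number S)"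
      using sm[of "2 * i - 1"] sm[of "2 * j"] by auto
  qed
  moreover have ar: "ar_number (shift_down c S) = ar_number S" by (rule ar_number_shift_down[OF ge])
  ultimately show ?thesis unfolding spread_mu_def mn ar by (intro arg_cong[where f = Min] Collect_cong)
qed

text \<open>The nested minimum is unfolded once into a bound and a place where it is attained. The
  assumption \<open>le\<close> keeps the truncated subtraction \<open>p k - c k\<close>
  honest.\<close>

lemma mu_bounds:
  fixes P :: "nat multiset" and Ss :: "nat multiset list"
  defines "p \<equiv> \<lambda>k. Min_mset (Ss ! k)" and "c \<equiv> \<lambda>k. 2 * (\<Sum>i<k. ar_number (Ss ! i))"
  defines "elt \<equiv> \<lambda>k i j. (p k - c k) * count (Ss ! k) (p k + (2 * i - 2)) +
    (p k - c k + 1) * count (Ss ! k) (p k + (2 * j - 1))"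
  assumes Ss: "spread_decomposition P Ss" and ne: "Ss \<noteq> []" and le: "\<And>k. k < length Ss \<Longrightarrow> c k \<le> p k"
  shows "\<And>k i j. k < length Ss \<Longrightarrow> 1 \<le> i \<Longrightarrow> i \<le> j \<Longrightarrow> j \<le> ar_number (Ss ! k) \<Longrightarrow> mu P \<le> elt k i j"
    and "\<exists>k i j. k < length Ss \<and> 1 \<le> i \<and> i \<le> j \<and> j \<le> ar_number (Ss ! k) \<and> mu P = elt k i j"
proof -
  define F where "F k = {elt k i j | i j. 1 \<le> i \<and> i \<le> j \<and> j \<le> ar_number (Ss ! k)}" for k
  have sp: "spread (Ss ! k)" if "k < length Ss" for k
    using Ss that by (simp add: spread_decomposition_def)
  have sm: "spread_mu (shift_down (c k) (Ss ! k)) = Min (F k)" if k: "k < length Ss" for k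
  proof -
    obtain q s where qs: "set_mset (Ss ! k) = {q..<q + s}" "0 < s" using sp[OF k] by (auto simp: spread_def)
    then have "p k = q" using spread_Min_Max(1)[OF qs] by (simp add: p_def)
    then show ?thesis
      using spread_mu_shift_down[OF qs, of "c k"] le[OF k] by (simp add: F_def elt_def)
  qed
  have mu: "mu P = Min ((\<lambda>k. Min (F k)) ` {..<length Ss})"
  proof -
    have "{spread_mu (shift_down (c k) (Ss ! k)) | k. k < length Ss} =
      (\<lambda>k. spread_mu (shift_down (c k) (Ss ! k))) ` {..<length Ss}" by auto
    also have "\<dots> = (\<lambda>k. Min (F k)) ` {..<length Ss}"
      by (rule image_cong) (use sm in auto)
    finally show ?thesis unfolding mu_def spreads_eqI[OF Ss] c_def by simp
  qed
  have fin: "finite (F k)" for k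
  proof (rule finite_subset)
    show "F k \<subseteq> (\<lambda>(i, j). elt k i j) ` ({..ar_number (Ss ! k)} \<times> {..ar_number (Ss ! k)})"
      by (force simp: F_def)
  qed simp
  have F_ne: "F k \<noteq> {}" if k: "k < length Ss" for k
  proof -
    obtain os where os: "skeleton (Ss ! k) os" using skeleton_exists by blast
    have "Ss ! k \<noteq> {#}" using sp[OF k] by (auto simp: spread_def)
    then have "os \<noteq> []" using os by (auto simp: skeleton_def)
    then have "1 \<le> ar_number (Ss ! k)" using ar_number_skeleton[OF os] by (cases os) auto
    then have "elt k 1 1 \<in> F k" unfolding F_def by blast
    then show ?thesis by blast
  qed
  show "mu P \<le> elt k i j" if "k < length Ss" "1 \<le> i" "i \<le> j" "j \<le> ar_number (Ss ! k)" for k i j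
  proof -
    have "mu P \<le> Min (F k)" unfolding mu using that by (intro Min_le) auto
    also have "\<dots> \<le> elt k i j" using that fin by (intro Min_le) (auto simp: F_def)
    finally show ?thesis .
  qed
  have "mu P \<in> (\<lambda>k. Min (F k)) ` {..<length Ss}" unfolding mu using ne by (intro Min_in) auto
  then obtain k where k: "k < length Ss" "mu P = Min (F k)" by auto
  then have "mu P \<in> F k" using Min_in[OF fin F_ne] by simp
  then show "\<exists>k i j. k < length Ss \<and> 1 \<le> i \<and> i \<le> j \<and> j \<le> ar_number (Ss ! k) \<and> mu P = elt k i j"
    using k unfolding F_def by blast
qed

text \<open>The four cases record which neighbouring pairs share a spread; mixed terms arise only
  there. The coefficients \<open>c + 1\<close>, \<open>c + d + 1\<close>,
  \<open>c + d + e + 1\<close> of the smaller parts hold in all cases: in a common spread the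
  coefficient is the same for all pairs, and there \<open>d = 0\<close> or \<open>e = 0\<close>
  makes these numbers equal.\<close>

lemma mu_three:
  assumes sk: "skeleton P [c + 1, c + d + 3, c + d + e + 5]"
  defines "X \<equiv> \<lambda>p q l. (l + 1) * count P p + (l + 2) * count P q"
  defines "A \<equiv> {X (c + 1) (c + 2) c, X (c + d + 3) (c + d + 4) (c + d), X (c + d + e + 5) (c + d + e + 6) (c + d + e)} \<union>
    (if c + 2 \<in># P \<and> d = 0 then {X (c + 1) (c + d + 4) c} else {}) \<union>
    (if c + d + 4 \<in># P \<and> e = 0 then {X (c + d + 3) (c + d + e + 6) (c + d)} else {}) \<union>
    (if c + 2 \<in># P \<and> d = 0 \<and> c + d + 4 \<in># P \<and> e = 0 then {X (c + 1) (c + d + e + 6) c} else {})"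
  shows "mu P = Min A"
proof -
  define f1 f2 f3 where "f1 = filter_mset (\<lambda>v. v = c + 1 \<or> v = c + 2) P"
    and "f2 = filter_mset (\<lambda>v. v = c + d + 3 \<or> v = c + d + 4) P"
    and "f3 = filter_mset (\<lambda>v. v = c + d + e + 5 \<or> v = c + d + e + 6) P"
  have mem: "c + 1 \<in># P" "c + d + 3 \<in># P" "c + d + e + 5 \<in># P"
    and cov: "\<And>v. v \<in># P \<Longrightarrow> v \<in> {c + 1, c + 2, c + d + 3, c + d + 4, c + d + e + 5, c + d + e + 6}"
    using sk by (auto simp: skeleton_def)
  have P: "P = f1 + f2 + f3"
  proof (rule multiset_eqI)
    fix v show "count P v = count (f1 + f2 + f3) v"
      using cov[of v] by (cases "v \<in># P") (auto simp: f1_def f2_def f3_def not_in_iff)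
  qed
  have two: "{p..<p + (if Q then 2 else 1)} = (if Q then {p, q} else {p})" if "q = p + 1" for p q :: nat and Q
    using that by auto
  have set1: "set_mset f1 = {c + 1..<c + 1 + (if c + 2 \<in># P then 2 else 1)}"
    by (subst two[of "c + 2"]) (use mem in \<open>auto simp: f1_def\<close>)
  have set2: "set_mset f2 = {c + d + 3..<c + d + 3 + (if c + d + 4 \<in># P then 2 else 1)}"
    by (subst two[of "c + d + 4"]) (use mem in \<open>auto simp: f2_def\<close>)
  have set3: "set_mset f3 = {c + d + e + 5..<c + d + e + 5 + (if c + d + e + 6 \<in># P then 2 else 1)}"
    by (subst two[of "c + d + e + 6"]) (use mem in \<open>auto simp: f3_def\<close>)
  note sets = set1 set2 set3
  have cnt: "count f1 v = (if v = c + 1 \<or> v = c + 2 then count P v else 0)"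
    "count f2 v = (if v = c + d + 3 \<or> v = c + d + 4 then count P v else 0)"
    "count f3 v = (if v = c + d + e + 5 \<or> v = c + d + e + 6 then count P v else 0)" for v
    by (auto simp: f1_def f2_def f3_def)
  have finA: "finite A" by (auto simp: A_def)
  consider (00) "\<not> (c + 2 \<in># P \<and> d = 0)" "\<not> (c + d + 4 \<in># P \<and> e = 0)"
    | (10) "c + 2 \<in># P \<and> d = 0" "\<not> (c + d + 4 \<in># P \<and> e = 0)"
    | (01) "\<not> (c + 2 \<in># P \<and> d = 0)" "c + d + 4 \<in># P \<and> e = 0"
    | (11) "c + 2 \<in># P \<and> d = 0" "c + d + 4 \<in># P \<and> e = 0" by blast
  then show ?thesis
  proof cases
    case 00
    let ?Ss = "[f1, f2, f3]"
    have m: "Min_mset f1 = c + 1" "Min_mset f2 = c + d + 3" "Min_mset f3 = c + d + e + 5"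
      "Max_mset f1 + 2 \<le> c + d + 3" "Max_mset f2 + 2 \<le> c + d + e + 5"
      using spread_Min_Max[OF set1] spread_Min_Max[OF set2] spread_Min_Max[OF set3] 00 by auto
    have sd: "spread_decomposition P ?Ss" unfolding spread_decomposition_def
      using P m spreadI[OF set1] spreadI[OF set2] spreadI[OF set3] by (simp add: add.assoc)
    have "skeleton f1 [c + 1]" "skeleton f2 [c + d + 3]" "skeleton f3 [c + d + e + 5]"
      using mem by (auto simp: skeleton_def f1_def f2_def f3_def)
    then have ar: "ar_number f1 = 1" "ar_number f2 = 1" "ar_number f3 = 1"
      by (simp_all add: ar_number_skeleton)
    have k3: "k = 0 \<or> k = 1 \<or> k = 2" if "k < length ?Ss" for k using that by auto
    note mb = mu_bounds[OF sd]
    have le: "2 * (\<Sum>i<k. ar_number (?Ss ! i)) \<le> Min_mset (?Ss ! k)" if "k < length ?Ss" for k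
      using k3[OF that] m ar by (auto simp: numeral_2_eq_2)
    show ?thesis
    proof (rule Min_eqI[symmetric, OF finA])
      show "mu P \<le> y" if "y \<in> A" for y
        using that mb(1)[of 0 1 1] mb(1)[of 1 1 1] mb(1)[of 2 1 1] le 00 m ar
        by (auto simp: A_def X_def cnt numeral_eq_Suc ac_simps split: if_splits)
      obtain k i j where kij: "k < length ?Ss" "1 \<le> i" "i \<le> j" "j \<le> ar_number (?Ss ! k)"
        "mu P = (Min_mset (?Ss ! k) - 2 * (\<Sum>i<k. ar_number (?Ss ! i))) * count (?Ss ! k) (Min_mset (?Ss ! k) + (2 * i - 2)) +
          (Min_mset (?Ss ! k) - 2 * (\<Sum>i<k. ar_number (?Ss ! i)) + 1) * count (?Ss ! k) (Min_mset (?Ss ! k) + (2 * j - 1))"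
        using mb(2) le by blast
      have "i = 1" "j = 1" using k3[OF kij(1)] kij(2-4) ar by auto
      then show "mu P \<in> A" using k3[OF kij(1)] kij(5) m ar
        by (auto simp: A_def X_def cnt numeral_eq_Suc ac_simps)
    qed
  next
    case 10
    let ?Ss = "[f1 + f2, f3]"
    have set12: "set_mset (f1 + f2) = {c + 1..<c + 1 + (2 + (if c + d + 4 \<in># P then 2 else 1))}"
      using 10 by (auto simp: set1 set2)
    have m: "Min_mset (f1 + f2) = c + 1" "Min_mset f3 = c + d + e + 5" "Max_mset (f1 + f2) + 2 \<le> c + d + e + 5"
      using spread_Min_Max[OF set12] spread_Min_Max[OF set3] 10 by auto
    have sd: "spread_decomposition P ?Ss" unfolding spread_decomposition_def
      using P m spreadI[OF set12] spreadI[OF set3] by (simp add: add.assoc)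
    have "skeleton (f1 + f2) [c + 1, c + d + 3]" "skeleton f3 [c + d + e + 5]"
      using mem 10 by (auto simp: skeleton_def f1_def f2_def f3_def)
    then have ar: "ar_number (f1 + f2) = 2" "ar_number f3 = 1"
      by (simp_all add: ar_number_skeleton)
    have k3: "k = 0 \<or> k = 1" if "k < length ?Ss" for k using that by auto
    note mb = mu_bounds[OF sd]
    have le: "2 * (\<Sum>i<k. ar_number (?Ss ! i)) \<le> Min_mset (?Ss ! k)" if "k < length ?Ss" for k
      using k3[OF that] m ar by (auto simp: numeral_2_eq_2)
    show ?thesis
    proof (rule Min_eqI[symmetric, OF finA])
      show "mu P \<le> y" if "y \<in> A" for y
        using that mb(1)[of 0 1 1] mb(1)[of 0 1 2] mb(1)[of 0 2 2] mb(1)[of 1 1 1] le 10 m ar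
        by (auto simp: A_def X_def cnt numeral_eq_Suc ac_simps split: if_splits)
      obtain k i j where kij: "k < length ?Ss" "1 \<le> i" "i \<le> j" "j \<le> ar_number (?Ss ! k)"
        "mu P = (Min_mset (?Ss ! k) - 2 * (\<Sum>i<k. ar_number (?Ss ! i))) * count (?Ss ! k) (Min_mset (?Ss ! k) + (2 * i - 2)) +
          (Min_mset (?Ss ! k) - 2 * (\<Sum>i<k. ar_number (?Ss ! i)) + 1) * count (?Ss ! k) (Min_mset (?Ss ! k) + (2 * j - 1))"
        using mb(2) le by blast
      have "k = 0 \<and> i = 1 \<and> j = 1 \<or> k = 0 \<and> i = 1 \<and> j = 2 \<or> k = 0 \<and> i = 2 \<and> j = 2 \<or> k = 1 \<and> i = 1 \<and> j = 1"
        using k3[OF kij(1)] kij(2-4) ar by auto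
      then show "mu P \<in> A" using kij(5) m ar 10
        by (auto simp: A_def X_def cnt numeral_eq_Suc ac_simps)
    qed
  next
    case 01
    let ?Ss = "[f1, f2 + f3]"
    have set23: "set_mset (f2 + f3) = {c + d + 3..<c + d + 3 + (2 + (if c + d + e + 6 \<in># P then 2 else 1))}"
      using 01 by (auto simp: set2 set3)
    have m: "Min_mset f1 = c + 1" "Min_mset (f2 + f3) = c + d + 3" "Max_mset f1 + 2 \<le> c + d + 3"
      using spread_Min_Max[OF set1] spread_Min_Max[OF set23] 01 by auto
    have sd: "spread_decomposition P ?Ss" unfolding spread_decomposition_def
      using P m spreadI[OF set1] spreadI[OF set23] by (simp add: add.assoc)
    have "skeleton f1 [c + 1]" "skeleton (f2 + f3) [c + d + 3, c + d + e + 5]"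
      using mem 01 by (auto simp: skeleton_def f1_def f2_def f3_def)
    then have ar: "ar_number f1 = 1" "ar_number (f2 + f3) = 2"
      by (simp_all add: ar_number_skeleton)
    have k3: "k = 0 \<or> k = 1" if "k < length ?Ss" for k using that by auto
    note mb = mu_bounds[OF sd]
    have le: "2 * (\<Sum>i<k. ar_number (?Ss ! i)) \<le> Min_mset (?Ss ! k)" if "k < length ?Ss" for k
      using k3[OF that] m ar by (auto simp: numeral_2_eq_2)
    show ?thesis
    proof (rule Min_eqI[symmetric, OF finA])
      show "mu P \<le> y" if "y \<in> A" for y
        using that mb(1)[of 0 1 1] mb(1)[of 1 1 1] mb(1)[of 1 1 2] mb(1)[of 1 2 2] le 01 m ar
        by (auto simp: A_def X_def cnt numeral_eq_Suc ac_simps split: if_splits)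
      obtain k i j where kij: "k < length ?Ss" "1 \<le> i" "i \<le> j" "j \<le> ar_number (?Ss ! k)"
        "mu P = (Min_mset (?Ss ! k) - 2 * (\<Sum>i<k. ar_number (?Ss ! i))) * count (?Ss ! k) (Min_mset (?Ss ! k) + (2 * i - 2)) +
          (Min_mset (?Ss ! k) - 2 * (\<Sum>i<k. ar_number (?Ss ! i)) + 1) * count (?Ss ! k) (Min_mset (?Ss ! k) + (2 * j - 1))"
        using mb(2) le by blast
      have "k = 0 \<and> i = 1 \<and> j = 1 \<or> k = 1 \<and> i = 1 \<and> j = 1 \<or> k = 1 \<and> i = 1 \<and> j = 2 \<or> k = 1 \<and> i = 2 \<and> j = 2"
        using k3[OF kij(1)] kij(2-4) ar by auto
      then show "mu P \<in> A" using kij(5) m ar 01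
        by (auto simp: A_def X_def cnt numeral_eq_Suc ac_simps)
    qed
  next
    case 11
    let ?Ss = "[f1 + f2 + f3]"
    have set123: "set_mset (f1 + f2 + f3) = {c + 1..<c + 1 + (4 + (if c + d + e + 6 \<in># P then 2 else 1))}"
      using 11 by (auto simp: set1 set2 set3)
    have m: "Min_mset (f1 + f2 + f3) = c + 1"
      using spread_Min_Max[OF set123] 11 by auto
    have sd: "spread_decomposition P ?Ss" unfolding spread_decomposition_def
      using P m spreadI[OF set123] by (simp add: add.assoc)
    have "skeleton (f1 + f2 + f3) [c + 1, c + d + 3, c + d + e + 5]"
      using mem 11 by (auto simp: skeleton_def f1_def f2_def f3_def)
    then have ar: "ar_number (f1 + f2 + f3) = 3"
      by (simp_all add: ar_number_skeleton)
    have k3: "k = 0" if "k < length ?Ss" for k using that by auto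
    note mb = mu_bounds[OF sd]
    have le: "2 * (\<Sum>i<k. ar_number (?Ss ! i)) \<le> Min_mset (?Ss ! k)" if "k < length ?Ss" for k
      using k3[OF that] m ar by (auto simp: numeral_2_eq_2)
    show ?thesis
    proof (rule Min_eqI[symmetric, OF finA])
      show "mu P \<le> y" if "y \<in> A" for y
        using that mb(1)[of 0 1 1] mb(1)[of 0 1 2] mb(1)[of 0 1 3] mb(1)[of 0 2 2] mb(1)[of 0 2 3] mb(1)[of 0 3 3] le 11 m ar
        by (auto simp: A_def X_def cnt numeral_eq_Suc ac_simps split: if_splits)
      obtain k i j where kij: "k < length ?Ss" "1 \<le> i" "i \<le> j" "j \<le> ar_number (?Ss ! k)"
        "mu P = (Min_mset (?Ss ! k) - 2 * (\<Sum>i<k. ar_number (?Ss ! i))) * count (?Ss ! k) (Min_mset (?Ss ! k) + (2 * i - 2)) +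
          (Min_mset (?Ss ! k) - 2 * (\<Sum>i<k. ar_number (?Ss ! i)) + 1) * count (?Ss ! k) (Min_mset (?Ss ! k) + (2 * j - 1))"
        using mb(2) le by blast
      have "k = 0 \<and> i = 1 \<and> j = 1 \<or> k = 0 \<and> i = 1 \<and> j = 2 \<or> k = 0 \<and> i = 1 \<and> j = 3 \<or> k = 0 \<and> i = 2 \<and> j = 2 \<or> k = 0 \<and> i = 2 \<and> j = 3 \<or> k = 0 \<and> i = 3 \<and> j = 3"
        using k3[OF kij(1)] kij(2-4) ar by auto
      then show "mu P \<in> A" using kij(5) m ar 11
        by (auto simp: A_def X_def cnt numeral_eq_Suc ac_simps)
    qed
  qed
qed

theorem corollary4p6:
  fixes P :: "nat multiset" and n :: nat
  assumes "infinite (UNIV :: 'k::field set)"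
    and "partition_of n P"
    and "ar_number P = 3"
  shows "parts (generic_partition TYPE('k) P) =
           [index (generic_partition TYPE('k) P),
            n - index (generic_partition TYPE('k) P) - mu P,
            mu P]"
proof -
  have P0: "0 \<notin># P" "sum_mset P = n" using assms(2) by (auto simp: partition_of_def)
  obtain os where os: "skeleton P os" using skeleton_exists by blast
  then have "length os = 3" using ar_number_skeleton assms(3) by metis
  then obtain x y z where xyz: "os = [x, y, z]" by (auto simp: numeral_eq_Suc length_Suc_conv)
  then have gaps: "x + 2 \<le> y" "y + 2 \<le> z" and mem: "x \<in># P" using os by (auto simp: skeleton_def)
  have "x \<noteq> 0" using mem P0(1) by metis
  then obtain c where c: "x = c + 1" by (metis Suc_eq_plus1 not0_implies_Suc)
  obtain d where d: "y = c + d + 3" using gaps(1) c le_Suc_ex[of "x + 2" y] by auto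
  obtain e where e: "z = c + d + e + 5" using gaps(2) d le_Suc_ex[of "y + 2" z] by auto
  have sk: "skeleton P [c + 1, c + d + 3, c + d + e + 5]" using os xyz c d e by simp
  let ?blk = "jordan_blk (parts P)" and ?ht = "jordan_ht (parts P)"
  have setP: "set (parts P) = set_mset P" by (metis mset_parts set_mset_mset)
  interpret pos_block_coords n "length (parts P)" "(!) (parts P)" ?blk ?ht
  proof (intro pos_block_coords.intro pos_block_coords_axioms.intro)
    show "block_coords n (length (parts P)) ((!) (parts P)) ?blk ?ht"
      using jordan_coords[of "parts P"] P0(2) by simp
    show "0 < parts P ! b" if "b < length (parts P)" for b
      using nth_mem[OF that] setP P0(1) by (metis gr0I)
  qed
  have cls: "length (cls q) = count P q" for q
  proof -
    have "length (cls q) = card {b. b < length (parts P) \<and> parts P ! b = q}" by (simp add: cls_def)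
    also have "\<dots> = length (filter (\<lambda>p. p = q) (parts P))" by (simp add: length_filter_conv_card)
    also have "\<dots> = count (mset (parts P)) q" by (simp add: count_mset count_list_eq_length_filter eq_commute[of _ q] del: mset_parts)
    finally show ?thesis by simp
  qed
  have cls_ne: "cls q \<noteq> [] \<longleftrightarrow> q \<in># P" for q
    using cls[of q] by (metis count_greater_zero_iff length_greater_0_conv)
  interpret three_pairs n "length (parts P)" "(!) (parts P)" ?blk ?ht c d e
  proof unfold_locales
    show "q \<in> {c + 1, c + 2, c + d + 3, c + d + 4, c + d + e + 5, c + d + e + 6}" if "cls q \<noteq> []" for q
      using that sk unfolding cls_ne by (auto simp: skeleton_def)
    show "cls (c + 1) \<noteq> []" "cls (c + d + 3) \<noteq> []" "cls (c + d + e + 5) \<noteq> []"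
      using sk unfolding cls_ne by (auto simp: skeleton_def)
  qed
  have J: "nilp_jordan_matrix P = (J :: 'k mat)" by (simp add: nilp_jordan_matrix_shift_mat P0(2))
  note gen = generic_partition_minimizes_corank[OF assms(1) P0(2) J]
  let ?Q = "generic_partition TYPE('k) P"
  define X where "X p q l = (l + 1) * count P p + (l + 2) * count P q" for p q l
  define S where "S = {X (c + 1) (c + 2) c, X (c + d + 3) (c + d + 4) (c + d), X (c + d + e + 5) (c + d + e + 6) (c + d + e)} \<union>
    (if c + 2 \<in># P \<and> d = 0 then {X (c + 1) (c + d + 4) c} else {}) \<union>
    (if c + d + 4 \<in># P \<and> e = 0 then {X (c + d + 3) (c + d + e + 6) (c + d)} else {}) \<union>
    (if c + 2 \<in># P \<and> d = 0 \<and> c + d + 4 \<in># P \<and> e = 0 then {X (c + 1) (c + d + e + 6) c} else {})"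
  have mu: "mu P = Min S" unfolding S_def X_def by (rule mu_three[OF sk])
  have fin: "finite S" and ne: "S \<noteq> {}" by (auto simp: S_def)
  have mu_le: "mu P \<le> v" if "v \<in> S" for v unfolding mu using fin that by (rule Min_le)
  have mu_in: "mu P \<in> S" unfolding mu using fin ne by (rule Min_in)
  have low: "count P (c + 1) \<noteq> 0" "count P (c + d + 3) \<noteq> 0" "count P (c + d + e + 5) \<noteq> 0"
    using sk by (auto simp: skeleton_def)
  have pos: "0 < mu P" using mu_in low by (auto simp: S_def X_def split: if_splits)
  have anti: "corank_ge n (A ^\<^sub>m mu P) (3 * mu P)" if "A \<in> (tri :: 'k mat set)" for A
  proof (rule three_antichains[OF that pos])
    show "mu P \<le> (c + 1) * length (cls (c + 1)) + (c + 2) * length (cls (c + 2))"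
      unfolding cls using mu_le[of "X (c + 1) (c + 2) c"] by (simp add: S_def X_def)
    show "mu P \<le> (c + d + 1) * length (cls (c + d + 3)) + (c + d + 2) * length (cls (c + d + 4))"
      unfolding cls using mu_le[of "X (c + d + 3) (c + d + 4) (c + d)"] by (simp add: S_def X_def)
    show "mu P \<le> (c + d + e + 1) * length (cls (c + d + e + 5)) + (c + d + e + 2) * length (cls (c + d + e + 6))"
      unfolding cls using mu_le[of "X (c + d + e + 5) (c + d + e + 6) (c + d + e)"] by (simp add: S_def X_def)
    show "mu P \<le> (c + 1) * length (cls (c + 1)) + (c + 2) * length (cls (c + d + 4))"
      if "length (cls (c + 2)) \<noteq> 0" "d = 0"
      using that mu_le[of "X (c + 1) (c + d + 4) c"] unfolding cls by (simp add: S_def X_def)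
    show "mu P \<le> (c + d + 1) * length (cls (c + d + 3)) + (c + d + 2) * length (cls (c + d + e + 6))"
      if "length (cls (c + d + 4)) \<noteq> 0" "e = 0"
      using that mu_le[of "X (c + d + 3) (c + d + e + 6) (c + d)"] unfolding cls by (simp add: S_def X_def)
    show "mu P \<le> (c + 1) * length (cls (c + 1)) + (c + 2) * length (cls (c + d + e + 6))"
      if "length (cls (c + 2)) \<noteq> 0" "d = 0" "length (cls (c + d + 4)) \<noteq> 0" "e = 0"
      using that mu_le[of "X (c + 1) (c + d + e + 6) c"] unfolding cls by (simp add: S_def X_def)
  qed
  have strings: "\<exists>A\<in>(tri :: 'k mat set). corank_le n (A ^\<^sub>m k) (mu P + k * 2)" for k
  proof -
    note s = two_strings_11[OF assms(1), of k] two_strings_22[OF assms(1), of k] two_strings_33[OF assms(1), of k]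
      two_strings_12[OF assms(1), of k] two_strings_23[OF assms(1), of k] two_strings_13[OF assms(1), of k]
    \<comment> \<open>Each candidate for the minimum is the number of basis vectors given up in one
      of the constructions with two strings.\<close>
    consider "mu P = X (c + 1) (c + 2) c" | "mu P = X (c + d + 3) (c + d + 4) (c + d)"
      | "mu P = X (c + d + e + 5) (c + d + e + 6) (c + d + e)"
      | "c + 2 \<in># P" "d = 0" "mu P = X (c + 1) (c + d + 4) c"
      | "c + d + 4 \<in># P" "e = 0" "mu P = X (c + d + 3) (c + d + e + 6) (c + d)"
      | "c + 2 \<in># P" "c + d + 4 \<in># P" "d = 0" "e = 0" "mu P = X (c + 1) (c + d + e + 6) c"
      using mu_in by (auto simp: S_def split: if_splits)
    then show ?thesis
    proof cases
      case 1 then show ?thesis using s(1) unfolding cls by (simp add: X_def)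
    next
      case 2 then show ?thesis using s(2) unfolding cls by (simp add: X_def)
    next
      case 3 then show ?thesis using s(3) unfolding cls by (simp add: X_def)
    next
      case 4 then show ?thesis using s(4) unfolding cls cls_ne by (simp add: X_def)
    next
      case 5 then show ?thesis using s(5) unfolding cls cls_ne by (simp add: X_def)
    next
      case 6 then show ?thesis using s(6) unfolding cls cls_ne by (simp add: X_def)
    qed
  qed
  \<comment> \<open>The lower bound holds on all of \<open>tri\<close>, hence for a matrix of
    generic type; the upper bounds come from other matrices through minimality.\<close>
  obtain A where A: "A \<in> (tri :: 'k mat set)" "has_jordan_type A ?Q" using gen(2) by blast
  have "3 * mu P \<le> (\<Sum>q\<in>#?Q. min (mu P) q)"
    using corank_ge_le[OF anti[OF A(1)] has_jordan_type_corank(1)[OF tri_carrier[OF A(1)] A(2)]] .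
  moreover have "(\<Sum>q\<in>#?Q. min (mu P + 1) q) \<le> mu P + (mu P + 1) * 2"
    using strings[of "mu P + 1"] gen(3) by blast
  moreover have "(\<Sum>q\<in>#?Q. min 1 q) \<le> 3"
    using three_strings[OF assms(1), of 1] gen(3)[of _ 1 3] by auto
  ultimately show ?thesis using parts_of_three[OF gen(1) pos] by blast
qed

end
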